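(* Let $\mathcal{C}$ be a non-trivial extension-closed pseudovariety of finite groups. For each $i\in\{1,2\}$ let $F_i$ be either a non-abelian free group or a non-elementary $\mathcal{C}$-hereditarily conjugacy separable hyperbolic group without non-trivial finite normal subgroups. Let $G\leqslant F_1\times F_2$ be a subdirect product which has finite index in $F_1\times F_2$. Then the following statements are equivalent: (1) $G$ is $\mathcal{C}$-conjugacy separable; (2) $F_1/N_1\in\mathcal{C}$, where $N_1:=G\cap F_1$; (3) $G$ is open in the pro-$\mathcal{C}$ topology on $F_1\times F_2$.
   Context: A pseudovariety of groups is a class of groups closed under isomorphisms, subgroups, direct products of two members, and quotients; it is a pseudovariety of finite groups if all its members are finite, non-trivial if it contains a non-trivial group, and extension-closed if any group $A$ with a normal subgroup $N$ such that $N\in\mathcal{C}$ and $A/N\in\mathcal{C}$ belongs to $\mathcal{C}$. The pro-$\mathcal{C}$ topology on a group $A$ has as basic open sets the cosets of the normal subgroups $N\lhd A$ with $A/N\in\mathcal{C}$. A group $A$ is $\mathcal{C}$-conjugacy separable if for any two non-conjugate elements $x,y\in A$ there are $M\in\mathcal{C}$ and a homomorphism $\varphi:A\to M$ such that $\varphi(x)$ and $\varphi(y)$ are not conjugate in $M$. $A$ is $\mathcal{C}$-hereditarily conjugacy separable if every subgroup of $A$ which is open in the pro-$\mathcal{C}$ topology on $A$ is $\mathcal{C}$-conjugacy separable. In $F_1\times F_2$ one identifies $F_1$ with $F_1\times\{1\}$ and $F_2$ with $\{1\}\times F_2$. A subgroup $G\leqslant F_1\times F_2$ is a subdirect product if both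 coordinate projections map $G$ onto $F_1$ and $F_2$ respectively; then $G\cap F_i\lhd F_i$. "Hyperbolic" means hyperbolic in the sense of Gromov; a group is elementary if it has a cyclic subgroup of finite index. *)

theory Defs
  imports "HOL-Algebra.Elementary_Groups" "HOL-Analysis.Abstract_Topology"
begin

section \<open>Pseudovarieties of finite groups\<close>

text \<open>
  A class of finite groups closed under isomorphism is determined by its members whose
  elements are natural numbers, since every finite group is isomorphic to such a group.
  It is therefore represented by a set of groups of type \<^typ>\<open>nat monoid\<close>, and a group over an
  arbitrary type belongs to the class if it is isomorphic to an element of this set.
\<close>

definition in_class :: "nat monoid set \<Rightarrow> ('a, 'm) monoid_scheme \<Rightarrow> bool" where
  "in_class \<C> A \<longleftrightarrow> group A \<and> (\<exists>M\<in>\<C>. A \<cong> M)"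

definition pseudovariety_of_finite_groups :: "nat monoid set \<Rightarrow> bool" where
  "pseudovariety_of_finite_groups \<C> \<longleftrightarrow>
     (\<forall>A\<in>\<C>. group A \<and> finite (carrier A)) \<and>
     (\<forall>A. in_class \<C> A \<longrightarrow> A \<in> \<C>) \<and>
     (\<forall>A\<in>\<C>. \<forall>H. subgroup H A \<longrightarrow> in_class \<C> (A\<lparr>carrier := H\<rparr>)) \<and>
     (\<forall>A\<in>\<C>. \<forall>B\<in>\<C>. in_class \<C> (A \<times>\<times> B)) \<and>
     (\<forall>A\<in>\<C>. \<forall>N. N \<lhd> A \<longrightarrow> in_class \<C> (A Mod N))"

definition nontrivial_class :: "nat monoid set \<Rightarrow> bool" where
  "nontrivial_class \<C> \<longleftrightarrow> (\<exists>A\<in>\<C>. \<not> trivial_group A)"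

text \<open>
  An extension of a finite group by a finite group is finite, so that it suffices to let the
  extension range over groups of natural numbers.
\<close>

definition extension_closed :: "nat monoid set \<Rightarrow> bool" where
  "extension_closed \<C> \<longleftrightarrow>
     (\<forall>(A :: nat monoid) N. N \<lhd> A \<longrightarrow> in_class \<C> (A\<lparr>carrier := N\<rparr>) \<longrightarrow> in_class \<C> (A Mod N)
        \<longrightarrow> in_class \<C> A)"


section \<open>The pro-$\mathcal{C}$ topology and conjugacy separability\<close>

definition pro_topology :: "nat monoid set \<Rightarrow> ('a, 'm) monoid_scheme \<Rightarrow> 'a topology" where
  "pro_topology \<C> A =
     topology_generated_by {N #>\<^bsub>A\<^esub> x | N x. N \<lhd> A \<and> in_class \<C> (A Mod N) \<and> x \<in> carrier A}"

definition conjugate_in :: "('a, 'm) monoid_scheme \<Rightarrow> 'a \<Rightarrow> 'a \<Rightarrow> bool" where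
  "conjugate_in A x y \<longleftrightarrow> (\<exists>g\<in>carrier A. y = g \<otimes>\<^bsub>A\<^esub> x \<otimes>\<^bsub>A\<^esub> inv\<^bsub>A\<^esub> g)"

definition conjugacy_separable :: "nat monoid set \<Rightarrow> ('a, 'm) monoid_scheme \<Rightarrow> bool" where
  "conjugacy_separable \<C> A \<longleftrightarrow>
     (\<forall>x\<in>carrier A. \<forall>y\<in>carrier A. \<not> conjugate_in A x y \<longrightarrow>
        (\<exists>M\<in>\<C>. \<exists>\<phi>\<in>hom A M. \<not> conjugate_in M (\<phi> x) (\<phi> y)))"

definition hereditarily_conjugacy_separable ::
    "nat monoid set \<Rightarrow> ('a, 'm) monoid_scheme \<Rightarrow> bool" where
  "hereditarily_conjugacy_separable \<C> A \<longleftrightarrow>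
     (\<forall>H. subgroup H A \<and> openin (pro_topology \<C> A) H \<longrightarrow>
        conjugacy_separable \<C> (A\<lparr>carrier := H\<rparr>))"


section \<open>Words, free groups and hyperbolic groups\<close>

text \<open>
  A word over a set \<open>X\<close> of group elements is a list of letters \<open>(x, b)\<close> with \<open>x \<in> X\<close>, where
  \<open>(x, True)\<close> stands for \<open>x\<close> and \<open>(x, False)\<close> for the inverse of \<open>x\<close>.
\<close>

definition letter_val :: "('a, 'm) monoid_scheme \<Rightarrow> 'a \<times> bool \<Rightarrow> 'a" where
  "letter_val A l = (if snd l then fst l else inv\<^bsub>A\<^esub> (fst l))"

definition word_val :: "('a, 'm) monoid_scheme \<Rightarrow> ('a \<times> bool) list \<Rightarrow> 'a" where
  "word_val A w = foldr (\<lambda>l g. letter_val A l \<otimes>\<^bsub>A\<^esub> g) w \<one>\<^bsub>A\<^esub>"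

definition words_over :: "'a set \<Rightarrow> ('a \<times> bool) list set" where
  "words_over X = lists (X \<times> UNIV)"

definition reduced_word :: "('a \<times> bool) list \<Rightarrow> bool" where
  "reduced_word w \<longleftrightarrow>
     (\<forall>i. Suc i < length w \<longrightarrow>
        \<not> (fst (w ! i) = fst (w ! Suc i) \<and> snd (w ! i) \<noteq> snd (w ! Suc i)))"

text \<open>The rank of a free group may be infinite.\<close>

definition free_basis :: "('a, 'm) monoid_scheme \<Rightarrow> 'a set \<Rightarrow> bool" where
  "free_basis A X \<longleftrightarrow> X \<subseteq> carrier A \<and>
     (\<forall>g\<in>carrier A. \<exists>!w. w \<in> words_over X \<and> reduced_word w \<and> word_val A w = g)"

definition is_free_group :: "('a, 'm) monoid_scheme \<Rightarrow> bool" where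
  "is_free_group A \<longleftrightarrow> group A \<and> (\<exists>X. free_basis A X)"

text \<open>The word length below is only meaningful on the subgroup generated by \<open>S\<close>.\<close>

definition word_length :: "('a, 'm) monoid_scheme \<Rightarrow> 'a set \<Rightarrow> 'a \<Rightarrow> nat" where
  "word_length A S g = (LEAST n. \<exists>w\<in>words_over S. length w = n \<and> word_val A w = g)"

definition word_metric :: "('a, 'm) monoid_scheme \<Rightarrow> 'a set \<Rightarrow> 'a \<Rightarrow> 'a \<Rightarrow> real" where
  "word_metric A S x y = real (word_length A S (inv\<^bsub>A\<^esub> x \<otimes>\<^bsub>A\<^esub> y))"

definition Gromov_product :: "('a \<Rightarrow> 'a \<Rightarrow> real) \<Rightarrow> 'a \<Rightarrow> 'a \<Rightarrow> 'a \<Rightarrow> real" where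
  "Gromov_product d w x y = (d w x + d w y - d x y) / 2"

definition Gromov_hyperbolic_on :: "'a set \<Rightarrow> ('a \<Rightarrow> 'a \<Rightarrow> real) \<Rightarrow> bool" where
  "Gromov_hyperbolic_on M d \<longleftrightarrow>
     (\<exists>\<delta>\<ge>0. \<forall>w\<in>M. \<forall>x\<in>M. \<forall>y\<in>M. \<forall>z\<in>M.
        Gromov_product d w x z \<ge> min (Gromov_product d w x y) (Gromov_product d w y z) - \<delta>)"

definition hyperbolic_group :: "('a, 'm) monoid_scheme \<Rightarrow> bool" where
  "hyperbolic_group A \<longleftrightarrow> group A \<and>
     (\<exists>S. finite S \<and> S \<subseteq> carrier A \<and> generate A S = carrier A \<and>
        Gromov_hyperbolic_on (carrier A) (word_metric A S))"


section \<open>Finite index, elementary groups and subdirect products\<close>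

definition finite_index :: "('a, 'm) monoid_scheme \<Rightarrow> 'a set \<Rightarrow> bool" where
  "finite_index A H \<longleftrightarrow> subgroup H A \<and> finite (rcosets\<^bsub>A\<^esub> H)"

definition elementary_group :: "('a, 'm) monoid_scheme \<Rightarrow> bool" where
  "elementary_group A \<longleftrightarrow>
     (\<exists>H. subgroup H A \<and> cyclic_group (A\<lparr>carrier := H\<rparr>) \<and> finite_index A H)"

definition no_nontrivial_finite_normal_subgroup :: "('a, 'm) monoid_scheme \<Rightarrow> bool" where
  "no_nontrivial_finite_normal_subgroup A \<longleftrightarrow> (\<forall>N. N \<lhd> A \<and> finite N \<longrightarrow> N = {\<one>\<^bsub>A\<^esub>})"

definition subdirect_product ::
    "('a, 'm) monoid_scheme \<Rightarrow> ('b, 'n) monoid_scheme \<Rightarrow> ('a \<times> 'b) set \<Rightarrow> bool" where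
  "subdirect_product A B G \<longleftrightarrow>
     subgroup G (A \<times>\<times> B) \<and> fst ` G = carrier A \<and> snd ` G = carrier B"

text \<open>
  The intersection of \<open>G\<close> with the first factor, as a subset of \<open>A\<close> (via the identification of
  \<open>A\<close> with \<open>A \<times> {1}\<close>).
\<close>

definition inter_first_factor ::
    "('a, 'm) monoid_scheme \<Rightarrow> ('b, 'n) monoid_scheme \<Rightarrow> ('a \<times> 'b) set \<Rightarrow> 'a set" where
  "inter_first_factor A B G = {x \<in> carrier A. (x, \<one>\<^bsub>B\<^esub>) \<in> G}"

end

theory Submission
  imports Defs "HOL-Algebra.Multiplicative_Group" "HOL-Algebra.SndIsomorphismGrp"
begin

text \<open>
  Let \<open>N\<^sub>i = G \<inter> F\<^sub>i\<close>. If \<open>F\<^sub>1/N\<^sub>1\<close> is not in \<open>\<C>\<close>, some \<open>(f, f\<^sub>2) \<in> G\<close> with \<open>f \<notin> N\<^sub>1\<close> lies in the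
  pro-\<open>\<C>\<close> closure of \<open>N\<^sub>1 \<times> N\<^sub>2\<close>. For \<open>h\<^sub>i \<in> N\<^sub>i\<close> with centralizer contained in \<open>N\<^sub>i\<close>, the elements
  \<open>(h\<^sub>1, h\<^sub>2)\<close> and \<open>(f h\<^sub>1 f\<^sup>-\<^sup>1, h\<^sub>2)\<close> then have conjugate images in every quotient of \<open>G\<close> in \<open>\<C>\<close>, but are
  not conjugate in \<open>G\<close>.

  In a free group such an \<open>h\<^sub>i\<close> is \<open>a\<^sup>m b\<^sup>m\<close>. In a hyperbolic group it is \<open>w a\<^sup>n\<close> with \<open>n\<close> large, where
  the powers of \<open>a\<close> are geodesic (the finiteness of the number of cone types provides such elements)
  and where \<open>w\<close> avoids finitely many cosets of subgroups of infinite index; these cosets do not cover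
  the group by a theorem of B. H. Neumann.

  For the converse, every open normal subgroup \<open>K\<close> of \<open>F\<^sub>i\<close> contains an open normal subgroup \<open>L\<close> such
  that two given elements are conjugate modulo \<open>L\<close> only by cosets of \<open>K\<close> that contain an element which
  really conjugates them. This passes to direct products, and from there to open subgroups. For a
  hereditarily conjugacy separable group it follows from conjugacy separability of the subgroups
  generated by \<open>K\<close> and one element. For a free group one takes a finite Cayley graph of large girth and
  passes to its mod-\<open>q\<close> homology cover, where a closed path can be recovered from its homology class.
\<close>

section \<open>Open normal subgroups for a pseudovariety\<close>

text \<open>An element of \<open>G\<close> conjugates both coordinates at once, so conjugators found
  separately in the factors need not fit together. Hence the control of the coset of the conjugator:
  corrections inside \<open>K\<^sub>1 \<times> K\<^sub>2 \<subseteq> G\<close> do not leave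
  \<open>G\<close>. In the free case only the moduli offered by \<C> are available: powers of the
  order of an element of a member, by extension closure.

  For the first direction, \<open>N\<^sub>i\<close> is known only to have finite index, so
  \<open>h\<^sub>i\<close> is found without reference to \<C>. In the hyperbolic case
  \<open>w\<close> avoids the centralizer of \<open>a\<close>, the coset of the elements inverting a
  power of \<open>a\<close>, and the centralizers of the non-trivial torsion elements commuting with
  \<open>a\<close>. By the first two, the centralizer of \<open>w a\<^sup>n\<close> is bounded
  modulo powers of \<open>w a\<^sup>n\<close>, uniformly for large \<open>n\<close>. An element
  outside \<open>N\<^sub>i\<close> commuting with \<open>w a\<^sup>n\<close> for two values of
  \<open>n\<close> would commute with \<open>w\<close> and \<open>a\<close>; the first and third
  exclude this. Dietzmann's lemma gives the third kind infinite index.\<close>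

definition open_normal :: "nat monoid set \<Rightarrow> ('a, 'm) monoid_scheme \<Rightarrow> 'a set \<Rightarrow> bool" where
  "open_normal \<C> A N \<longleftrightarrow> N \<lhd> A \<and> in_class \<C> (A Mod N)"

lemma (in group) rcos_eq_iff:
  assumes "subgroup N G" "x \<in> carrier G" "y \<in> carrier G"
  shows "N #> x = N #> y \<longleftrightarrow> x \<otimes> inv y \<in> N"
proof
  assume "N #> x = N #> y"
  then show "x \<otimes> inv y \<in> N"
    using subgroup.rcos_module[OF assms(1) is_group assms(3,2)] rcos_self[OF assms(2,1)] by simp
next
  assume "x \<otimes> inv y \<in> N"
  then have "x \<in> N #> y" using subgroup.rcos_module[OF assms(1) is_group assms(3,2)] by simp
  from repr_independence[OF this assms(3,1)] show "N #> x = N #> y" by (rule sym)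
qed

lemma (in normal) kernel_r_coset: "kernel G (G Mod H) (\<lambda>x. H #> x) = H"
  using coset_join1[OF _ _ subgroup_axioms] coset_join2[OF _ subgroup_axioms] subset
  by (auto simp: kernel_def)

lemma (in group) finite_group_iso_nat:
  assumes "finite (carrier G)"
  obtains M :: "nat monoid" and h where "group M" "h \<in> iso G M"
proof -
  interpret T: normal "{\<one>}" G by (rule one_is_normal)
  have G: "group (G Mod {\<one>})" by (rule T.factorgroup_is_group)
  obtain i where i: "i \<in> iso G (G Mod {\<one>})"
    using trivial_factor_iso iso_set_sym group.iso_set_sym[OF G] by blast
  then have "finite (carrier (G Mod {\<one>}))"
    using assms iso_finite is_isoI by blast
  then obtain f :: "_ \<Rightarrow> nat" where f: "inj_on f (carrier (G Mod {\<one>}))"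
    using finite_imp_inj_to_nat_seg by metis
  let ?M = "flatten (G Mod {\<one>}) f"
  have "f ` carrier (G Mod {\<one>}) = carrier ?M" by (simp add: flatten_def)
  then have "f \<in> iso (G Mod {\<one>}) ?M"
    using f flatten_set_group_hom[OF G f] by (simp add: iso_def bij_betw_def)
  with i have "f \<circ> i \<in> iso G ?M" by (rule iso_set_trans)
  with flatten_set_group[OF G f] show ?thesis by (rule that)
qed

locale pseudovariety =
  fixes \<C> :: "nat monoid set"
  assumes pseudovariety: "pseudovariety_of_finite_groups \<C>"
    and nontrivial: "nontrivial_class \<C>"
    and extension_closed: "extension_closed \<C>"
begin

lemma group_member: "M \<in> \<C> \<Longrightarrow> group M" and finite_member: "M \<in> \<C> \<Longrightarrow> finite (carrier M)"
  and iso_member: "in_class \<C> M \<Longrightarrow> M \<in> \<C>"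
  using pseudovariety by (auto simp: pseudovariety_of_finite_groups_def)

lemma in_class_member: "M \<in> \<C> \<Longrightarrow> in_class \<C> M"
  using group_member[of M] by (auto simp: in_class_def intro!: bexI[of _ M])

lemma in_classE:
  assumes "in_class \<C> A"
  obtains M h k where "group A" "M \<in> \<C>" "group M" "h \<in> iso A M" "k \<in> iso M A"
  using assms group_member unfolding in_class_def is_iso_def
  by (metis ex_in_conv group.iso_set_sym)

lemma in_class_finite: "in_class \<C> A \<Longrightarrow> finite (carrier A)"
  using finite_member iso_finite unfolding in_class_def by blast

lemma in_class_iso: "in_class \<C> A \<Longrightarrow> A \<cong> B \<Longrightarrow> group B \<Longrightarrow> in_class \<C> B"
  unfolding in_class_def by (meson group.iso_sym iso_trans)

text \<open>The closure axioms speak only of groups on \<open>nat\<close>. Composing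
  \<open>h\<close> with an isomorphism from \<open>B\<close> to a member \<open>M\<close> turns an
  embedding, on any type, into a subgroup of \<open>M\<close>.\<close>

lemma in_class_inj:
  assumes "in_class \<C> B" "group A" and h: "h \<in> hom A B" "inj_on h (carrier A)"
  shows "in_class \<C> A"
proof -
  obtain M k where M: "M \<in> \<C>" "group M" "k \<in> iso B M" and "group B"
    using assms(1) by (elim in_classE)
  let ?f = "k \<circ> h"
  have f: "?f \<in> hom A M" "inj_on ?f (carrier A)"
    using h M(3) hom_compose[of h A B k M] comp_inj_on[of h "carrier A" k]
      inj_on_subset[of k "carrier B" "h ` carrier A"] hom_carrier[of h A B]
    by (auto simp: iso_def bij_betw_def simp del: o_apply)
  interpret f: group_hom A M ?f
    using f assms(2) M(2) by (simp add: group_hom_def group_hom_axioms_def)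
  let ?H = "?f ` carrier A"
  have "subgroup ?H M" by (rule f.img_is_subgroup)
  then have "in_class \<C> (M\<lparr>carrier := ?H\<rparr>)"
    using pseudovariety M(1) by (auto simp: pseudovariety_of_finite_groups_def)
  moreover have "?f \<in> iso A (M\<lparr>carrier := ?H\<rparr>)"
    using f by (auto simp: iso_def hom_def bij_betw_def)
  ultimately show ?thesis
    using assms(2) in_class_iso[OF _ group.iso_sym[OF assms(2) is_isoI]] by blast
qed

text \<open>The quotient by the kernel embeds into \<open>B\<close>, and \<C> is closed under
  subgroups. Most open normal subgroups below are obtained as such kernels.\<close>

lemma open_normal_kernel:
  assumes "in_class \<C> B" "group A" "h \<in> hom A B"
  shows "open_normal \<C> A (kernel A B h)"
proof -
  interpret group_hom A B h
    using assms by (simp add: group_hom_def group_hom_axioms_def in_class_def)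
  show ?thesis
    unfolding open_normal_def
    using in_class_inj[OF assms(1) normal.factorgroup_is_group[OF normal_kernel] FactGroup_hom FactGroup_inj_on]
      normal_kernel by blast
qed

lemma in_class_surj:
  assumes "in_class \<C> A" "group B" "h \<in> hom A B" "h ` carrier A = carrier B"
  shows "in_class \<C> B"
proof -
  obtain M k where M: "M \<in> \<C>" "group M" "k \<in> iso M A" and "group A"
    using assms(1) by (elim in_classE)
  let ?f = "h \<circ> k"
  have f: "?f \<in> hom M B" "?f ` carrier M = carrier B"
    using assms(3,4) M(3) hom_compose[of k M A h B] image_comp[of h k "carrier M"]
    by (auto simp: iso_def bij_betw_def)
  interpret f: group_hom M B ?f
    using f assms(2) M(2) by (simp add: group_hom_def group_hom_axioms_def)
  have "in_class \<C> (M Mod kernel M B ?f)"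
    using pseudovariety M(1) f.normal_kernel by (auto simp: pseudovariety_of_finite_groups_def)
  then show ?thesis
    using f.FactGroup_iso[OF f(2)] assms(2) in_class_iso by blast
qed

lemma in_class_DirProd:
  assumes "in_class \<C> A" "in_class \<C> B"
  shows "in_class \<C> (A \<times>\<times> B)"
proof -
  obtain M h where M: "M \<in> \<C>" "group M" "h \<in> iso A M" "group A" using assms(1) by (elim in_classE)
  obtain N k where N: "N \<in> \<C>" "group N" "k \<in> iso B N" "group B" using assms(2) by (elim in_classE)
  have "in_class \<C> (M \<times>\<times> N)"
    using pseudovariety M(1) N(1) by (auto simp: pseudovariety_of_finite_groups_def)
  moreover have "(\<lambda>(x, y). (h x, k y)) \<in> iso (A \<times>\<times> B) (M \<times>\<times> N)"
    using M N by (simp add: group.DirProd_iso_set_trans)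
  ultimately show ?thesis
    using in_class_inj[OF _ DirProd_group[OF M(4) N(4)]] by (auto simp: iso_def bij_betw_def)
qed

text \<open>\<open>extension_closed\<close> ranges over groups on \<open>nat\<close>. Since
  \<open>A\<close> is a finite union of finite cosets, it is finite, and the whole extension can be
  carried to a copy \<open>M\<close> on \<open>nat\<close>; \<open>k\<close> is the inverse of the
  isomorphism \<open>h\<close>.\<close>

lemma in_class_extension:
  assumes "N \<lhd> A" "in_class \<C> (A\<lparr>carrier := N\<rparr>)" "in_class \<C> (A Mod N)"
  shows "in_class \<C> A"
proof -
  interpret normal N A by fact
  have "finite N" "finite (rcosets\<^bsub>A\<^esub> N)"
    using in_class_finite[OF assms(2)] in_class_finite[OF assms(3)] by (auto simp: FactGroup_def)
  moreover have "\<Union> (rcosets\<^bsub>A\<^esub> N) = carrier A" using rcosets_part_G subgroup_axioms by simp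
  moreover have "finite c" if "c \<in> rcosets\<^bsub>A\<^esub> N" for c
    using that \<open>finite N\<close> by (auto simp: RCOSETS_def r_coset_def)
  ultimately have "finite (carrier A)" by (metis finite_Union)
  then obtain M :: "nat monoid" and h where M: "group M" "h \<in> iso A M"
    by (rule finite_group_iso_nat)
  then obtain k where "group_isomorphisms A M h k"
    using iso_iff_group_isomorphisms[of h M] by auto
  then have hk: "h \<in> hom A M" "k \<in> hom M A" "\<And>x. x \<in> carrier A \<Longrightarrow> k (h x) = x"
    "\<And>y. y \<in> carrier M \<Longrightarrow> h (k y) = y"
    by (auto simp: group_isomorphisms_def)
  have car: "\<And>x. x \<in> carrier A \<Longrightarrow> h x \<in> carrier M" "\<And>y. y \<in> carrier M \<Longrightarrow> k y \<in> carrier A"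
    using hk by (auto simp: hom_def)
  have N': "h ` N \<lhd> M"
    using iso_normal_subgroup[OF M(2) is_group M(1) normal_axioms] .
  interpret N': normal "h ` N" M by fact
  have "in_class \<C> (M\<lparr>carrier := h ` N\<rparr>)"
  proof (rule in_class_inj[OF assms(2), of _ k])
    show "group (M\<lparr>carrier := h ` N\<rparr>)" using N'.subgroup_is_group M by simp
    show "k \<in> hom (M\<lparr>carrier := h ` N\<rparr>) (A\<lparr>carrier := N\<rparr>)"
      by (rule homI) (use hk car in \<open>auto simp: hom_mult\<close>)
    show "inj_on k (carrier (M\<lparr>carrier := h ` N\<rparr>))"
      using hk(4) by (auto intro!: inj_onI simp: hk(3))
  qed
  moreover have "in_class \<C> (M Mod (h ` N))"
  proof -
    have r: "(\<lambda>x. N #>\<^bsub>A\<^esub> x) \<circ> k \<in> hom M (A Mod N)"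
      using Group.hom_compose[OF hk(2) r_coset_hom_Mod] .
    have "kernel M (A Mod N) ((\<lambda>x. N #>\<^bsub>A\<^esub> x) \<circ> k) = {y \<in> carrier M. k y \<in> N}"
      using kernel_r_coset car by (auto simp: kernel_def)
    also have "\<dots> = h ` N"
    proof
      show "{y \<in> carrier M. k y \<in> N} \<subseteq> h ` N" by (auto intro!: image_eqI[of _ h] simp: hk(4))
      show "h ` N \<subseteq> {y \<in> carrier M. k y \<in> N}" by (auto simp: hk(3) car)
    qed
    finally have "kernel M (A Mod N) ((\<lambda>x. N #>\<^bsub>A\<^esub> x) \<circ> k) = h ` N" .
    then show ?thesis using open_normal_kernel[OF assms(3) M(1) r] by (simp add: open_normal_def)
  qed
  ultimately have "in_class \<C> M"
    using extension_closed N' unfolding extension_closed_def by blast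
  then show ?thesis using in_class_inj[OF _ is_group hk(1)] M(2) by (auto simp: iso_def bij_betw_def)
qed


lemma open_normal_mono:
  assumes "open_normal \<C> A N" "N \<subseteq> K" "K \<lhd> A"
  shows "open_normal \<C> A K"
proof -
  interpret N: normal N A using assms(1) by (simp add: open_normal_def)
  interpret K: normal K A by fact
  interpret r: group_hom A "A Mod K" "\<lambda>x. K #>\<^bsub>A\<^esub> x"
    by (simp add: group_hom_def group_hom_axioms_def K.r_coset_hom_Mod K.factorgroup_is_group N.is_group)
  obtain g where g: "g \<in> hom (A Mod N) (A Mod K)"
    "\<And>x. x \<in> carrier A \<Longrightarrow> g (N #>\<^bsub>A\<^esub> x) = K #>\<^bsub>A\<^esub> x"
    using r.FactGroup_universal_kernel[OF N.normal_axioms] assms(2) K.kernel_r_coset by auto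
  have "g ` carrier (A Mod N) = carrier (A Mod K)"
    using g(2) by (auto simp: carrier_FactGroup image_image)
  then show ?thesis
    using assms(1,3) in_class_surj[OF _ K.factorgroup_is_group g(1)] by (auto simp: open_normal_def)
qed

lemma open_normal_vimage:
  assumes "group A" "group B" "h \<in> hom A B" "open_normal \<C> B N"
  shows "open_normal \<C> A {x \<in> carrier A. h x \<in> N}"
proof -
  interpret normal N B using assms(4) by (simp add: open_normal_def)
  have "kernel A (B Mod N) ((\<lambda>x. N #>\<^bsub>B\<^esub> x) \<circ> h) = {x \<in> carrier A. h x \<in> N}"
    using kernel_r_coset hom_carrier[OF assms(3)] by (auto simp: kernel_def)
  then show ?thesis
    using open_normal_kernel[OF _ assms(1) Group.hom_compose[OF assms(3) r_coset_hom_Mod]] assms(4)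
    by (auto simp: open_normal_def)
qed

lemma open_normal_restrict:
  assumes "open_normal \<C> A N" "subgroup H A" "group A"
  shows "open_normal \<C> (A\<lparr>carrier := H\<rparr>) (N \<inter> H)"
proof -
  have "{x \<in> H. x \<in> N} = N \<inter> H" by auto
  moreover have "(\<lambda>x. x) \<in> hom (A\<lparr>carrier := H\<rparr>) A"
    using subgroup.subset[OF assms(2)] by (auto simp: hom_def)
  ultimately show ?thesis
    using open_normal_vimage[of "A\<lparr>carrier := H\<rparr>" A "\<lambda>x. x" N] assms subgroup.subgroup_is_group by auto
qed

lemma open_normal_Int:
  assumes "open_normal \<C> A N" "open_normal \<C> A K"
  shows "open_normal \<C> A (N \<inter> K)"
proof -
  interpret N: normal N A using assms(1) by (simp add: open_normal_def)
  interpret K: normal K A using assms(2) by (simp add: open_normal_def)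
  let ?h = "\<lambda>x. (N #>\<^bsub>A\<^esub> x, K #>\<^bsub>A\<^esub> x)"
  have "?h \<in> hom A ((A Mod N) \<times>\<times> (A Mod K))"
    using N.r_coset_hom_Mod K.r_coset_hom_Mod by (auto simp: hom_def)
  moreover have "in_class \<C> ((A Mod N) \<times>\<times> (A Mod K))"
    using assms in_class_DirProd unfolding open_normal_def by blast
  moreover have "kernel A ((A Mod N) \<times>\<times> (A Mod K)) ?h = N \<inter> K"
    using N.kernel_r_coset K.kernel_r_coset by (auto simp: kernel_def)
  ultimately show ?thesis using open_normal_kernel[OF _ N.is_group] by metis
qed

lemma open_normal_carrier:
  assumes "group A"
  shows "open_normal \<C> A (carrier A)"
proof -
  obtain M where M: "M \<in> \<C>" using nontrivial by (auto simp: nontrivial_class_def)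
  then interpret M: group M by (rule group_member)
  have "kernel A M (\<lambda>x. \<one>\<^bsub>M\<^esub>) = carrier A" by (simp add: kernel_def)
  moreover have "(\<lambda>x. \<one>\<^bsub>M\<^esub>) \<in> hom A M" by (simp add: hom_def)
  ultimately show ?thesis using open_normal_kernel[OF in_class_member[OF M] assms] by metis
qed

lemma open_normal_INT:
  assumes "group A" "finite I" "\<And>i. i \<in> I \<Longrightarrow> open_normal \<C> A (N i)"
  shows "open_normal \<C> A (carrier A \<inter> (\<Inter>i\<in>I. N i))"
proof -
  have "open_normal \<C> A (carrier A \<inter> (\<Inter>i\<in>J. N i))" if "finite J" "J \<subseteq> I" for J
    using that
  proof (induction rule: finite_induct)
    case empty
    show ?case using open_normal_carrier[OF assms(1)] by auto
  next
    case (insert i J)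
    have "carrier A \<inter> (\<Inter>j\<in>insert i J. N j) = N i \<inter> (carrier A \<inter> (\<Inter>j\<in>J. N j))" by auto
    then show ?case using insert assms(3) by (auto intro: open_normal_Int)
  qed
  then show ?thesis using assms(2) by blast
qed

text \<open>This is where extension closure acts: \<open>?Q\<close>, a copy of \<open>K / L\<close>,
  is normal in \<open>A Mod L\<close>, and the quotient by it embeds into
  \<open>A Mod K\<close>.\<close>

lemma open_normal_trans:
  assumes "open_normal \<C> A K" "open_normal \<C> (A\<lparr>carrier := K\<rparr>) L" "L \<lhd> A"
  shows "open_normal \<C> A L"
proof -
  interpret K: normal K A using assms(1) by (simp add: open_normal_def)
  interpret L: normal L A by fact
  have LK: "L \<subseteq> K"
    using assms(2) normal_imp_subgroup subgroup.subset unfolding open_normal_def by fastforce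
  let ?Q = "rcosets\<^bsub>A\<lparr>carrier := K\<rparr>\<^esub> L"
  interpret Q: normal ?Q "A Mod L"
    by (rule K.normality_factorization[OF L.normal_axioms LK K.normal_axioms])
  interpret r: group_hom A "A Mod K" "\<lambda>x. K #>\<^bsub>A\<^esub> x"
    by (simp add: group_hom_def group_hom_axioms_def K.r_coset_hom_Mod K.factorgroup_is_group K.is_group)
  obtain g where g: "g \<in> hom (A Mod L) (A Mod K)"
    "\<And>x. x \<in> carrier A \<Longrightarrow> g (L #>\<^bsub>A\<^esub> x) = K #>\<^bsub>A\<^esub> x"
    using r.FactGroup_universal_kernel[OF L.normal_axioms] LK K.kernel_r_coset by auto
  have "?Q = (\<lambda>x. L #>\<^bsub>A\<^esub> x) ` K" by (auto simp: RCOSETS_def r_coset_def)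
  also have "\<dots> = kernel (A Mod L) (A Mod K) g"
  proof -
    have "x \<in> K \<longleftrightarrow> K #>\<^bsub>A\<^esub> x = K" if "x \<in> carrier A" for x
      using K.kernel_r_coset that by (auto simp: kernel_def)
    then show ?thesis
      using g(2) K.subset by (auto simp: kernel_def carrier_FactGroup simp del: K.rcos_const)
  qed
  finally have "?Q = kernel (A Mod L) (A Mod K) g" .
  then have "in_class \<C> (A Mod L Mod ?Q)"
    using open_normal_kernel[OF _ L.factorgroup_is_group g(1)] assms(1) by (simp add: open_normal_def)
  moreover have "in_class \<C> ((A Mod L)\<lparr>carrier := ?Q\<rparr>)"
  proof (rule in_class_inj)
    show "in_class \<C> (A\<lparr>carrier := K\<rparr> Mod L)" using assms(2) by (simp add: open_normal_def)
    show "group ((A Mod L)\<lparr>carrier := ?Q\<rparr>)" using Q.subgroup_is_group by simp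
    show "(\<lambda>x. x) \<in> hom ((A Mod L)\<lparr>carrier := ?Q\<rparr>) (A\<lparr>carrier := K\<rparr> Mod L)"
      by (auto simp: hom_def FactGroup_def)
  qed simp
  ultimately have "in_class \<C> (A Mod L)"
    using in_class_extension Q.normal_axioms by blast
  then show ?thesis using assms(3) by (simp add: open_normal_def)
qed

lemma open_normal_finite_index: "open_normal \<C> A N \<Longrightarrow> finite (rcosets\<^bsub>A\<^esub> N)"
  using in_class_finite[of "A Mod N"] by (simp add: open_normal_def FactGroup_def)

lemma exists_order:
  obtains M z where "M \<in> \<C>" "z \<in> carrier M" "group.ord M z > 1"
proof -
  obtain M where M: "M \<in> \<C>" "\<not> trivial_group M" using nontrivial by (auto simp: nontrivial_class_def)
  interpret M: group M using M(1) by (rule group_member)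
  obtain z where z: "z \<in> carrier M" "z \<noteq> \<one>\<^bsub>M\<^esub>"
    using M(2) M.is_group by (auto simp: trivial_group_def)
  have "M.ord z > 0" using M.ord_ge_1[OF finite_member[OF M(1)] z(1)] by simp
  then show ?thesis using that[OF M(1) z(1)] M.ord_eq_1[OF z(1)] z(2) by fastforce
qed

text \<open>For \<open>r\<close> the order of a non-trivial element \<open>z\<close> of a member of
  \<C>, reduction modulo \<open>r\<close> is the map \<open>n \<mapsto> z^n\<close>. Extension
  closure lifts this to all powers of \<open>r\<close>, which gives arbitrarily large moduli. The
  group is quantified inside the conclusion so that a single \<open>r\<close> serves a group and all
  its subgroups.\<close>

lemma exists_modulus:
  obtains r :: nat where "r > 1"
    "\<And>A c e. group (A :: ('a, 'm) monoid_scheme) \<Longrightarrow> c \<in> hom A integer_group \<Longrightarrow>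
       open_normal \<C> A {g \<in> carrier A. int (r ^ e) dvd c g}"
proof -
  obtain M z where M: "M \<in> \<C>" "z \<in> carrier M" "group.ord M z > 1" by (rule exists_order)
  interpret M: group M using M(1) by (rule group_member)
  let ?r = "M.ord z"
  have step: "open_normal \<C> A {g \<in> carrier A. int ?r dvd c g}"
    if "group A" "c \<in> hom A integer_group" for A :: "('a, 'm) monoid_scheme" and c
  proof -
    have "(\<lambda>n::int. z [^]\<^bsub>M\<^esub> n) \<in> hom integer_group M"
      using M(2) by (auto simp: hom_def M.int_pow_mult)
    then have "(\<lambda>n::int. z [^]\<^bsub>M\<^esub> n) \<circ> c \<in> hom A M"
      using that(2) Group.hom_compose by blast
    moreover have "kernel A M ((\<lambda>n::int. z [^]\<^bsub>M\<^esub> n) \<circ> c) = {g \<in> carrier A. int ?r dvd c g}"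
      using M(2) by (auto simp: kernel_def M.int_pow_eq_id)
    ultimately show ?thesis using open_normal_kernel[OF in_class_member[OF M(1)] that(1)] by metis
  qed
  have mult: "open_normal \<C> A {g \<in> carrier A. s * int ?r dvd c g}"
    if A: "group A" and c: "c \<in> hom A integer_group" and s: "s > 0"
      and IH: "open_normal \<C> A {g \<in> carrier A. s dvd c g}"
    for A :: "('a, 'm) monoid_scheme" and c and s :: int
  proof -
    interpret A: group A by (rule A)
    interpret c: group_hom A integer_group c
      using c A by (simp add: group_hom_def group_hom_axioms_def)
    define K where "K = {g \<in> carrier A. s dvd c g}"
    interpret K: normal K A using IH by (simp add: K_def open_normal_def)
    have cm: "c (a \<otimes>\<^bsub>A\<^esub> b) = c a + c b" if "a \<in> carrier A" "b \<in> carrier A" for a b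
      using c.hom_mult[OF that] by simp
    have ci: "c (inv\<^bsub>A\<^esub> a) = - c a" if "a \<in> carrier A" for a
      using c.hom_inv[OF that] by simp
    have n: "{g \<in> carrier A. t dvd c g} \<lhd> A" for t :: int
      unfolding A.normal_inv_iff
    proof (intro conjI ballI A.subgroupI)
      have "\<one>\<^bsub>A\<^esub> \<in> {g \<in> carrier A. t dvd c g}" using c.hom_one by simp
      then show "{g \<in> carrier A. t dvd c g} \<noteq> {}" by blast
    qed (simp_all add: cm ci subset_iff)
    have gK: "group (A\<lparr>carrier := K\<rparr>)" by (rule K.subgroup_is_group[OF A])
    \<comment> \<open>On \<open>K\<close> the values of \<open>c\<close> are multiples of
      \<open>s\<close>, so \<open>c / s\<close> is again a homomorphism to the integers, and the
      case of modulus \<open>r\<close> applies to it.\<close>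
    have hK: "(\<lambda>g. c g div s) \<in> hom (A\<lparr>carrier := K\<rparr>) integer_group"
    proof (rule homI)
      fix x y assume "x \<in> carrier (A\<lparr>carrier := K\<rparr>)" "y \<in> carrier (A\<lparr>carrier := K\<rparr>)"
      then have "x \<in> K" "y \<in> K" by simp_all
      then have xy: "x \<in> carrier A" "y \<in> carrier A" "s dvd c x" unfolding K_def by blast+
      have "c (x \<otimes>\<^bsub>A\<^esub> y) div s = c x div s + c y div s"
        unfolding cm[OF xy(1,2)] by (rule div_plus_div_distrib_dvd_left[OF xy(3)])
      then show "c (x \<otimes>\<^bsub>A\<lparr>carrier := K\<rparr>\<^esub> y) div s =
          (c x div s) \<otimes>\<^bsub>integer_group\<^esub> (c y div s)" by simp
    qed simp
    have "s * int ?r dvd n \<longleftrightarrow> s dvd n \<and> int ?r dvd n div s" for n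
    proof (cases "s dvd n")
      case True
      then have "int ?r dvd n div s \<longleftrightarrow> int ?r * s dvd n" using s by (intro dvd_div_iff_mult) simp_all
      with True show ?thesis by (simp only: mult.commute simp_thms)
    next
      case False
      then show ?thesis using dvd_mult_left[of s "int ?r" n] by blast
    qed
    then have "{g \<in> carrier A. s * int ?r dvd c g} = {g \<in> carrier (A\<lparr>carrier := K\<rparr>). int ?r dvd c g div s}"
      unfolding K_def by simp
    then have "open_normal \<C> (A\<lparr>carrier := K\<rparr>) {g \<in> carrier A. s * int ?r dvd c g}"
      using step[OF gK hK] by (simp only:)
    from open_normal_trans[OF IH[folded K_def] this n] show ?thesis .
  qed
  have "open_normal \<C> A {g \<in> carrier A. int (?r ^ e) dvd c g}"
    if A: "group A" and c: "c \<in> hom A integer_group" for A :: "('a, 'm) monoid_scheme" and c e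
  proof (induction e)
    case 0
    then show ?case using open_normal_carrier[OF A] by simp
  next
    case (Suc e)
    from mult[OF A c _ this] M(3) show ?case by (simp add: mult.commute)
  qed
  with M(3) show ?thesis by (rule that[of ?r])
qed

end

section \<open>Separating the elements that are conjugate by a coset\<close>

lemma (in group) inv_m_cancel:
  assumes "x \<in> carrier G" "y \<in> carrier G"
  shows "inv x \<otimes> (x \<otimes> y) = y" "x \<otimes> (inv x \<otimes> y) = y"
  using assms by (simp_all flip: m_assoc)

lemmas (in group) group_norm = m_assoc inv_mult_group inv_m_cancel

text \<open>For \<open>K\<close> the whole group this is conjugacy separability. For
  \<open>x = y\<close> it says that an element commuting with \<open>x\<close> modulo
  \<open>L\<close> lies in the product of \<open>K\<close> and the centralizer of
  \<open>x\<close>.\<close>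

definition coset_conjugacy_separable :: "nat monoid set \<Rightarrow> ('a, 'm) monoid_scheme \<Rightarrow> bool" where
  "coset_conjugacy_separable \<C> A \<longleftrightarrow>
     (\<forall>x\<in>carrier A. \<forall>y\<in>carrier A. \<forall>K. open_normal \<C> A K \<longrightarrow>
        (\<exists>L\<subseteq>K. open_normal \<C> A L \<and>
           (\<forall>g\<in>carrier A. g \<otimes>\<^bsub>A\<^esub> x \<otimes>\<^bsub>A\<^esub> inv\<^bsub>A\<^esub> g \<otimes>\<^bsub>A\<^esub> inv\<^bsub>A\<^esub> y \<in> L \<longrightarrow>
              (\<exists>k\<in>K. (g \<otimes>\<^bsub>A\<^esub> k) \<otimes>\<^bsub>A\<^esub> x \<otimes>\<^bsub>A\<^esub> inv\<^bsub>A\<^esub> (g \<otimes>\<^bsub>A\<^esub> k) = y))))"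

context pseudovariety
begin

text \<open>The cosets only generate the topology, so the claim is carried through finite
  intersections and unions; a generating coset that contains the identity is the subgroup
  itself.\<close>

lemma open_normal_subset_open:
  assumes "openin (pro_topology \<C> A) U" "\<one>\<^bsub>A\<^esub> \<in> U" "group A"
  obtains K where "open_normal \<C> A K" "K \<subseteq> U"
proof -
  interpret group A by fact
  have "generate_topology_on {N #>\<^bsub>A\<^esub> x | N x. N \<lhd> A \<and> in_class \<C> (A Mod N) \<and> x \<in> carrier A} U"
    using assms(1) unfolding pro_topology_def openin_topology_generated_by_iff .
  then have "\<one>\<^bsub>A\<^esub> \<in> U \<longrightarrow> (\<exists>K. open_normal \<C> A K \<and> K \<subseteq> U)"
  proof induction
    case (Int a b)
    then show ?case using open_normal_Int by (metis Int_iff Int_mono)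
  next
    case (UN F)
    then show ?case by (metis Union_iff Union_upper subset_trans)
  next
    case (Basis s)
    then obtain N x where N: "s = N #>\<^bsub>A\<^esub> x" "N \<lhd> A" "in_class \<C> (A Mod N)" "x \<in> carrier A" by auto
    show ?case
    proof
      assume "\<one>\<^bsub>A\<^esub> \<in> s"
      then have "N #>\<^bsub>A\<^esub> x = N #>\<^bsub>A\<^esub> \<one>\<^bsub>A\<^esub>"
        using repr_independence[of "\<one>\<^bsub>A\<^esub>" N x] N normal_imp_subgroup by blast
      then have "s = N" using N normal_imp_subgroup subgroup.subset by fastforce
      then show "\<exists>K. open_normal \<C> A K \<and> K \<subseteq> s" using N by (auto simp: open_normal_def)
    qed
  qed simp
  then show ?thesis using assms(2) that by blast
qed

lemma openin_pro_topology_subgroup: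
  assumes "group A" "open_normal \<C> A K" "K \<subseteq> H" "subgroup H A"
  shows "openin (pro_topology \<C> A) H"
proof -
  interpret group A by fact
  interpret H: subgroup H A by fact
  interpret K: normal K A using assms(2) by (simp add: open_normal_def)
  have "\<Union>((\<lambda>h. K #>\<^bsub>A\<^esub> h) ` H) = H"
  proof
    show "\<Union>((\<lambda>h. K #>\<^bsub>A\<^esub> h) ` H) \<subseteq> H" using assms(3) by (auto simp: r_coset_def)
    show "H \<subseteq> \<Union>((\<lambda>h. K #>\<^bsub>A\<^esub> h) ` H)"
      using rcos_self[OF H.mem_carrier K.subgroup_axioms] by auto
  qed
  moreover have "openin (pro_topology \<C> A) (\<Union>((\<lambda>h. K #>\<^bsub>A\<^esub> h) ` H))"
    unfolding pro_topology_def
    using assms(2) H.mem_carrier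
    by (intro openin_Union) (force simp: open_normal_def intro!: topology_generated_by_Basis)
  ultimately show ?thesis by simp
qed

text \<open>\<open>N\<close> is normalised by \<open>K\<close> but perhaps not by \<open>A\<close>.
  \<open>V g\<close> is the conjugate of \<open>N\<close> by \<open>g\<close>; it depends only on
  the coset of \<open>g\<close> modulo \<open>K\<close>, so there are finitely many conjugates, and
  their intersection \<open>L\<close> is normal in \<open>A\<close> and still open in
  \<open>K\<close>.\<close>

lemma open_normal_core:
  assumes "group A" "open_normal \<C> A K" "open_normal \<C> (A\<lparr>carrier := K\<rparr>) N"
  obtains L where "open_normal \<C> A L" "L \<subseteq> N"
proof -
  interpret group A by fact
  interpret K: normal K A using assms(2) by (simp add: open_normal_def)
  interpret N: normal N "A\<lparr>carrier := K\<rparr>" using assms(3) by (simp add: open_normal_def)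
  have gK: "group (A\<lparr>carrier := K\<rparr>)" using K.subgroup_is_group assms(1) by simp
  let ?c = "\<lambda>g x. inv\<^bsub>A\<^esub> g \<otimes>\<^bsub>A\<^esub> x \<otimes>\<^bsub>A\<^esub> g"
  define V where "V g = {x \<in> K. ?c g x \<in> N}" for g
  define rep where "rep c = (SOME g. g \<in> c)" for c :: "'a set"
  have NK: "N \<subseteq> K" using N.subset by simp
  have V: "open_normal \<C> (A\<lparr>carrier := K\<rparr>) (V g)" if g: "g \<in> carrier A" for g
  proof -
    have "?c g \<in> hom (A\<lparr>carrier := K\<rparr>) (A\<lparr>carrier := K\<rparr>)"
      by (rule homI) (use g K.inv_op_closed1[OF g] in \<open>auto simp: group_norm\<close>)
    from open_normal_vimage[OF gK gK this assms(3)] show ?thesis by (simp add: V_def)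
  qed
  have Nconj: "inv\<^bsub>A\<^esub> k \<otimes>\<^bsub>A\<^esub> n \<otimes>\<^bsub>A\<^esub> k \<in> N" if "k \<in> K" "n \<in> N" for k n
    using N.inv_op_closed1[of k n] that K.subgroup_axioms by simp
  have VgkI: "V g \<subseteq> V (g \<otimes>\<^bsub>A\<^esub> k)" if "g \<in> carrier A" "k \<in> K" for g k
  proof
    fix x assume "x \<in> V g"
    then have x: "x \<in> K" "?c g x \<in> N" by (auto simp: V_def)
    then show "x \<in> V (g \<otimes>\<^bsub>A\<^esub> k)" using Nconj[OF that(2) x(2)] that by (simp add: V_def group_norm)
  qed
  have Vk: "V (k \<otimes>\<^bsub>A\<^esub> g) = V g" if g: "g \<in> carrier A" and k: "k \<in> K" for g k
  proof -
    have c: "?c g k \<in> K" using K.inv_op_closed1 g k by simp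
    have kg: "k \<otimes>\<^bsub>A\<^esub> g = g \<otimes>\<^bsub>A\<^esub> ?c g k" using g k by (simp add: group_norm)
    have "V (g \<otimes>\<^bsub>A\<^esub> ?c g k) \<subseteq> V (g \<otimes>\<^bsub>A\<^esub> ?c g k \<otimes>\<^bsub>A\<^esub> inv\<^bsub>A\<^esub> (?c g k))"
      using g c by (intro VgkI) auto
    moreover have "g \<otimes>\<^bsub>A\<^esub> ?c g k \<otimes>\<^bsub>A\<^esub> inv\<^bsub>A\<^esub> (?c g k) = g"
      using g k by (simp add: group_norm)
    ultimately have "V (g \<otimes>\<^bsub>A\<^esub> ?c g k) = V g" using VgkI[OF g c] by auto
    then show ?thesis by (subst kg)
  qed
  let ?R = "rcosets\<^bsub>A\<^esub> K"
  define L where "L = {x \<in> K. \<forall>g\<in>carrier A. ?c g x \<in> N}"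
  have rep: "rep c \<in> c" if "c \<in> ?R" for c
    using K.rcosets_non_empty[OF that] by (simp add: rep_def some_in_eq)
  have rep_carrier: "rep c \<in> carrier A" if "c \<in> ?R" for c
    using rep[OF that] that K.rcosets_carrier[OF is_group] by blast
  have "L = K \<inter> (\<Inter>c\<in>?R. V (rep c))"
  proof (intro equalityI subsetI)
    fix x assume x: "x \<in> K \<inter> (\<Inter>c\<in>?R. V (rep c))"
    have "?c g x \<in> N" if g: "g \<in> carrier A" for g
    proof -
      have gc: "K #>\<^bsub>A\<^esub> g \<in> ?R" using g by (rule rcosetsI[OF K.subset])
      then obtain k where k: "k \<in> K" "rep (K #>\<^bsub>A\<^esub> g) = k \<otimes>\<^bsub>A\<^esub> g"
        using rep by (auto simp: r_coset_def)
      moreover have "x \<in> V (rep (K #>\<^bsub>A\<^esub> g))" using x gc by blast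
      ultimately have "x \<in> V g" using Vk[OF g k(1)] by (simp only:)
      then show ?thesis by (simp add: V_def)
    qed
    then show "x \<in> L" using x by (simp add: L_def)
  qed (use rep_carrier in \<open>auto simp: L_def V_def\<close>)
  moreover have "open_normal \<C> (A\<lparr>carrier := K\<rparr>) (carrier (A\<lparr>carrier := K\<rparr>) \<inter> (\<Inter>c\<in>?R. V (rep c)))"
    by (rule open_normal_INT[OF gK open_normal_finite_index[OF assms(2)] V[OF rep_carrier]])
  ultimately have L: "open_normal \<C> (A\<lparr>carrier := K\<rparr>) L" by simp
  interpret L: normal L "A\<lparr>carrier := K\<rparr>" using L by (simp add: open_normal_def)
  have "subgroup L A"
    using L.subgroup_axioms K.subgroup_axioms incl_subgroup by blast
  moreover have "g \<otimes>\<^bsub>A\<^esub> x \<otimes>\<^bsub>A\<^esub> inv\<^bsub>A\<^esub> g \<in> L" if g: "g \<in> carrier A" and x: "x \<in> L" for g x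
  proof -
    have "?c h (g \<otimes>\<^bsub>A\<^esub> x \<otimes>\<^bsub>A\<^esub> inv\<^bsub>A\<^esub> g) \<in> N" if h: "h \<in> carrier A" for h
    proof -
      have "?c (inv\<^bsub>A\<^esub> g \<otimes>\<^bsub>A\<^esub> h) x \<in> N" using x g h by (simp add: L_def)
      then show ?thesis using x g h by (simp add: group_norm L_def)
    qed
    then show ?thesis using K.inv_op_closed2 g x by (simp add: L_def)
  qed
  ultimately have "L \<lhd> A" using normal_inv_iff by blast
  then have "open_normal \<C> A L" using open_normal_trans[OF assms(2) L] by simp
  moreover have "L \<subseteq> N"
  proof
    fix x assume "x \<in> L"
    then have "x \<in> K" "?c \<one>\<^bsub>A\<^esub> x \<in> N" unfolding L_def by blast+
    then show "x \<in> N" by simp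
  qed
  ultimately show ?thesis by (rule that)
qed

lemma conjugacy_separableI:
  assumes "group A"
    and "\<And>x y. x \<in> carrier A \<Longrightarrow> y \<in> carrier A \<Longrightarrow> \<not> conjugate_in A x y \<Longrightarrow>
      \<exists>L. open_normal \<C> A L \<and> (\<forall>g\<in>carrier A. g \<otimes>\<^bsub>A\<^esub> x \<otimes>\<^bsub>A\<^esub> inv\<^bsub>A\<^esub> g \<otimes>\<^bsub>A\<^esub> inv\<^bsub>A\<^esub> y \<notin> L)"
  shows "conjugacy_separable \<C> A"
  unfolding conjugacy_separable_def
proof (intro ballI impI)
  interpret group A by fact
  fix x y assume xy: "x \<in> carrier A" "y \<in> carrier A" "\<not> conjugate_in A x y"
  then obtain L where L: "open_normal \<C> A L"
    and sep: "\<And>g. g \<in> carrier A \<Longrightarrow> g \<otimes>\<^bsub>A\<^esub> x \<otimes>\<^bsub>A\<^esub> inv\<^bsub>A\<^esub> g \<otimes>\<^bsub>A\<^esub> inv\<^bsub>A\<^esub> y \<notin> L"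
    using assms(2)[OF xy] by auto
  interpret L: normal L A using L by (simp add: open_normal_def)
  obtain M i where M: "M \<in> \<C>" "group M" "i \<in> iso (A Mod L) M"
    using L by (auto simp: open_normal_def elim: in_classE)
  let ?\<phi> = "i \<circ> (\<lambda>x. L #>\<^bsub>A\<^esub> x)"
  have \<phi>: "?\<phi> \<in> hom A M"
    using Group.hom_compose[OF L.r_coset_hom_Mod] M(3) by (auto simp: iso_def)
  interpret \<phi>: group_hom A M ?\<phi> using \<phi> M by (simp add: group_hom_def group_hom_axioms_def is_group)
  have "\<not> conjugate_in M (?\<phi> x) (?\<phi> y)"
  proof
    assume "conjugate_in M (?\<phi> x) (?\<phi> y)"
    then obtain m where m: "m \<in> carrier M" "?\<phi> y = m \<otimes>\<^bsub>M\<^esub> ?\<phi> x \<otimes>\<^bsub>M\<^esub> inv\<^bsub>M\<^esub> m"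
      by (auto simp: conjugate_in_def)
    have "i ` carrier (A Mod L) = carrier M" using M(3) by (simp add: iso_def bij_betw_def)
    then obtain g where g: "g \<in> carrier A" "m = ?\<phi> g" using m(1) unfolding carrier_FactGroup by auto
    have "?\<phi> y = ?\<phi> (g \<otimes>\<^bsub>A\<^esub> x \<otimes>\<^bsub>A\<^esub> inv\<^bsub>A\<^esub> g)"
      unfolding m(2) g(2) using g(1) xy(1) by (simp del: o_apply)
    then have "i (L #>\<^bsub>A\<^esub> (g \<otimes>\<^bsub>A\<^esub> x \<otimes>\<^bsub>A\<^esub> inv\<^bsub>A\<^esub> g)) = i (L #>\<^bsub>A\<^esub> y)" by simp
    moreover have "inj_on i (carrier (A Mod L))" using M(3) by (simp add: iso_def bij_betw_def)
    ultimately have "L #>\<^bsub>A\<^esub> (g \<otimes>\<^bsub>A\<^esub> x \<otimes>\<^bsub>A\<^esub> inv\<^bsub>A\<^esub> g) = L #>\<^bsub>A\<^esub> y"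
      using g xy by (intro inj_onD[of i "carrier (A Mod L)"]) (simp_all add: carrier_FactGroup)
    then have "g \<otimes>\<^bsub>A\<^esub> x \<otimes>\<^bsub>A\<^esub> inv\<^bsub>A\<^esub> g \<otimes>\<^bsub>A\<^esub> inv\<^bsub>A\<^esub> y \<in> L"
      using rcos_eq_iff[OF L.subgroup_axioms] g xy by simp
    then show False using sep g by blast
  qed
  then show "\<exists>M\<in>\<C>. \<exists>\<phi>\<in>hom A M. \<not> conjugate_in M (\<phi> x) (\<phi> y)" using M(1) \<phi> by blast
qed

lemma open_normal_times:
  assumes "group A" "group B" "open_normal \<C> A K" "open_normal \<C> B L"
  shows "open_normal \<C> (A \<times>\<times> B) (K \<times> L)"
proof -
  have "open_normal \<C> (A \<times>\<times> B)
    ({x \<in> carrier (A \<times>\<times> B). fst x \<in> K} \<inter> {x \<in> carrier (A \<times>\<times> B). snd x \<in> L})"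
    using assms DirProd_group[OF assms(1,2)]
    by (intro open_normal_Int open_normal_vimage) (auto simp: hom_def)
  moreover have "{x \<in> carrier (A \<times>\<times> B). fst x \<in> K} \<inter> {x \<in> carrier (A \<times>\<times> B). snd x \<in> L} = K \<times> L"
    using assms(3,4) by (auto simp: open_normal_def dest: normal_imp_subgroup subgroup.mem_carrier)
  ultimately show ?thesis by simp
qed

text \<open>A pair \<open>(g1, g2)\<close> of \<open>G\<close> that conjugates \<open>x\<close> to
  \<open>y\<close> modulo \<open>L1 \<times> L2\<close> is corrected in each coordinate, by
  \<open>k1 \<in> K\<^sub>1\<close> and \<open>k2 \<in> K\<^sub>2\<close>. The corrections are
  chosen independently, yet the corrected pair stays in \<open>G\<close> because
  \<open>(k1, k2)\<close> lies in \<open>G\<close>.\<close>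

lemma conjugacy_separable_subgroup_DirProd:
  assumes "group A" "group B" "coset_conjugacy_separable \<C> A" "coset_conjugacy_separable \<C> B"
    and G: "subgroup G (A \<times>\<times> B)"
    and K: "open_normal \<C> A K\<^sub>1" "open_normal \<C> B K\<^sub>2" "K\<^sub>1 \<times> K\<^sub>2 \<subseteq> G"
  shows "conjugacy_separable \<C> ((A \<times>\<times> B)\<lparr>carrier := G\<rparr>)"
proof (rule conjugacy_separableI)
  interpret A: group A by fact
  interpret B: group B by fact
  interpret P: group "A \<times>\<times> B" by (rule DirProd_group) fact+
  interpret G: subgroup G "A \<times>\<times> B" by fact
  let ?G = "(A \<times>\<times> B)\<lparr>carrier := G\<rparr>"
  show "group ?G" using G.subgroup_is_group P.is_group by simp
  fix x y assume "x \<in> carrier ?G" "y \<in> carrier ?G" and nc: "\<not> conjugate_in ?G x y"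
  moreover obtain x1 x2 y1 y2 where eq: "x = (x1, x2)" "y = (y1, y2)" by fastforce
  ultimately have xy: "(x1, x2) \<in> G" "(y1, y2) \<in> G" and car: "x1 \<in> carrier A" "x2 \<in> carrier B"
    "y1 \<in> carrier A" "y2 \<in> carrier B"
    using G.subset by auto
  obtain L1 where L1: "open_normal \<C> A L1" "L1 \<subseteq> K\<^sub>1"
    "\<And>g. g \<in> carrier A \<Longrightarrow> g \<otimes>\<^bsub>A\<^esub> x1 \<otimes>\<^bsub>A\<^esub> inv\<^bsub>A\<^esub> g \<otimes>\<^bsub>A\<^esub> inv\<^bsub>A\<^esub> y1 \<in> L1 \<Longrightarrow>
      \<exists>k\<in>K\<^sub>1. (g \<otimes>\<^bsub>A\<^esub> k) \<otimes>\<^bsub>A\<^esub> x1 \<otimes>\<^bsub>A\<^esub> inv\<^bsub>A\<^esub> (g \<otimes>\<^bsub>A\<^esub> k) = y1"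
    using assms(3)[unfolded coset_conjugacy_separable_def, rule_format, OF car(1,3) K(1)] by blast
  obtain L2 where L2: "open_normal \<C> B L2" "L2 \<subseteq> K\<^sub>2"
    "\<And>g. g \<in> carrier B \<Longrightarrow> g \<otimes>\<^bsub>B\<^esub> x2 \<otimes>\<^bsub>B\<^esub> inv\<^bsub>B\<^esub> g \<otimes>\<^bsub>B\<^esub> inv\<^bsub>B\<^esub> y2 \<in> L2 \<Longrightarrow>
      \<exists>k\<in>K\<^sub>2. (g \<otimes>\<^bsub>B\<^esub> k) \<otimes>\<^bsub>B\<^esub> x2 \<otimes>\<^bsub>B\<^esub> inv\<^bsub>B\<^esub> (g \<otimes>\<^bsub>B\<^esub> k) = y2"
    using assms(4)[unfolded coset_conjugacy_separable_def, rule_format, OF car(2,4) K(2)] by blast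
  have "g \<otimes>\<^bsub>?G\<^esub> x \<otimes>\<^bsub>?G\<^esub> inv\<^bsub>?G\<^esub> g \<otimes>\<^bsub>?G\<^esub> inv\<^bsub>?G\<^esub> y \<notin> (L1 \<times> L2) \<inter> G" if "g \<in> carrier ?G" for g
  proof
    assume *: "g \<otimes>\<^bsub>?G\<^esub> x \<otimes>\<^bsub>?G\<^esub> inv\<^bsub>?G\<^esub> g \<otimes>\<^bsub>?G\<^esub> inv\<^bsub>?G\<^esub> y \<in> (L1 \<times> L2) \<inter> G"
    obtain g1 g2 where g: "g = (g1, g2)" by fastforce
    then have gG: "(g1, g2) \<in> G" "g1 \<in> carrier A" "g2 \<in> carrier B" using that G.subset by auto
    have **: "g1 \<otimes>\<^bsub>A\<^esub> x1 \<otimes>\<^bsub>A\<^esub> inv\<^bsub>A\<^esub> g1 \<otimes>\<^bsub>A\<^esub> inv\<^bsub>A\<^esub> y1 \<in> L1"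
      "g2 \<otimes>\<^bsub>B\<^esub> x2 \<otimes>\<^bsub>B\<^esub> inv\<^bsub>B\<^esub> g2 \<otimes>\<^bsub>B\<^esub> inv\<^bsub>B\<^esub> y2 \<in> L2"
      using * gG xy car by (simp_all add: eq g G.subgroup_axioms inv_DirProd A.is_group B.is_group)
    obtain k1 where k1: "k1 \<in> K\<^sub>1" "(g1 \<otimes>\<^bsub>A\<^esub> k1) \<otimes>\<^bsub>A\<^esub> x1 \<otimes>\<^bsub>A\<^esub> inv\<^bsub>A\<^esub> (g1 \<otimes>\<^bsub>A\<^esub> k1) = y1"
      using L1(3)[OF gG(2) **(1)] by blast
    obtain k2 where k2: "k2 \<in> K\<^sub>2" "(g2 \<otimes>\<^bsub>B\<^esub> k2) \<otimes>\<^bsub>B\<^esub> x2 \<otimes>\<^bsub>B\<^esub> inv\<^bsub>B\<^esub> (g2 \<otimes>\<^bsub>B\<^esub> k2) = y2"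
      using L2(3)[OF gG(3) **(2)] by blast
    have kG: "(k1, k2) \<in> G" using k1 k2 K(3) by auto
    then have kc: "k1 \<in> carrier A" "k2 \<in> carrier B" using G.subset by auto
    have gk: "(g1 \<otimes>\<^bsub>A\<^esub> k1, g2 \<otimes>\<^bsub>B\<^esub> k2) \<in> G" using G.m_closed[OF gG(1) kG] by simp
    have "conjugate_in ?G x y"
      unfolding conjugate_in_def eq
      by (rule bexI[of _ "(g1 \<otimes>\<^bsub>A\<^esub> k1, g2 \<otimes>\<^bsub>B\<^esub> k2)"])
         (use gk k1 k2 kc gG in \<open>simp_all add: G.subgroup_axioms inv_DirProd A.is_group B.is_group\<close>)
    then show False using nc by simp
  qed
  moreover have "open_normal \<C> ?G ((L1 \<times> L2) \<inter> G)"
    by (rule open_normal_restrict[OF open_normal_times[OF assms(1,2) L1(1) L2(1)] G P.is_group])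
  ultimately show "\<exists>L. open_normal \<C> ?G L \<and>
      (\<forall>g\<in>carrier ?G. g \<otimes>\<^bsub>?G\<^esub> x \<otimes>\<^bsub>?G\<^esub> inv\<^bsub>?G\<^esub> g \<otimes>\<^bsub>?G\<^esub> inv\<^bsub>?G\<^esub> y \<notin> L)"
    by (intro exI[of _ "(L1 \<times> L2) \<inter> G"] conjI ballI)
qed

text \<open>Conjugacy separability is applied to the open subgroup generated by \<open>K\<close> and \<open>x\<close>: its elements
  conjugate \<open>x\<close> in the same way as those of \<open>K\<close>.\<close>

lemma separate_coset_conjugates:
  assumes "group A" "hereditarily_conjugacy_separable \<C> A" "open_normal \<C> A K"
    and x: "x \<in> carrier A" and y: "y \<in> carrier A"
  obtains L where "open_normal \<C> A L" "L \<subseteq> K"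
    "\<And>k. k \<in> K \<Longrightarrow> k \<otimes>\<^bsub>A\<^esub> x \<otimes>\<^bsub>A\<^esub> inv\<^bsub>A\<^esub> k \<otimes>\<^bsub>A\<^esub> inv\<^bsub>A\<^esub> y \<in> L \<Longrightarrow>
       \<exists>k\<in>K. k \<otimes>\<^bsub>A\<^esub> x \<otimes>\<^bsub>A\<^esub> inv\<^bsub>A\<^esub> k = y"
proof -
  interpret group A by fact
  interpret K: normal K A using assms(3) by (simp add: open_normal_def)
  consider "\<exists>k\<in>K. k \<otimes>\<^bsub>A\<^esub> x \<otimes>\<^bsub>A\<^esub> inv\<^bsub>A\<^esub> k = y" | "y \<otimes>\<^bsub>A\<^esub> inv\<^bsub>A\<^esub> x \<notin> K"
    | "y \<otimes>\<^bsub>A\<^esub> inv\<^bsub>A\<^esub> x \<in> K" "\<not> (\<exists>k\<in>K. k \<otimes>\<^bsub>A\<^esub> x \<otimes>\<^bsub>A\<^esub> inv\<^bsub>A\<^esub> k = y)" by blast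
  then show ?thesis
  proof cases
    case 1
    show ?thesis by (rule that[OF assms(3) order_refl]) (rule 1)
  next
    \<comment> \<open>Modulo \<open>K\<close>, conjugation by an element of \<open>K\<close> does
      nothing, so \<open>k x k^-1\<close> can be congruent to \<open>y\<close> only if
      \<open>x\<close> is. Already \<open>L = K\<close> separates.\<close>
    case 2
    show ?thesis
    proof (rule that[OF assms(3) order_refl])
      fix k assume k: "k \<in> K" "k \<otimes>\<^bsub>A\<^esub> x \<otimes>\<^bsub>A\<^esub> inv\<^bsub>A\<^esub> k \<otimes>\<^bsub>A\<^esub> inv\<^bsub>A\<^esub> y \<in> K"
      have q: "x \<otimes>\<^bsub>A\<^esub> inv\<^bsub>A\<^esub> k \<otimes>\<^bsub>A\<^esub> inv\<^bsub>A\<^esub> x \<in> K" using k(1) x K.inv_op_closed2 by simp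
      have "inv\<^bsub>A\<^esub> (k \<otimes>\<^bsub>A\<^esub> x \<otimes>\<^bsub>A\<^esub> inv\<^bsub>A\<^esub> k \<otimes>\<^bsub>A\<^esub> inv\<^bsub>A\<^esub> y) \<otimes>\<^bsub>A\<^esub> k \<otimes>\<^bsub>A\<^esub> (x \<otimes>\<^bsub>A\<^esub> inv\<^bsub>A\<^esub> k \<otimes>\<^bsub>A\<^esub> inv\<^bsub>A\<^esub> x) \<in> K"
        by (rule K.m_closed[OF K.m_closed[OF K.m_inv_closed[OF k(2)] k(1)] q])
      then have "y \<otimes>\<^bsub>A\<^esub> inv\<^bsub>A\<^esub> x \<in> K" using k(1) x y by (simp add: group_norm)
      with 2 show "\<exists>k\<in>K. k \<otimes>\<^bsub>A\<^esub> x \<otimes>\<^bsub>A\<^esub> inv\<^bsub>A\<^esub> k = y" by simp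
    qed
  next
    case 3
    define X where "X = generate A {x}"
    define H where "H = K <#>\<^bsub>A\<^esub> X"
    have X: "subgroup X A" using x by (simp add: X_def generate_is_subgroup)
    have Xc: "z \<otimes>\<^bsub>A\<^esub> x \<otimes>\<^bsub>A\<^esub> inv\<^bsub>A\<^esub> z = x" if "z \<in> X" for z
    proof -
      obtain n :: int where z: "z = x [^]\<^bsub>A\<^esub> n" using \<open>z \<in> X\<close> x by (auto simp: X_def generate_pow)
      have "z \<otimes>\<^bsub>A\<^esub> x = x \<otimes>\<^bsub>A\<^esub> z"
        using x int_pow_mult[of x n 1] int_pow_mult[of x 1 n] by (simp add: z add.commute)
      then show ?thesis using x by (simp add: m_assoc z)
    qed
    interpret S: second_isomorphism_grp K A X
      by (simp add: second_isomorphism_grp_def second_isomorphism_grp_axioms_def X K.normal_axioms)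
    have H: "subgroup H A" unfolding H_def by (rule S.normal_set_mult_subgroup)
    interpret H: subgroup H A by (rule H)
    have KH: "K \<subseteq> H"
    proof
      fix k assume "k \<in> K"
      then have "k \<otimes>\<^bsub>A\<^esub> \<one>\<^bsub>A\<^esub> \<in> H" unfolding H_def set_mult_def using subgroup.one_closed[OF X] by blast
      then show "k \<in> H" using \<open>k \<in> K\<close> by simp
    qed
    have xX: "x \<in> X" unfolding X_def by (simp add: generate.incl)
    then have "\<one>\<^bsub>A\<^esub> \<otimes>\<^bsub>A\<^esub> x \<in> H" "y \<otimes>\<^bsub>A\<^esub> inv\<^bsub>A\<^esub> x \<otimes>\<^bsub>A\<^esub> x \<in> H"
      unfolding H_def set_mult_def using K.one_closed 3(1) by blast+
    then have xy: "x \<in> H" "y \<in> H" using x y by (simp_all add: m_assoc)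
    let ?H = "A\<lparr>carrier := H\<rparr>"
    have gH: "group ?H" by (rule H.subgroup_is_group[OF is_group])
    have "\<not> conjugate_in ?H x y"
    proof
      assume "conjugate_in ?H x y"
      then obtain h where h: "h \<in> H" "y = h \<otimes>\<^bsub>A\<^esub> x \<otimes>\<^bsub>A\<^esub> inv\<^bsub>A\<^esub> h"
        unfolding conjugate_in_def using m_inv_consistent[OF H] by auto
      from h(1) obtain k z where kz: "k \<in> K" "z \<in> X" "h = k \<otimes>\<^bsub>A\<^esub> z"
        unfolding H_def set_mult_def by blast
      have zc: "z \<in> carrier A" using subgroup.mem_carrier[OF X kz(2)] .
      have "y = k \<otimes>\<^bsub>A\<^esub> (z \<otimes>\<^bsub>A\<^esub> x \<otimes>\<^bsub>A\<^esub> inv\<^bsub>A\<^esub> z) \<otimes>\<^bsub>A\<^esub> inv\<^bsub>A\<^esub> k"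
        unfolding h(2) kz(3) using kz(1) zc x by (simp add: group_norm)
      then have "k \<otimes>\<^bsub>A\<^esub> x \<otimes>\<^bsub>A\<^esub> inv\<^bsub>A\<^esub> k = y" using Xc[OF kz(2)] by simp
      then show False using 3(2) kz(1) by blast
    qed
    moreover have CS: "conjugacy_separable \<C> ?H"
      using assms(2) H openin_pro_topology_subgroup[OF is_group assms(3) KH H]
      by (simp add: hereditarily_conjugacy_separable_def)
    ultimately have "\<exists>M\<in>\<C>. \<exists>\<phi>\<in>hom ?H M. \<not> conjugate_in M (\<phi> x) (\<phi> y)"
      using xy by (simp add: conjugacy_separable_def)
    then obtain M \<phi> where M: "M \<in> \<C>" "\<phi> \<in> hom ?H M" "\<not> conjugate_in M (\<phi> x) (\<phi> y)"
      by (elim bexE)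
    interpret \<phi>: group_hom ?H M \<phi>
      using M gH group_member by (simp add: group_hom_def group_hom_axioms_def)
    have gK: "group (A\<lparr>carrier := K\<rparr>)" using K.subgroup_is_group is_group by simp
    have "\<phi> \<in> hom (A\<lparr>carrier := K\<rparr>) M" using M(2) KH by (auto simp: hom_def)
    \<comment> \<open>\<open>\<phi>\<close> is defined on \<open>H\<close> only, so its kernel in
      \<open>K\<close> is normal in \<open>K\<close> but perhaps not in \<open>A\<close>; passing to
      a core repairs this.\<close>
    from open_normal_kernel[OF in_class_member[OF M(1)] gK this]
    obtain L where L: "open_normal \<C> A L" "L \<subseteq> kernel (A\<lparr>carrier := K\<rparr>) M \<phi>"
      by (rule open_normal_core[OF is_group assms(3)])
    have LK: "L \<subseteq> K" using L(2) by (auto simp: kernel_def)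
    show ?thesis
    proof (rule that[OF L(1) LK])
      fix k assume k: "k \<in> K" and kL: "k \<otimes>\<^bsub>A\<^esub> x \<otimes>\<^bsub>A\<^esub> inv\<^bsub>A\<^esub> k \<otimes>\<^bsub>A\<^esub> inv\<^bsub>A\<^esub> y \<in> L"
      have 1: "\<phi> (k \<otimes>\<^bsub>A\<^esub> x \<otimes>\<^bsub>A\<^esub> inv\<^bsub>A\<^esub> k \<otimes>\<^bsub>A\<^esub> inv\<^bsub>A\<^esub> y) = \<one>\<^bsub>M\<^esub>"
        using subsetD[OF L(2) kL] by (simp add: kernel_def)
      have kH: "k \<in> H" using k KH by blast
      have mul: "\<phi> (a \<otimes>\<^bsub>A\<^esub> b) = \<phi> a \<otimes>\<^bsub>M\<^esub> \<phi> b" if "a \<in> H" "b \<in> H" for a b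
        using \<phi>.hom_mult[of a b] that by simp
      have inv: "\<phi> (inv\<^bsub>A\<^esub> a) = inv\<^bsub>M\<^esub> \<phi> a" if "a \<in> H" for a
        using \<phi>.hom_inv[of a] that H by simp
      have cl: "\<phi> a \<in> carrier M" if "a \<in> H" for a using \<phi>.hom_closed[of a] that by simp
      have "\<phi> k \<otimes>\<^bsub>M\<^esub> \<phi> x \<otimes>\<^bsub>M\<^esub> inv\<^bsub>M\<^esub> \<phi> k \<otimes>\<^bsub>M\<^esub> inv\<^bsub>M\<^esub> \<phi> y = \<one>\<^bsub>M\<^esub>"
        using 1 kH xy by (simp add: mul inv)
      then have "\<phi> y = \<phi> k \<otimes>\<^bsub>M\<^esub> \<phi> x \<otimes>\<^bsub>M\<^esub> inv\<^bsub>M\<^esub> \<phi> k"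
        using \<phi>.H.inv_equality[of _ "inv\<^bsub>M\<^esub> \<phi> y"] cl kH xy by simp
      then have "conjugate_in M (\<phi> x) (\<phi> y)"
        unfolding conjugate_in_def using cl[OF kH] by (rule bexI)
      with M(3) show "\<exists>k\<in>K. k \<otimes>\<^bsub>A\<^esub> x \<otimes>\<^bsub>A\<^esub> inv\<^bsub>A\<^esub> k = y" by (rule notE)
    qed
  qed
qed

text \<open>If \<open>g\<close> lies in the coset \<open>c\<close>, then
  \<open>k = (rep c)^-1 g\<close> lies in \<open>K\<close>, and \<open>g\<close> conjugates
  \<open>x\<close> to \<open>y\<close> modulo a normal subgroup exactly if \<open>k\<close>
  conjugates \<open>x\<close> to \<open>?y c\<close>. So only conjugators in \<open>K\<close> have
  to be treated, with one target for each of the finitely many cosets.\<close>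

lemma coset_conjugacy_separable_hereditarily:
  assumes "group A" "hereditarily_conjugacy_separable \<C> A"
  shows "coset_conjugacy_separable \<C> A"
  unfolding coset_conjugacy_separable_def
proof (intro ballI allI impI)
  interpret group A by fact
  fix x y K assume x: "x \<in> carrier A" and y: "y \<in> carrier A" and K: "open_normal \<C> A K"
  interpret K: normal K A using K by (simp add: open_normal_def)
  define rep where "rep c = (SOME g. g \<in> c)" for c :: "'a set"
  let ?R = "rcosets\<^bsub>A\<^esub> K"
  have rep: "rep c \<in> c" if "c \<in> ?R" for c
    using K.rcosets_non_empty[OF that] by (simp add: rep_def some_in_eq)
  have rep_carrier: "rep c \<in> carrier A" if "c \<in> ?R" for c
    using rep[OF that] that K.rcosets_carrier[OF is_group] by blast
  let ?y = "\<lambda>c. inv\<^bsub>A\<^esub> (rep c) \<otimes>\<^bsub>A\<^esub> y \<otimes>\<^bsub>A\<^esub> rep c"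
  define sep where "sep L y \<longleftrightarrow> (\<forall>k\<in>K. k \<otimes>\<^bsub>A\<^esub> x \<otimes>\<^bsub>A\<^esub> inv\<^bsub>A\<^esub> k \<otimes>\<^bsub>A\<^esub> inv\<^bsub>A\<^esub> y \<in> L \<longrightarrow>
        (\<exists>k\<in>K. k \<otimes>\<^bsub>A\<^esub> x \<otimes>\<^bsub>A\<^esub> inv\<^bsub>A\<^esub> k = y))" for L y
  have "\<exists>L. open_normal \<C> A L \<and> L \<subseteq> K \<and> sep L (?y c)" if "c \<in> ?R" for c
  proof -
    have yc: "?y c \<in> carrier A" using rep_carrier[OF that] y by simp
    obtain L where L: "open_normal \<C> A L" "L \<subseteq> K"
      "\<And>k. k \<in> K \<Longrightarrow> k \<otimes>\<^bsub>A\<^esub> x \<otimes>\<^bsub>A\<^esub> inv\<^bsub>A\<^esub> k \<otimes>\<^bsub>A\<^esub> inv\<^bsub>A\<^esub> ?y c \<in> L \<Longrightarrow>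
       \<exists>k\<in>K. k \<otimes>\<^bsub>A\<^esub> x \<otimes>\<^bsub>A\<^esub> inv\<^bsub>A\<^esub> k = ?y c"
      using separate_coset_conjugates[OF is_group assms(2) K x yc] by metis
    have "sep L (?y c)" unfolding sep_def by (intro ballI impI) (rule L(3))
    with L(1,2) show ?thesis by blast
  qed
  then obtain L where L: "\<forall>c\<in>?R. open_normal \<C> A (L c) \<and> L c \<subseteq> K \<and> sep (L c) (?y c)"
    by (metis (no_types))
  let ?L = "K \<inter> (carrier A \<inter> (\<Inter>c\<in>?R. L c))"
  have ON: "open_normal \<C> A ?L"
    by (intro open_normal_Int K open_normal_INT is_group open_normal_finite_index[OF K]) (use L in blast)
  have sep: "\<exists>k\<in>K. (g \<otimes>\<^bsub>A\<^esub> k) \<otimes>\<^bsub>A\<^esub> x \<otimes>\<^bsub>A\<^esub> inv\<^bsub>A\<^esub> (g \<otimes>\<^bsub>A\<^esub> k) = y"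
    if g: "g \<in> carrier A" and l: "g \<otimes>\<^bsub>A\<^esub> x \<otimes>\<^bsub>A\<^esub> inv\<^bsub>A\<^esub> g \<otimes>\<^bsub>A\<^esub> inv\<^bsub>A\<^esub> y \<in> ?L" for g
  proof -
    let ?c = "K #>\<^bsub>A\<^esub> g"
    have c: "?c \<in> ?R" using g by (rule rcosetsI[OF K.subset])
    obtain k0 where k0: "k0 \<in> K" "rep ?c = k0 \<otimes>\<^bsub>A\<^esub> g"
      using rep[OF c] by (auto simp: r_coset_def)
    interpret Lc: normal "L ?c" A using bspec[OF L c] by (simp add: open_normal_def)
    define k where "k = inv\<^bsub>A\<^esub> g \<otimes>\<^bsub>A\<^esub> inv\<^bsub>A\<^esub> k0 \<otimes>\<^bsub>A\<^esub> g"
    have k: "k \<in> K" unfolding k_def using k0(1) g K.inv_op_closed1 by simp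
    let ?r = "rep ?c"
    have r: "?r \<in> carrier A" by (rule rep_carrier[OF c])
    have gr: "inv\<^bsub>A\<^esub> ?r \<otimes>\<^bsub>A\<^esub> g = k" unfolding k0(2) k_def using k0(1) g by (simp add: group_norm)
    have "g \<otimes>\<^bsub>A\<^esub> x \<otimes>\<^bsub>A\<^esub> inv\<^bsub>A\<^esub> g \<otimes>\<^bsub>A\<^esub> inv\<^bsub>A\<^esub> y \<in> L ?c" using l c by blast
    from Lc.inv_op_closed1[OF r this]
    have "k \<otimes>\<^bsub>A\<^esub> x \<otimes>\<^bsub>A\<^esub> inv\<^bsub>A\<^esub> k \<otimes>\<^bsub>A\<^esub> inv\<^bsub>A\<^esub> ?y ?c \<in> L ?c"
      unfolding gr[symmetric] using r g x y by (simp add: group_norm)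
    with bspec[OF L c] k obtain k' where k': "k' \<in> K" "k' \<otimes>\<^bsub>A\<^esub> x \<otimes>\<^bsub>A\<^esub> inv\<^bsub>A\<^esub> k' = ?y ?c"
      unfolding sep_def by blast
    have "?r \<otimes>\<^bsub>A\<^esub> (k' \<otimes>\<^bsub>A\<^esub> x \<otimes>\<^bsub>A\<^esub> inv\<^bsub>A\<^esub> k') \<otimes>\<^bsub>A\<^esub> inv\<^bsub>A\<^esub> ?r = y"
      unfolding k'(2) using r y by (simp add: group_norm)
    moreover have "?r = g \<otimes>\<^bsub>A\<^esub> inv\<^bsub>A\<^esub> k" unfolding k_def k0(2) using k0(1) g by (simp add: group_norm)
    ultimately have "(g \<otimes>\<^bsub>A\<^esub> (inv\<^bsub>A\<^esub> k \<otimes>\<^bsub>A\<^esub> k')) \<otimes>\<^bsub>A\<^esub> x \<otimes>\<^bsub>A\<^esub> inv\<^bsub>A\<^esub> (g \<otimes>\<^bsub>A\<^esub> (inv\<^bsub>A\<^esub> k \<otimes>\<^bsub>A\<^esub> k')) = y"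
      using g k k'(1) x by (simp add: group_norm)
    then show ?thesis using k k'(1) by blast
  qed
  show "\<exists>L\<subseteq>K. open_normal \<C> A L \<and>
           (\<forall>g\<in>carrier A. g \<otimes>\<^bsub>A\<^esub> x \<otimes>\<^bsub>A\<^esub> inv\<^bsub>A\<^esub> g \<otimes>\<^bsub>A\<^esub> inv\<^bsub>A\<^esub> y \<in> L \<longrightarrow>
              (\<exists>k\<in>K. (g \<otimes>\<^bsub>A\<^esub> k) \<otimes>\<^bsub>A\<^esub> x \<otimes>\<^bsub>A\<^esub> inv\<^bsub>A\<^esub> (g \<otimes>\<^bsub>A\<^esub> k) = y))"
    by (rule exI[of _ ?L], intro conjI ballI impI, blast, rule ON, rule sep)
qed

end

section \<open>Subdirect products\<close>

context pseudovariety
begin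

lemma open_normal_image:
  assumes "group A" "group B" "h \<in> hom A B" "h ` carrier A = carrier B" "open_normal \<C> A N"
  shows "open_normal \<C> B (h ` N)"
proof -
  interpret N: normal N A using assms(5) by (simp add: open_normal_def)
  interpret h: group_hom A B h using assms by (simp add: group_hom_def group_hom_axioms_def)
  have n: "h ` N \<lhd> B" by (rule N.surj_hom_normal_subgroup[OF h.group_hom_axioms assms(4)])
  interpret n: normal "h ` N" B by (rule n)
  let ?q = "(\<lambda>y. h ` N #>\<^bsub>B\<^esub> y) \<circ> h"
  have q: "?q \<in> hom A (B Mod h ` N)" by (rule Group.hom_compose[OF assms(3) n.r_coset_hom_Mod])
  interpret q: group_hom A "B Mod h ` N" ?q
    using q assms(1) n.factorgroup_is_group by (simp add: group_hom_def group_hom_axioms_def)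
  have "N \<subseteq> kernel A (B Mod h ` N) ?q"
    using n.rcos_const[OF assms(2)] by (auto simp: kernel_def)
  then obtain g where g: "g \<in> hom (A Mod N) (B Mod h ` N)"
    "\<And>x. x \<in> carrier A \<Longrightarrow> g (N #>\<^bsub>A\<^esub> x) = ?q x"
    using q.FactGroup_universal_kernel[OF N.normal_axioms] by metis
  have "g ` carrier (A Mod N) = ?q ` carrier A" using g(2) by (simp add: carrier_FactGroup image_image)
  also have "\<dots> = carrier (B Mod h ` N)" using assms(4) by (simp only: carrier_FactGroup image_comp[symmetric])
  finally have "in_class \<C> (B Mod h ` N)"
    using in_class_surj[OF _ n.factorgroup_is_group g(1)] assms(5) by (simp add: open_normal_def)
  then show ?thesis using n by (simp add: open_normal_def)
qed

end

locale subdirect =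
  fixes A :: "('a, 'm) monoid_scheme" and B :: "('b, 'n) monoid_scheme" and G :: "('a \<times> 'b) set"
  assumes gA: "group A" and gB: "group B" and G: "subdirect_product A B G"
begin

definition N1 where "N1 = inter_first_factor A B G"
definition N2 where "N2 = {y \<in> carrier B. (\<one>\<^bsub>A\<^esub>, y) \<in> G}"

abbreviation GG where "GG \<equiv> (A \<times>\<times> B)\<lparr>carrier := G\<rparr>"

sublocale A: group A by (rule gA)
sublocale B: group B by (rule gB)
sublocale P: group "A \<times>\<times> B" by (rule DirProd_group[OF gA gB])
sublocale G: subgroup G "A \<times>\<times> B" using G by (simp add: subdirect_product_def)

lemma gG: "group GG" by (rule G.subgroup_is_group[OF P.is_group])

lemma G_carrier: "(x, y) \<in> G \<Longrightarrow> x \<in> carrier A" "(x, y) \<in> G \<Longrightarrow> y \<in> carrier B"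
  using G.subset by auto

lemma G_mult: "(x, y) \<in> G \<Longrightarrow> (x', y') \<in> G \<Longrightarrow> (x \<otimes>\<^bsub>A\<^esub> x', y \<otimes>\<^bsub>B\<^esub> y') \<in> G"
  using G.m_closed by fastforce

lemma G_inv: "(x, y) \<in> G \<Longrightarrow> (inv\<^bsub>A\<^esub> x, inv\<^bsub>B\<^esub> y) \<in> G"
  using G.m_inv_closed G_carrier inv_DirProd[OF gA gB] by metis

lemma fst_onto: "x \<in> carrier A \<Longrightarrow> \<exists>y. (x, y) \<in> G"
  using G by (force simp: subdirect_product_def)

lemma snd_onto: "y \<in> carrier B \<Longrightarrow> \<exists>x. (x, y) \<in> G"
  using G by (force simp: subdirect_product_def)

lemma mem_N1: "x \<in> N1 \<longleftrightarrow> (x, \<one>\<^bsub>B\<^esub>) \<in> G"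
  using G_carrier by (auto simp: N1_def inter_first_factor_def)

lemma mem_N2: "y \<in> N2 \<longleftrightarrow> (\<one>\<^bsub>A\<^esub>, y) \<in> G"
  using G_carrier by (auto simp: N2_def)

lemma N1_normal: "N1 \<lhd> A"
  unfolding A.normal_inv_iff
proof (intro conjI ballI A.subgroupI)
  fix x h assume x: "x \<in> carrier A" and h: "h \<in> N1"
  obtain y where y: "(x, y) \<in> G" using fst_onto[OF x] by blast
  have "(x \<otimes>\<^bsub>A\<^esub> h \<otimes>\<^bsub>A\<^esub> inv\<^bsub>A\<^esub> x, y \<otimes>\<^bsub>B\<^esub> \<one>\<^bsub>B\<^esub> \<otimes>\<^bsub>B\<^esub> inv\<^bsub>B\<^esub> y) \<in> G"
    using y h by (intro G_mult G_inv) (simp_all add: mem_N1)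
  then show "x \<otimes>\<^bsub>A\<^esub> h \<otimes>\<^bsub>A\<^esub> inv\<^bsub>A\<^esub> x \<in> N1" using G_carrier(2)[OF y] by (simp add: mem_N1)
next
  show "N1 \<noteq> {}" using G.one_closed mem_N1[of "\<one>\<^bsub>A\<^esub>"] by auto
next
  fix a assume "a \<in> N1" then show "inv\<^bsub>A\<^esub> a \<in> N1" using G_inv[of a "\<one>\<^bsub>B\<^esub>"] by (simp add: mem_N1)
next
  fix a b assume "a \<in> N1" "b \<in> N1"
  then show "a \<otimes>\<^bsub>A\<^esub> b \<in> N1" using G_mult[of a "\<one>\<^bsub>B\<^esub>" b "\<one>\<^bsub>B\<^esub>"] by (simp add: mem_N1)
qed (auto simp: mem_N1 G_carrier)

lemma N2_normal: "N2 \<lhd> B"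
  unfolding B.normal_inv_iff
proof (intro conjI ballI B.subgroupI)
  fix x h assume x: "x \<in> carrier B" and h: "h \<in> N2"
  obtain y where y: "(y, x) \<in> G" using snd_onto[OF x] by blast
  have "(y \<otimes>\<^bsub>A\<^esub> \<one>\<^bsub>A\<^esub> \<otimes>\<^bsub>A\<^esub> inv\<^bsub>A\<^esub> y, x \<otimes>\<^bsub>B\<^esub> h \<otimes>\<^bsub>B\<^esub> inv\<^bsub>B\<^esub> x) \<in> G"
    using y h by (intro G_mult G_inv) (simp_all add: mem_N2)
  then show "x \<otimes>\<^bsub>B\<^esub> h \<otimes>\<^bsub>B\<^esub> inv\<^bsub>B\<^esub> x \<in> N2" using G_carrier(1)[OF y] by (simp add: mem_N2)
next
  show "N2 \<noteq> {}" using G.one_closed mem_N2[of "\<one>\<^bsub>B\<^esub>"] by auto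
next
  fix a assume "a \<in> N2" then show "inv\<^bsub>B\<^esub> a \<in> N2" using G_inv[of "\<one>\<^bsub>A\<^esub>" a] by (simp add: mem_N2)
next
  fix a b assume "a \<in> N2" "b \<in> N2"
  then show "a \<otimes>\<^bsub>B\<^esub> b \<in> N2" using G_mult[of "\<one>\<^bsub>A\<^esub>" a "\<one>\<^bsub>A\<^esub>" b] by (simp add: mem_N2)
qed (auto simp: mem_N2 G_carrier)

sublocale N1: normal N1 A by (rule N1_normal)
sublocale N2: normal N2 B by (rule N2_normal)

lemma N1_times_N2: "N1 \<times> N2 \<subseteq> G"
  using G_mult[of _ "\<one>\<^bsub>B\<^esub>" "\<one>\<^bsub>A\<^esub>"] G_carrier by (fastforce simp: mem_N1 mem_N2)

lemma fst_hom: "fst \<in> hom GG A" and snd_hom: "snd \<in> hom GG B"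
  by (auto simp: hom_def G_carrier)

text \<open>A coset of \<open>N1\<close> is the trace on the first factor of a coset of
  \<open>G\<close>.\<close>

lemma finite_index_N1: "finite_index (A \<times>\<times> B) G \<Longrightarrow> finite (rcosets\<^bsub>A\<^esub> N1)"
proof -
  assume fin: "finite_index (A \<times>\<times> B) G"
  have "N1 #>\<^bsub>A\<^esub> x = {a. (a, \<one>\<^bsub>B\<^esub>) \<in> G #>\<^bsub>A \<times>\<times> B\<^esub> (x, \<one>\<^bsub>B\<^esub>)}" if x: "x \<in> carrier A" for x
  proof -
    have "a \<in> N1 #>\<^bsub>A\<^esub> x \<longleftrightarrow> (a, \<one>\<^bsub>B\<^esub>) \<in> G #>\<^bsub>A \<times>\<times> B\<^esub> (x, \<one>\<^bsub>B\<^esub>)" for a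
    proof
      assume "(a, \<one>\<^bsub>B\<^esub>) \<in> G #>\<^bsub>A \<times>\<times> B\<^esub> (x, \<one>\<^bsub>B\<^esub>)"
      then obtain u v where uv: "(u, v) \<in> G" "a = u \<otimes>\<^bsub>A\<^esub> x" "\<one>\<^bsub>B\<^esub> = v \<otimes>\<^bsub>B\<^esub> \<one>\<^bsub>B\<^esub>"
        by (auto simp: r_coset_def)
      then have "u \<in> N1" using G_carrier(2)[OF uv(1)] by (simp add: mem_N1)
      then show "a \<in> N1 #>\<^bsub>A\<^esub> x" using uv by (auto simp: r_coset_def)
    qed (force simp: r_coset_def mem_N1)
    then show ?thesis by blast
  qed
  then have "rcosets\<^bsub>A\<^esub> N1 \<subseteq> (\<lambda>c. {a. (a, \<one>\<^bsub>B\<^esub>) \<in> c}) ` (rcosets\<^bsub>A \<times>\<times> B\<^esub> G)"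
    by (auto simp: RCOSETS_def)
  then show ?thesis using fin finite_surj unfolding finite_index_def by blast
qed

lemma finite_index_N2: "finite_index (A \<times>\<times> B) G \<Longrightarrow> finite (rcosets\<^bsub>B\<^esub> N2)"
proof -
  assume fin: "finite_index (A \<times>\<times> B) G"
  have "N2 #>\<^bsub>B\<^esub> x = {a. (\<one>\<^bsub>A\<^esub>, a) \<in> G #>\<^bsub>A \<times>\<times> B\<^esub> (\<one>\<^bsub>A\<^esub>, x)}" if x: "x \<in> carrier B" for x
  proof -
    have "a \<in> N2 #>\<^bsub>B\<^esub> x \<longleftrightarrow> (\<one>\<^bsub>A\<^esub>, a) \<in> G #>\<^bsub>A \<times>\<times> B\<^esub> (\<one>\<^bsub>A\<^esub>, x)" for a
    proof
      assume "(\<one>\<^bsub>A\<^esub>, a) \<in> G #>\<^bsub>A \<times>\<times> B\<^esub> (\<one>\<^bsub>A\<^esub>, x)"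
      then obtain u v where uv: "(u, v) \<in> G" "a = v \<otimes>\<^bsub>B\<^esub> x" "\<one>\<^bsub>A\<^esub> = u \<otimes>\<^bsub>A\<^esub> \<one>\<^bsub>A\<^esub>"
        by (auto simp: r_coset_def)
      then have "v \<in> N2" using G_carrier(1)[OF uv(1)] by (simp add: mem_N2)
      then show "a \<in> N2 #>\<^bsub>B\<^esub> x" using uv by (auto simp: r_coset_def)
    qed (force simp: r_coset_def mem_N2)
    then show ?thesis by blast
  qed
  then have "rcosets\<^bsub>B\<^esub> N2 \<subseteq> (\<lambda>c. {a. (\<one>\<^bsub>A\<^esub>, a) \<in> c}) ` (rcosets\<^bsub>A \<times>\<times> B\<^esub> G)"
    by (auto simp: RCOSETS_def)
  then show ?thesis using fin finite_surj unfolding finite_index_def by blast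
qed

end

locale subdirect_pseudovariety = subdirect A B G + pseudovariety \<C>
  for A :: "('a, 'm) monoid_scheme" and B :: "('b, 'n) monoid_scheme" and G and \<C>
begin

lemma fst_image: "fst ` carrier GG = carrier A" and snd_image: "snd ` carrier GG = carrier B"
  using G by (simp_all add: subdirect_product_def)

text \<open>Goursat: \<open>A / N1\<close> and \<open>B / N2\<close> are both isomorphic to
  \<open>G / (N1 \<times> N2)\<close>. Here the preimage of \<open>N1\<close> under the first
  projection of \<open>G\<close>, which is \<open>N1 \<times> N2\<close>, is pushed forward by the
  second.\<close>

lemma open_normal_N2: "open_normal \<C> A N1 \<Longrightarrow> open_normal \<C> B N2"
proof -
  assume "open_normal \<C> A N1"
  then have "open_normal \<C> GG {g \<in> carrier GG. fst g \<in> N1}"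
    by (rule open_normal_vimage[OF gG gA fst_hom])
  then have "open_normal \<C> B (snd ` {g \<in> carrier GG. fst g \<in> N1})"
    by (rule open_normal_image[OF gG gB snd_hom snd_image])
  moreover have "snd ` {g \<in> carrier GG. fst g \<in> N1} = N2"
  proof
    show "snd ` {g \<in> carrier GG. fst g \<in> N1} \<subseteq> N2"
    proof clarsimp
      fix x y assume xy: "(x, y) \<in> G" "x \<in> N1"
      then have "(inv\<^bsub>A\<^esub> x \<otimes>\<^bsub>A\<^esub> x, inv\<^bsub>B\<^esub> \<one>\<^bsub>B\<^esub> \<otimes>\<^bsub>B\<^esub> y) \<in> G"
        by (intro G_mult G_inv) (simp_all add: mem_N1)
      then show "y \<in> N2" using G_carrier[OF xy(1)] by (simp add: mem_N2)
    qed
    show "N2 \<subseteq> snd ` {g \<in> carrier GG. fst g \<in> N1}"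
      by (force simp: mem_N2)
  qed
  ultimately show ?thesis by simp
qed

text \<open>If \<open>N1\<close> is open, then so is \<open>N1 \<times> N2\<close>, which lies in
  \<open>G\<close>. Conversely, an open normal subgroup contained in \<open>G\<close> meets the
  first factor inside \<open>N1\<close>.\<close>

lemma open_iff: "open_normal \<C> A N1 \<longleftrightarrow> openin (pro_topology \<C> (A \<times>\<times> B)) G"
proof
  assume "open_normal \<C> A N1"
  then have "open_normal \<C> (A \<times>\<times> B) (N1 \<times> N2)"
    by (intro open_normal_times gA gB open_normal_N2)
  then show "openin (pro_topology \<C> (A \<times>\<times> B)) G"
    by (rule openin_pro_topology_subgroup[OF P.is_group _ N1_times_N2 G.subgroup_axioms])
next
  assume o: "openin (pro_topology \<C> (A \<times>\<times> B)) G"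
  obtain K where K: "open_normal \<C> (A \<times>\<times> B) K" "K \<subseteq> G"
    by (rule open_normal_subset_open[OF o G.one_closed P.is_group])
  have "(\<lambda>x. (x, \<one>\<^bsub>B\<^esub>)) \<in> hom A (A \<times>\<times> B)" by (auto simp: hom_def)
  from open_normal_vimage[OF gA P.is_group this K(1)] show "open_normal \<C> A N1"
    by (rule open_normal_mono[OF _ _ N1_normal]) (use K(2) in \<open>auto simp: mem_N1\<close>)
qed

text \<open>Otherwise each \<open>f\<close> outside \<open>N1\<close> would be missed by an open
  normal \<open>R\<close> containing \<open>N1\<close>. As \<open>N1\<close> has finite index,
  finitely many such \<open>R\<close> intersect in \<open>N1\<close>, which would be open.\<close>

lemma dense_element:
  assumes fin: "finite (rcosets\<^bsub>A\<^esub> N1)" and "\<not> open_normal \<C> A N1"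
  obtains f where "f \<in> carrier A" "f \<notin> N1"
    "\<And>M \<phi> g. M \<in> \<C> \<Longrightarrow> \<phi> \<in> hom GG M \<Longrightarrow> (f, g) \<in> G \<Longrightarrow> \<phi> (f, g) \<in> \<phi> ` (N1 \<times> N2)"
proof -
  define Q where "Q f \<longleftrightarrow> (\<forall>M \<phi> g. M \<in> \<C> \<longrightarrow> \<phi> \<in> hom GG M \<longrightarrow> (f, g) \<in> G \<longrightarrow> \<phi> (f, g) \<in> \<phi> ` (N1 \<times> N2))" for f
  have "\<exists>f\<in>carrier A - N1. Q f"
  proof (rule ccontr)
    assume contr: "\<not> ?thesis"
    have ex: "\<exists>R. open_normal \<C> A R \<and> N1 \<subseteq> R \<and> f \<notin> R" if f: "f \<in> carrier A - N1" for f
    proof -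
      have "\<not> Q f" using contr f by blast
      then obtain M \<phi> g where M: "M \<in> \<C>" "\<phi> \<in> hom GG M" and fg: "(f, g) \<in> G" "\<phi> (f, g) \<notin> \<phi> ` (N1 \<times> N2)"
        unfolding Q_def by auto
      interpret M: group M using M(1) by (rule group_member)
      interpret \<phi>: group_hom GG M \<phi> using M gG by (simp add: group_hom_def group_hom_axioms_def)
      have mul: "\<phi> (a \<otimes>\<^bsub>A \<times>\<times> B\<^esub> b) = \<phi> a \<otimes>\<^bsub>M\<^esub> \<phi> b" if "a \<in> G" "b \<in> G" for a b
        using \<phi>.hom_mult[of a b] that by simp
      have inv: "\<phi> (inv\<^bsub>A \<times>\<times> B\<^esub> a) = inv\<^bsub>M\<^esub> \<phi> a" if "a \<in> G" for a
        using \<phi>.hom_inv[of a] that P.m_inv_consistent[OF G.subgroup_axioms] by simp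
      have cl: "\<phi> a \<in> carrier M" if "a \<in> G" for a using \<phi>.hom_closed[of a] that by simp
      let ?N = "N1 \<times> N2"
      interpret N: normal ?N "A \<times>\<times> B"
        by (rule A.DirProd_normal[OF gB N1_normal N2_normal])
      have NG: "n \<in> G" if "n \<in> ?N" for n using that N1_times_N2 by blast
      \<comment> \<open>The preimage of the image of \<open>N1 \<times> N2\<close>. It is open
        because it contains the kernel of \<open>\<phi>\<close>; its projection to \<open>A\<close>
        is the subgroup wanted.\<close>
      define R where "R = {r \<in> G. \<phi> r \<in> \<phi> ` ?N}"
      have "subgroup R GG"
      proof (rule group.subgroupI[OF gG])
        show "R \<subseteq> carrier GG" by (auto simp: R_def)
        have "\<one>\<^bsub>A \<times>\<times> B\<^esub> \<in> R"
          unfolding R_def using imageI[OF N.one_closed, of \<phi>] G.one_closed by simp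
        then show "R \<noteq> {}" by blast
      next
        fix a assume "a \<in> R"
        then obtain n where n: "a \<in> G" "n \<in> ?N" "\<phi> a = \<phi> n" by (auto simp: R_def)
        have "\<phi> (inv\<^bsub>A \<times>\<times> B\<^esub> a) = \<phi> (inv\<^bsub>A \<times>\<times> B\<^esub> n)" by (simp only: inv n(1) NG[OF n(2)] n(3))
        then have "inv\<^bsub>A \<times>\<times> B\<^esub> a \<in> R"
          unfolding R_def using G.m_inv_closed[OF n(1)] imageI[OF N.m_inv_closed[OF n(2)], of \<phi>] by simp
        then show "inv\<^bsub>GG\<^esub> a \<in> R" using P.m_inv_consistent[OF G.subgroup_axioms n(1)] by simp
      next
        fix a b assume "a \<in> R" "b \<in> R"
        then obtain n m where n: "a \<in> G" "n \<in> ?N" "\<phi> a = \<phi> n" "b \<in> G" "m \<in> ?N" "\<phi> b = \<phi> m"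
          by (auto simp: R_def)
        have "\<phi> (a \<otimes>\<^bsub>A \<times>\<times> B\<^esub> b) = \<phi> (n \<otimes>\<^bsub>A \<times>\<times> B\<^esub> m)"
          by (simp only: mul n(1,4) NG[OF n(2)] NG[OF n(5)] n(3,6))
        then show "a \<otimes>\<^bsub>GG\<^esub> b \<in> R"
          unfolding R_def using G.m_closed[OF n(1,4)] imageI[OF N.m_closed[OF n(2,5)], of \<phi>] by simp
      qed
      moreover have "a \<otimes>\<^bsub>GG\<^esub> r \<otimes>\<^bsub>GG\<^esub> inv\<^bsub>GG\<^esub> a \<in> R" if a: "a \<in> carrier GG" and r: "r \<in> R" for a r
      proof -
        have aG: "a \<in> G" using a by simp
        obtain n where n: "r \<in> G" "n \<in> ?N" "\<phi> r = \<phi> n" using r by (auto simp: R_def)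
        have "\<phi> (a \<otimes>\<^bsub>A \<times>\<times> B\<^esub> r \<otimes>\<^bsub>A \<times>\<times> B\<^esub> inv\<^bsub>A \<times>\<times> B\<^esub> a) = \<phi> (a \<otimes>\<^bsub>A \<times>\<times> B\<^esub> n \<otimes>\<^bsub>A \<times>\<times> B\<^esub> inv\<^bsub>A \<times>\<times> B\<^esub> a)"
          by (simp only: mul inv aG n(1) NG[OF n(2)] n(3) G.m_closed G.m_inv_closed)
        then have "a \<otimes>\<^bsub>A \<times>\<times> B\<^esub> r \<otimes>\<^bsub>A \<times>\<times> B\<^esub> inv\<^bsub>A \<times>\<times> B\<^esub> a \<in> R"
          unfolding R_def
          using imageI[OF N.inv_op_closed2[OF G.mem_carrier[OF aG] n(2)], of \<phi>]
            G.m_closed[OF G.m_closed[OF aG n(1)] G.m_inv_closed[OF aG]]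
          by simp
        then show ?thesis using P.m_inv_consistent[OF G.subgroup_axioms aG] by simp
      qed
      ultimately have "R \<lhd> GG" using group.normal_inv_iff[OF gG] by blast
      moreover have "kernel GG M \<phi> \<subseteq> R"
      proof
        fix r assume "r \<in> kernel GG M \<phi>"
        then have "r \<in> G" "\<phi> r = \<phi> \<one>\<^bsub>A \<times>\<times> B\<^esub>" using \<phi>.hom_one by (simp_all add: kernel_def)
        then show "r \<in> R" unfolding R_def using imageI[OF N.one_closed, of \<phi>] by simp
      qed
      ultimately have "open_normal \<C> GG R"
        using open_normal_mono[OF open_normal_kernel[OF in_class_member[OF M(1)] gG M(2)]] by simp
      then have "open_normal \<C> A (fst ` R)"
        by (rule open_normal_image[OF gG gA fst_hom fst_image])
      moreover have "N1 \<subseteq> fst ` R"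
      proof
        fix x assume "x \<in> N1"
        then have "(x, \<one>\<^bsub>B\<^esub>) \<in> R" unfolding R_def using N2.one_closed N1_times_N2 by blast
        then show "x \<in> fst ` R" by force
      qed
      moreover have "f \<notin> fst ` R"
      proof
        assume "f \<in> fst ` R"
        then obtain g' where g': "(f, g') \<in> R" by auto
        then obtain n where n: "(f, g') \<in> G" "n \<in> ?N" "\<phi> (f, g') = \<phi> n" by (auto simp: R_def)
        have m: "(inv\<^bsub>A\<^esub> f \<otimes>\<^bsub>A\<^esub> f, inv\<^bsub>B\<^esub> g' \<otimes>\<^bsub>B\<^esub> g) \<in> G" using fg(1) n(1) by (intro G_mult G_inv)
        have c: "f \<in> carrier A" "g \<in> carrier B" "g' \<in> carrier B"
          using G_carrier n(1) fg(1) by blast+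
        \<comment> \<open>Two partners of the same \<open>f\<close> differ by an element of
          \<open>{1} \<times> N2\<close>, so the choice of \<open>g\<close> does not matter.\<close>
        let ?m = "(\<one>\<^bsub>A\<^esub>, inv\<^bsub>B\<^esub> g' \<otimes>\<^bsub>B\<^esub> g)"
        have m: "?m \<in> ?N" "?m \<in> G" using m c by (auto simp: mem_N2)
        have "(f, g) = (f, g') \<otimes>\<^bsub>A \<times>\<times> B\<^esub> ?m" using c by (simp add: B.group_norm)
        then have "\<phi> (f, g) = \<phi> (f, g') \<otimes>\<^bsub>M\<^esub> \<phi> ?m" using mul[OF n(1) m(2)] by (simp only:)
        also have "\<dots> = \<phi> (n \<otimes>\<^bsub>A \<times>\<times> B\<^esub> ?m)" by (simp only: n(3) mul[OF NG[OF n(2)] m(2)])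
        finally have "\<phi> (f, g) = \<phi> (n \<otimes>\<^bsub>A \<times>\<times> B\<^esub> ?m)" .
        then have "\<phi> (f, g) \<in> \<phi> ` ?N" by (rule image_eqI) (rule N.m_closed[OF n(2) m(1)])
        with fg(2) show False by (rule notE)
      qed
      ultimately show ?thesis by blast
    qed
    define R where "R f = (SOME R. open_normal \<C> A R \<and> N1 \<subseteq> R \<and> f \<notin> R)" for f
    have R: "open_normal \<C> A (R f)" "N1 \<subseteq> R f" "f \<notin> R f" if "f \<in> carrier A - N1" for f
      using someI_ex[OF ex[OF that]] by (simp_all add: R_def)
    define rep where "rep c = (SOME g. g \<in> c)" for c :: "'a set"
    have rep: "rep c \<in> c" if "c \<in> rcosets\<^bsub>A\<^esub> N1" for c
      using N1.rcosets_non_empty[OF that] by (simp add: rep_def some_in_eq)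
    let ?J = "rep ` (rcosets\<^bsub>A\<^esub> N1) - N1"
    have J: "?J \<subseteq> carrier A - N1" using rep N1.rcosets_carrier[OF gA] by blast
    have "open_normal \<C> A (carrier A \<inter> (\<Inter>j\<in>?J. R j))"
      by (rule open_normal_INT[OF gA]) (use fin J R(1) in auto)
    moreover have "carrier A \<inter> (\<Inter>j\<in>?J. R j) = N1"
    proof
      show "N1 \<subseteq> carrier A \<inter> (\<Inter>j\<in>?J. R j)" using J R(2) N1.subset by blast
      show "carrier A \<inter> (\<Inter>j\<in>?J. R j) \<subseteq> N1"
      proof (rule subsetI, rule ccontr)
        fix x assume x: "x \<in> carrier A \<inter> (\<Inter>j\<in>?J. R j)" "x \<notin> N1"
        have c: "N1 #>\<^bsub>A\<^esub> x \<in> rcosets\<^bsub>A\<^esub> N1" using x(1) A.rcosetsI[OF N1.subset] by blast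
        let ?j = "rep (N1 #>\<^bsub>A\<^esub> x)"
        obtain n where n: "n \<in> N1" "?j = n \<otimes>\<^bsub>A\<^esub> x" using rep[OF c] by (auto simp: r_coset_def)
        have xe: "x = inv\<^bsub>A\<^esub> n \<otimes>\<^bsub>A\<^esub> ?j" using n x(1) by (simp add: A.group_norm)
        have "?j \<notin> N1" using x(2) n(1) xe by (metis N1.m_closed N1.m_inv_closed)
        then have j: "?j \<in> ?J" using c by blast
        then have "x \<in> R ?j" using x(1) by blast
        moreover have "n \<in> R ?j" using R(2) j J n(1) by blast
        moreover have "subgroup (R ?j) A"
          using R(1) j J normal_imp_subgroup unfolding open_normal_def by blast
        ultimately have "?j \<in> R ?j" using n(2) subgroup.m_closed by metis
        then show False using R(3) j J by blast
      qed
    qed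
    ultimately show False using assms(2) by simp
  qed
  then obtain f where f: "f \<in> carrier A - N1" "Q f" ..
  show ?thesis by (rule that[of f]) (use f(1) f(2)[unfolded Q_def, rule_format] in simp_all)
qed

text \<open>For \<open>f\<close> from \<open>dense_element\<close>, every homomorphism to a member
  of \<C> confuses \<open>(f, g)\<close> with an element of \<open>N1 \<times> N2\<close>. So it
  cannot tell conjugation of the first coordinate by \<open>f\<close> from conjugation by an element
  of \<open>N1\<close>; in \<open>G\<close> itself the conditions on the centralizers of
  \<open>h1\<close> and \<open>h2\<close> tell them apart.\<close>

lemma conjugacy_separable_imp_open_normal:
  assumes fin: "finite (rcosets\<^bsub>A\<^esub> N1)"
    and sep: "conjugacy_separable \<C> GG"
    and h1: "h1 \<in> N1" "\<And>f. f \<in> carrier A \<Longrightarrow> f \<otimes>\<^bsub>A\<^esub> h1 = h1 \<otimes>\<^bsub>A\<^esub> f \<Longrightarrow> f \<in> N1"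
    and h2: "h2 \<in> N2" "\<And>f. f \<in> carrier B \<Longrightarrow> f \<otimes>\<^bsub>B\<^esub> h2 = h2 \<otimes>\<^bsub>B\<^esub> f \<Longrightarrow> f \<in> N2"
  shows "open_normal \<C> A N1"
proof (rule ccontr)
  assume "\<not> open_normal \<C> A N1"
  then obtain f where f: "f \<in> carrier A" "f \<notin> N1" and
    dense: "\<And>M \<phi> g. M \<in> \<C> \<Longrightarrow> \<phi> \<in> hom GG M \<Longrightarrow> (f, g) \<in> G \<Longrightarrow> \<phi> (f, g) \<in> \<phi> ` (N1 \<times> N2)"
    by (rule dense_element[OF fin]) (auto)
  obtain g where fg: "(f, g) \<in> G" using fst_onto[OF f(1)] by blast
  have g: "g \<in> carrier B" using G_carrier(2)[OF fg] .
  have hc: "h1 \<in> carrier A" "h2 \<in> carrier B" using h1(1) h2(1) by auto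
  let ?x = "(h1, h2)" and ?y = "(f \<otimes>\<^bsub>A\<^esub> h1 \<otimes>\<^bsub>A\<^esub> inv\<^bsub>A\<^esub> f, h2)"
  have xN: "?x \<in> N1 \<times> N2" using h1 h2 by simp
  have yN: "?y \<in> N1 \<times> N2" using N1.inv_op_closed2[OF f(1) h1(1)] h2(1) by simp
  have xG: "?x \<in> G" and yG: "?y \<in> G" using xN yN N1_times_N2 by blast+
  have inv_G: "inv\<^bsub>GG\<^esub> u = inv\<^bsub>A \<times>\<times> B\<^esub> u" if "u \<in> G" for u
    by (rule P.m_inv_consistent[OF G.subgroup_axioms that])
  have "\<not> conjugate_in GG ?x ?y"
  proof
    assume "conjugate_in GG ?x ?y"
    then obtain u v where uv: "(u, v) \<in> G" "?y = (u, v) \<otimes>\<^bsub>A \<times>\<times> B\<^esub> ?x \<otimes>\<^bsub>A \<times>\<times> B\<^esub> inv\<^bsub>A \<times>\<times> B\<^esub> (u, v)"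
      using inv_G by (auto simp: conjugate_in_def)
    have c: "u \<in> carrier A" "v \<in> carrier B" using G_carrier[OF uv(1)] .
    have e: "f \<otimes>\<^bsub>A\<^esub> h1 \<otimes>\<^bsub>A\<^esub> inv\<^bsub>A\<^esub> f = u \<otimes>\<^bsub>A\<^esub> h1 \<otimes>\<^bsub>A\<^esub> inv\<^bsub>A\<^esub> u" "h2 = v \<otimes>\<^bsub>B\<^esub> h2 \<otimes>\<^bsub>B\<^esub> inv\<^bsub>B\<^esub> v"
      using uv(2) c inv_DirProd[OF gA gB c] by simp_all
    \<comment> \<open>The conjugator fixes \<open>h2\<close>, so \<open>v \<in> N2\<close> and
      therefore \<open>u \<in> N1\<close>. But \<open>f^-1 u\<close> commutes with
      \<open>h1\<close>, so it is in \<open>N1\<close> as well, and then so is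
      \<open>f\<close>.\<close>
    have "v \<otimes>\<^bsub>B\<^esub> h2 = (v \<otimes>\<^bsub>B\<^esub> h2 \<otimes>\<^bsub>B\<^esub> inv\<^bsub>B\<^esub> v) \<otimes>\<^bsub>B\<^esub> v" using c hc by (simp add: B.group_norm)
    then have "v \<otimes>\<^bsub>B\<^esub> h2 = h2 \<otimes>\<^bsub>B\<^esub> v" by (simp only: e(2)[symmetric])
    then have "v \<in> N2" using h2(2) c by blast
    have "(inv\<^bsub>A\<^esub> f \<otimes>\<^bsub>A\<^esub> u) \<otimes>\<^bsub>A\<^esub> h1 = inv\<^bsub>A\<^esub> f \<otimes>\<^bsub>A\<^esub> (u \<otimes>\<^bsub>A\<^esub> h1 \<otimes>\<^bsub>A\<^esub> inv\<^bsub>A\<^esub> u) \<otimes>\<^bsub>A\<^esub> u"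
      using c hc f(1) by (simp add: A.group_norm)
    also have "\<dots> = h1 \<otimes>\<^bsub>A\<^esub> (inv\<^bsub>A\<^esub> f \<otimes>\<^bsub>A\<^esub> u)"
      unfolding e(1)[symmetric] using c hc f(1) by (simp add: A.group_norm)
    finally have fu: "inv\<^bsub>A\<^esub> f \<otimes>\<^bsub>A\<^esub> u \<in> N1" using h1(2) c f(1) by simp
    have "(u \<otimes>\<^bsub>A\<^esub> inv\<^bsub>A\<^esub> \<one>\<^bsub>A\<^esub>, v \<otimes>\<^bsub>B\<^esub> inv\<^bsub>B\<^esub> v) \<in> G"
      using uv(1) \<open>v \<in> N2\<close> by (intro G_mult G_inv) (simp_all add: mem_N2)
    then have "u \<in> N1" using c by (simp add: mem_N1)
    from N1.m_closed[OF this N1.m_inv_closed[OF fu]] have e2: "u \<otimes>\<^bsub>A\<^esub> inv\<^bsub>A\<^esub> (inv\<^bsub>A\<^esub> f \<otimes>\<^bsub>A\<^esub> u) \<in> N1" .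
    have "u \<otimes>\<^bsub>A\<^esub> inv\<^bsub>A\<^esub> (inv\<^bsub>A\<^esub> f \<otimes>\<^bsub>A\<^esub> u) = f" using f(1) c by (simp add: A.group_norm)
    from subst[OF this, of "\<lambda>z. z \<in> N1", OF e2] f(2) show False by contradiction
  qed
  then have "\<exists>M\<in>\<C>. \<exists>\<phi>\<in>hom GG M. \<not> conjugate_in M (\<phi> ?x) (\<phi> ?y)"
    using sep xG yG by (simp add: conjugacy_separable_def)
  then obtain M \<phi> where M: "M \<in> \<C>" "\<phi> \<in> hom GG M" "\<not> conjugate_in M (\<phi> ?x) (\<phi> ?y)"
    by (elim bexE)
  interpret \<phi>: group_hom GG M \<phi>
    using M gG group_member by (simp add: group_hom_def group_hom_axioms_def)
  have mul: "\<phi> (a \<otimes>\<^bsub>A \<times>\<times> B\<^esub> b) = \<phi> a \<otimes>\<^bsub>M\<^esub> \<phi> b" if "a \<in> G" "b \<in> G" for a b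
    using \<phi>.hom_mult[of a b] that by simp
  have inv: "\<phi> (inv\<^bsub>A \<times>\<times> B\<^esub> a) = inv\<^bsub>M\<^esub> \<phi> a" if "a \<in> G" for a
    using \<phi>.hom_inv[of a] that inv_G by simp
  have cl: "\<phi> a \<in> carrier M" if "a \<in> G" for a using \<phi>.hom_closed[of a] that by simp
  obtain n1 n2 where n: "n1 \<in> N1" "n2 \<in> N2" "\<phi> (f, g) = \<phi> (n1, n2)"
    using dense[OF M(1,2) fg] by auto
  have nc: "n1 \<in> carrier A" "n2 \<in> carrier B" using n(1,2) by auto
  have nG: "(n1, n2) \<in> G" "(n1, \<one>\<^bsub>B\<^esub>) \<in> G" using n N1_times_N2 by (auto simp: mem_N1)
  have h1G: "(h1, \<one>\<^bsub>B\<^esub>) \<in> G" and h2G: "(\<one>\<^bsub>A\<^esub>, h2) \<in> G" using h1(1) h2(1) by (simp_all add: mem_N1 mem_N2)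
  let ?c = "\<lambda>a b. a \<otimes>\<^bsub>A \<times>\<times> B\<^esub> b \<otimes>\<^bsub>A \<times>\<times> B\<^esub> inv\<^bsub>A \<times>\<times> B\<^esub> a"
  have cc: "\<phi> (?c a b) = \<phi> a \<otimes>\<^bsub>M\<^esub> \<phi> b \<otimes>\<^bsub>M\<^esub> inv\<^bsub>M\<^esub> \<phi> a" if "a \<in> G" "b \<in> G" for a b
    using that by (simp only: mul inv G.m_closed G.m_inv_closed)
  \<comment> \<open>Only the factor \<open>(h1, 1)\<close> of \<open>?x\<close> is conjugated by
    \<open>(f, g)\<close>. Once \<open>(f, g)\<close> has been replaced by \<open>(n1, n2)\<close>,
    the coordinate \<open>n2\<close> acts trivially on \<open>(h1, 1)\<close> and may be
    dropped.\<close>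
  have "?y = ?c (f, g) (h1, \<one>\<^bsub>B\<^esub>) \<otimes>\<^bsub>A \<times>\<times> B\<^esub> (\<one>\<^bsub>A\<^esub>, h2)"
    using f(1) g hc by (simp add: inv_DirProd[OF gA gB] B.group_norm)
  then have "\<phi> ?y = \<phi> (?c (f, g) (h1, \<one>\<^bsub>B\<^esub>)) \<otimes>\<^bsub>M\<^esub> \<phi> (\<one>\<^bsub>A\<^esub>, h2)"
    using mul[OF G.m_closed[OF G.m_closed[OF fg h1G] G.m_inv_closed[OF fg]] h2G] by (simp only:)
  also have "\<dots> = \<phi> (?c (n1, n2) (h1, \<one>\<^bsub>B\<^esub>)) \<otimes>\<^bsub>M\<^esub> \<phi> (\<one>\<^bsub>A\<^esub>, h2)"
    by (simp only: cc[OF fg h1G] cc[OF nG(1) h1G] n(3))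
  also have "\<dots> = \<phi> (?c (n1, n2) (h1, \<one>\<^bsub>B\<^esub>) \<otimes>\<^bsub>A \<times>\<times> B\<^esub> (\<one>\<^bsub>A\<^esub>, h2))"
    using mul[OF G.m_closed[OF G.m_closed[OF nG(1) h1G] G.m_inv_closed[OF nG(1)]] h2G] by (simp only:)
  also have "?c (n1, n2) (h1, \<one>\<^bsub>B\<^esub>) \<otimes>\<^bsub>A \<times>\<times> B\<^esub> (\<one>\<^bsub>A\<^esub>, h2) = ?c (n1, \<one>\<^bsub>B\<^esub>) ?x"
    using nc hc by (simp add: inv_DirProd[OF gA gB] B.group_norm)
  also have "\<phi> (?c (n1, \<one>\<^bsub>B\<^esub>) ?x) = \<phi> (n1, \<one>\<^bsub>B\<^esub>) \<otimes>\<^bsub>M\<^esub> \<phi> ?x \<otimes>\<^bsub>M\<^esub> inv\<^bsub>M\<^esub> \<phi> (n1, \<one>\<^bsub>B\<^esub>)"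
    by (rule cc[OF nG(2) xG])
  finally have "conjugate_in M (\<phi> ?x) (\<phi> ?y)"
    unfolding conjugate_in_def using cl[OF nG(2)] by (rule bexI)
  with M(3) show False by (rule notE)
qed

lemma corollary_iff:
  assumes "coset_conjugacy_separable \<C> A" "coset_conjugacy_separable \<C> B"
    and "finite_index (A \<times>\<times> B) G"
    and h1: "\<exists>h\<in>N1. \<forall>f\<in>carrier A. f \<otimes>\<^bsub>A\<^esub> h = h \<otimes>\<^bsub>A\<^esub> f \<longrightarrow> f \<in> N1"
    and h2: "\<exists>h\<in>N2. \<forall>f\<in>carrier B. f \<otimes>\<^bsub>B\<^esub> h = h \<otimes>\<^bsub>B\<^esub> f \<longrightarrow> f \<in> N2"
  shows "conjugacy_separable \<C> GG \<longleftrightarrow> open_normal \<C> A N1"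
proof
  assume sep: "conjugacy_separable \<C> GG"
  obtain a where a: "a \<in> N1" "\<forall>f\<in>carrier A. f \<otimes>\<^bsub>A\<^esub> a = a \<otimes>\<^bsub>A\<^esub> f \<longrightarrow> f \<in> N1" using h1 by (elim bexE)
  obtain b where b: "b \<in> N2" "\<forall>f\<in>carrier B. f \<otimes>\<^bsub>B\<^esub> b = b \<otimes>\<^bsub>B\<^esub> f \<longrightarrow> f \<in> N2" using h2 by (elim bexE)
  show "open_normal \<C> A N1"
    by (rule conjugacy_separable_imp_open_normal[OF finite_index_N1[OF assms(3)] sep a(1) _ b(1)])
       (simp_all add: a(2)[rule_format] b(2)[rule_format])
next
  assume "open_normal \<C> A N1"
  then show "conjugacy_separable \<C> GG"
    using conjugacy_separable_subgroup_DirProd[OF gA gB assms(1,2) G.subgroup_axioms _ _ N1_times_N2]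
      open_normal_N2 by blast
qed

end

section \<open>Free groups\<close>

type_synonym 'a word = "('a \<times> bool) list"

definition inv_letter :: "'a \<times> bool \<Rightarrow> 'a \<times> bool" where
  "inv_letter l = (fst l, \<not> snd l)"

definition inv_word :: "'a word \<Rightarrow> 'a word" where
  "inv_word w = rev (map inv_letter w)"

fun reduce :: "'a word \<Rightarrow> 'a word" where
  "reduce [] = []"
| "reduce (l # w) = (case reduce w of [] \<Rightarrow> [l] | m # v \<Rightarrow> if m = inv_letter l then v else l # m # v)"

lemma inv_letter_inv_letter [simp]: "inv_letter (inv_letter l) = l"
  by (simp add: inv_letter_def)

lemma inv_letter_neq [simp]: "inv_letter l \<noteq> l" "l \<noteq> inv_letter l"
  by (auto simp: inv_letter_def prod_eq_iff)

lemma reduced_word_iff_successively: "reduced_word w \<longleftrightarrow> successively (\<lambda>l m. m \<noteq> inv_letter l) w"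
  unfolding reduced_word_def successively_conv_nth
  by (auto simp: inv_letter_def prod_eq_iff)

lemma reduced_word_Nil [simp]: "reduced_word []"
  by (simp add: reduced_word_iff_successively)

lemma reduced_word_Cons: "reduced_word (l # w) \<longleftrightarrow> (w = [] \<or> hd w \<noteq> inv_letter l \<and> reduced_word w)"
  by (cases w) (auto simp: reduced_word_iff_successively)

lemma reduced_word_appendD:
  "reduced_word (u @ v) \<Longrightarrow> reduced_word u" "reduced_word (u @ v) \<Longrightarrow> reduced_word v"
  by (auto simp: reduced_word_iff_successively successively_append_iff)

lemma reduced_word_take: "reduced_word w \<Longrightarrow> reduced_word (take i w)"
  and reduced_word_drop: "reduced_word w \<Longrightarrow> reduced_word (drop i w)"
  using reduced_word_appendD[of "take i w" "drop i w"] by auto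

lemma reduced_reduce: "reduced_word (reduce w)"
  by (induction w) (auto simp: reduced_word_Cons split: list.splits)

lemma length_reduce: "length (reduce w) \<le> length w"
  by (induction w) (auto split: list.splits)

lemma set_reduce: "set (reduce w) \<subseteq> set w"
  by (induction w) (auto split: list.splits if_splits)

lemma words_over_Nil [simp]: "[] \<in> words_over Y"
  and words_over_Cons [simp]: "l # w \<in> words_over Y \<longleftrightarrow> fst l \<in> Y \<and> w \<in> words_over Y"
  and words_over_append [simp]: "u @ v \<in> words_over Y \<longleftrightarrow> u \<in> words_over Y \<and> v \<in> words_over Y"
  by (auto simp: words_over_def mem_Times_iff)

lemma words_over_iff: "w \<in> words_over Y \<longleftrightarrow> (\<forall>l\<in>set w. fst l \<in> Y)"
  by (induction w) auto

lemma words_over_mono: "w \<in> words_over Y \<Longrightarrow> Y \<subseteq> Z \<Longrightarrow> w \<in> words_over Z"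
  by (auto simp: words_over_iff)

lemma reduce_words_over: "w \<in> words_over Y \<Longrightarrow> reduce w \<in> words_over Y"
  using set_reduce by (fastforce simp: words_over_iff)

lemma inv_word_words_over [simp]: "inv_word w \<in> words_over Y \<longleftrightarrow> w \<in> words_over Y"
  by (auto simp: words_over_iff inv_word_def inv_letter_def)

lemma length_inv_word [simp]: "length (inv_word w) = length w"
  by (simp add: inv_word_def)

lemma inv_word_Cons: "inv_word (l # w) = inv_word w @ [inv_letter l]"
  by (simp add: inv_word_def)

context group
begin

lemma word_val_Nil [simp]: "word_val G [] = \<one>"
  and word_val_Cons [simp]: "word_val G (l # w) = letter_val G l \<otimes> word_val G w"
  by (simp_all add: word_val_def)

lemma letter_val_closed [simp]: "fst l \<in> carrier G \<Longrightarrow> letter_val G l \<in> carrier G"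
  by (simp add: letter_val_def)

lemma letter_val_inv_letter [simp]:
  "fst l \<in> carrier G \<Longrightarrow> letter_val G (inv_letter l) = inv (letter_val G l)"
  by (simp add: letter_val_def inv_letter_def)

lemma word_val_closed [simp]: "w \<in> words_over (carrier G) \<Longrightarrow> word_val G w \<in> carrier G"
  by (induction w) simp_all

lemma word_val_append [simp]:
  "u \<in> words_over (carrier G) \<Longrightarrow> v \<in> words_over (carrier G) \<Longrightarrow>
     word_val G (u @ v) = word_val G u \<otimes> word_val G v"
  by (induction u) (simp_all add: m_assoc)

lemma word_val_inv_word [simp]:
  "w \<in> words_over (carrier G) \<Longrightarrow> word_val G (inv_word w) = inv (word_val G w)"
proof (induction w)
  case (Cons l w)
  then have "inv_letter l # [] \<in> words_over (carrier G)" by (simp add: inv_letter_def)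
  with Cons show ?case by (simp add: inv_word_Cons inv_mult_group del: words_over_Cons) (simp add: inv_mult_group)
qed (simp add: inv_word_def)

lemma word_val_reduce [simp]: "w \<in> words_over (carrier G) \<Longrightarrow> word_val G (reduce w) = word_val G w"
proof (induction w)
  case (Cons l w)
  have r: "reduce w \<in> words_over (carrier G)" using Cons.prems by (simp add: reduce_words_over)
  show ?case
  proof (cases "reduce w")
    case Nil
    with Cons show ?thesis by auto
  next
    case (Cons m v)
    with r have v: "v \<in> words_over (carrier G)" "fst m \<in> carrier G" by simp_all
    have "word_val G w = letter_val G m \<otimes> word_val G v" using Cons Cons.IH Cons.prems by simp
    then show ?thesis using Cons v Cons.prems by (auto simp: inv_m_cancel)
  qed
qed simp

text \<open>The signed number of times the path of \<open>w\<close> in the Cayley graph of the quotient by \<open>L\<close>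
  traverses the edge that leaves the vertex of \<open>v\<close> along the letter \<open>l\<close>.\<close>

primrec crossing :: "'a set \<Rightarrow> 'a word \<Rightarrow> 'a \<Rightarrow> 'a \<times> bool \<Rightarrow> int" where
  "crossing L [] v l = 0"
| "crossing L (m # w) v l =
     (if m = l \<and> v \<in> L then 1 else 0) - (if m = inv_letter l \<and> inv (letter_val G m) \<otimes> v \<in> L then 1 else 0)
     + crossing L w (inv (letter_val G m) \<otimes> v) l"

text \<open>The path of \<open>u\<close> ends at the vertex of \<open>word_val G u\<close>. Instead
  of starting the rest of the path there, \<open>crossing\<close> keeps the base point at the
  identity and translates \<open>v\<close> back.\<close>

lemma crossing_append:
  "u \<in> words_over (carrier G) \<Longrightarrow> w \<in> words_over (carrier G) \<Longrightarrow> v \<in> carrier G \<Longrightarrow>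
    crossing L (u @ w) v l = crossing L u v l + crossing L w (inv (word_val G u) \<otimes> v) l"
  by (induction u arbitrary: v) (simp_all add: inv_mult_group m_assoc)

text \<open>A letter followed by its inverse runs along one edge forth and back, and the two
  contributions cancel. In a free group the count therefore depends only on the element, not on the
  word.\<close>

lemma crossing_reduce:
  "w \<in> words_over (carrier G) \<Longrightarrow> v \<in> carrier G \<Longrightarrow> crossing L (reduce w) v l = crossing L w v l"
proof (induction w arbitrary: v)
  case (Cons m w)
  have IH: "crossing L (reduce w) (inv (letter_val G m) \<otimes> v) l = crossing L w (inv (letter_val G m) \<otimes> v) l"
    using Cons by simp
  show ?case
  proof (cases "reduce w")
    case Nil
    with IH show ?thesis by simp
  next
    case (Cons k u)
    show ?thesis
    proof (cases "k = inv_letter m")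
      case True
      have "inv (letter_val G (inv_letter m)) \<otimes> (inv (letter_val G m) \<otimes> v) = v"
        using Cons.prems by (simp add: inv_m_cancel)
      then have "crossing L (m # inv_letter m # u) v l = crossing L u v l"
        by (auto simp: inv_letter_def prod_eq_iff)
      then show ?thesis using IH Cons True by simp
    next
      case False
      then show ?thesis using IH Cons by simp
    qed
  qed
qed simp

lemma crossing_cong:
  assumes "subgroup L G"
  shows "w \<in> words_over (carrier G) \<Longrightarrow> v \<in> carrier G \<Longrightarrow> v' \<in> carrier G \<Longrightarrow> inv v \<otimes> v' \<in> L \<Longrightarrow>
    crossing L w v l = crossing L w v' l"
proof (induction w arbitrary: v v')
  case (Cons m w)
  interpret L: subgroup L G by fact
  have mem: "u \<in> L \<longleftrightarrow> u' \<in> L" if "u \<in> carrier G" "u' \<in> carrier G" "inv u \<otimes> u' \<in> L" for u u'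
  proof
    assume "u \<in> L"
    then have "u \<otimes> (inv u \<otimes> u') \<in> L" using that(3) by (rule L.m_closed)
    then show "u' \<in> L" using that by (simp add: inv_m_cancel)
  next
    assume "u' \<in> L"
    then have "u' \<otimes> inv (inv u \<otimes> u') \<in> L" using that(3) by (rule L.m_closed[OF _ L.m_inv_closed])
    moreover have "u' \<otimes> inv (inv u \<otimes> u') = u" using that(1,2) by (simp add: group_norm)
    ultimately show "u \<in> L" by (simp only:)
  qed
  let ?m = "inv (letter_val G m)"
  have m: "?m \<in> carrier G" using Cons.prems by simp
  have e: "inv (?m \<otimes> v) \<otimes> (?m \<otimes> v') \<in> L" using Cons.prems m by (simp add: group_norm)
  have "crossing L w (?m \<otimes> v) l = crossing L w (?m \<otimes> v') l"
    using Cons.IH[OF _ _ _ e] Cons.prems m by simp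
  moreover have "v \<in> L \<longleftrightarrow> v' \<in> L" using mem Cons.prems by blast
  moreover have "?m \<otimes> v \<in> L \<longleftrightarrow> ?m \<otimes> v' \<in> L" using mem[OF _ _ e] Cons.prems m by simp
  ultimately show ?case by simp
qed simp

lemma crossing_nonzeroD:
  assumes "crossing L w v l \<noteq> 0" "w \<in> words_over (carrier G)" "v \<in> carrier G"
  shows "\<exists>i<length w. w ! i = l \<and> inv (word_val G (take i w)) \<otimes> v \<in> L \<or>
    w ! i = inv_letter l \<and> inv (word_val G (take (Suc i) w)) \<otimes> v \<in> L"
  using assms
proof (induction w arbitrary: v)
  case (Cons m w)
  let ?m = "inv (letter_val G m)"
  have c: "?m \<in> carrier G" using Cons.prems by simp
  have t: "take i w \<in> words_over (carrier G)" for i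
    using Cons.prems by (auto simp: words_over_iff dest: in_set_takeD)
  consider "m = l \<and> v \<in> L" | "m = inv_letter l \<and> ?m \<otimes> v \<in> L" | "crossing L w (?m \<otimes> v) l \<noteq> 0"
    using Cons.prems(1) by (auto split: if_splits)
  then show ?case
  proof cases
    case 1
    then show ?thesis using Cons.prems by (intro exI[of _ 0]) simp
  next
    case 2
    then show ?thesis using Cons.prems by (intro exI[of _ 0]) auto
  next
    case 3
    then obtain i where i: "i < length w" "w ! i = l \<and> inv (word_val G (take i w)) \<otimes> (?m \<otimes> v) \<in> L \<or>
      w ! i = inv_letter l \<and> inv (word_val G (take (Suc i) w)) \<otimes> (?m \<otimes> v) \<in> L"
      using Cons.IH[OF 3] Cons.prems c by auto
    have "inv (word_val G (take (Suc j) (m # w))) \<otimes> v = inv (word_val G (take j w)) \<otimes> (?m \<otimes> v)" for j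
      using t[of j] Cons.prems by (simp add: group_norm)
    then show ?thesis using i by (intro exI[of _ "Suc i"]) simp
  qed
qed simp

text \<open>The hypothesis excludes backward traversals, so nothing cancels, and each letter
  contributes at most one traversal.\<close>

lemma crossing_bounds:
  assumes "w \<in> words_over (carrier G)" "v \<in> carrier G"
    "\<And>i. i < length w \<Longrightarrow> w ! i = inv_letter l \<Longrightarrow> inv (word_val G (take (Suc i) w)) \<otimes> v \<notin> L"
  shows "0 \<le> crossing L w v l \<and> crossing L w v l \<le> length w"
  using assms
proof (induction w arbitrary: v)
  case (Cons m w)
  let ?m = "inv (letter_val G m)"
  have t: "take i w \<in> words_over (carrier G)" for i
    using Cons.prems by (auto simp: words_over_iff dest: in_set_takeD)
  have e: "inv (word_val G (take (Suc j) (m # w))) \<otimes> v = inv (word_val G (take j w)) \<otimes> (?m \<otimes> v)" for j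
    using t[of j] Cons.prems by (simp add: group_norm)
  have "0 \<le> crossing L w (?m \<otimes> v) l \<and> crossing L w (?m \<otimes> v) l \<le> length w"
  proof (rule Cons.IH)
    fix i assume "i < length w" "w ! i = inv_letter l"
    then show "inv (word_val G (take (Suc i) w)) \<otimes> (?m \<otimes> v) \<notin> L"
      using Cons.prems(3)[of "Suc i"] e[of "Suc i"] by simp
  qed (use Cons.prems in simp_all)
  moreover have "\<not> (m = inv_letter l \<and> ?m \<otimes> v \<in> L)"
    using Cons.prems(3)[of 0] Cons.prems(1,2) by auto
  ultimately show ?case by auto
qed simp

end


section \<open>Crossing numbers and homology covers of a free group\<close>

locale free_group = group G for G (structure) +
  fixes X :: "'a set"
  assumes basis: "free_basis G X"
begin

lemma basis_carrier: "X \<subseteq> carrier G"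
  using basis by (simp add: free_basis_def)

lemma words_over_carrier: "w \<in> words_over X \<Longrightarrow> w \<in> words_over (carrier G)"
  using words_over_mono basis_carrier by blast

definition normal_form :: "'a \<Rightarrow> 'a word" where
  "normal_form g = (THE w. w \<in> words_over X \<and> reduced_word w \<and> word_val G w = g)"

lemma normal_form:
  assumes "g \<in> carrier G"
  shows "normal_form g \<in> words_over X" "reduced_word (normal_form g)" "word_val G (normal_form g) = g"
  using theI'[of "\<lambda>w. w \<in> words_over X \<and> reduced_word w \<and> word_val G w = g"] basis assms
  unfolding free_basis_def normal_form_def by blast+

lemma normal_form_carrier: "g \<in> carrier G \<Longrightarrow> normal_form g \<in> words_over (carrier G)"
  by (simp add: normal_form words_over_carrier)

lemma normal_form_unique:
  assumes "w \<in> words_over X" "reduced_word w"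
  shows "normal_form (word_val G w) = w"
proof -
  have "word_val G w \<in> carrier G" using words_over_carrier[OF assms(1)] by simp
  then show ?thesis
    unfolding normal_form_def using basis assms by (intro the1_equality) (simp_all add: free_basis_def)
qed

lemma normal_form_word_val:
  assumes "w \<in> words_over X"
  shows "normal_form (word_val G w) = reduce w"
  using normal_form_unique[OF reduce_words_over[OF assms] reduced_reduce] words_over_carrier[OF assms] by simp

lemma word_val_inj:
  "u \<in> words_over X \<Longrightarrow> w \<in> words_over X \<Longrightarrow> reduced_word u \<Longrightarrow> reduced_word w \<Longrightarrow>
     word_val G u = word_val G w \<Longrightarrow> u = w"
  using normal_form_unique by metis

definition cross :: "'a set \<Rightarrow> 'a \<Rightarrow> 'a \<Rightarrow> 'a \<times> bool \<Rightarrow> int" where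
  "cross L g v l = crossing L (normal_form g) v l"

lemma cross_word_val:
  "w \<in> words_over X \<Longrightarrow> v \<in> carrier G \<Longrightarrow> cross L (word_val G w) v l = crossing L w v l"
  by (simp add: cross_def normal_form_word_val crossing_reduce words_over_carrier)

text \<open>A cocycle identity. For \<open>g\<close> in a normal \<open>L\<close> the vertices of
  \<open>v\<close> and \<open>inv g \<otimes> v\<close> coincide, so on \<open>L\<close> each
  crossing number is a homomorphism to the integers.\<close>

lemma cross_mult:
  assumes "g \<in> carrier G" "h \<in> carrier G" "v \<in> carrier G"
  shows "cross L (g \<otimes> h) v l = cross L g v l + cross L h (inv g \<otimes> v) l"
proof -
  have "word_val G (normal_form g @ normal_form h) = g \<otimes> h"
    using assms by (simp add: normal_form normal_form_carrier)
  then have "cross L (g \<otimes> h) v l = crossing L (normal_form g @ normal_form h) v l"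
    using cross_word_val[of "normal_form g @ normal_form h" v L l] assms by (simp add: normal_form)
  then show ?thesis using assms by (simp add: crossing_append normal_form_carrier normal_form cross_def)
qed

lemma cross_one [simp]: "v \<in> carrier G \<Longrightarrow> cross L \<one> v l = 0"
  using cross_word_val[of "[]" v L l] by simp

lemma cross_cong:
  "subgroup L G \<Longrightarrow> g \<in> carrier G \<Longrightarrow> v \<in> carrier G \<Longrightarrow> v' \<in> carrier G \<Longrightarrow> inv v \<otimes> v' \<in> L \<Longrightarrow>
    cross L g v l = cross L g v' l"
  unfolding cross_def by (rule crossing_cong) (simp_all add: normal_form_carrier)

text \<open>The path of \<open>g h g^-1\<close> goes out along \<open>g\<close>, round the closed
  path of \<open>h\<close>, and back along \<open>g\<close>. The first and last parts cancel because
  \<open>h \<in> L\<close> returns to the same vertex; a translate of the closed path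
  remains.\<close>

lemma cross_conj:
  assumes L: "L \<lhd> G" and h: "h \<in> L" and g: "g \<in> carrier G" and v: "v \<in> carrier G"
  shows "cross L (g \<otimes> h \<otimes> inv g) v l = cross L h (inv g \<otimes> v) l"
proof -
  interpret L: normal L G by (rule L)
  have hc: "h \<in> carrier G" using h by simp
  have "cross L g v l + cross L (inv g) (inv g \<otimes> v) l = 0"
    using cross_mult[of g "inv g" v L l] g v by simp
  moreover have "cross L (inv g) (inv h \<otimes> (inv g \<otimes> v)) l = cross L (inv g) (inv g \<otimes> v) l"
  proof (rule cross_cong[OF L.subgroup_axioms])
    have "inv (inv g \<otimes> v) \<otimes> h \<otimes> (inv g \<otimes> v) \<in> L" using g v h by (intro L.inv_op_closed1) simp_all
    then show "inv (inv h \<otimes> (inv g \<otimes> v)) \<otimes> (inv g \<otimes> v) \<in> L"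
      using g v hc by (simp add: group_norm)
  qed (use g v hc in simp_all)
  moreover have "cross L (g \<otimes> h \<otimes> inv g) v l =
      cross L g v l + cross L h (inv g \<otimes> v) l + cross L (inv g) (inv h \<otimes> (inv g \<otimes> v)) l"
    using g v hc by (simp add: cross_mult group_norm)
  ultimately show ?thesis by simp
qed

text \<open>The kernel of the action of \<open>L\<close> on the homology, with coefficients modulo \<open>q\<close>, of the part of
  the Cayley graph of the quotient by \<open>L\<close> whose edges are labelled by \<open>Y\<close>.\<close>

definition homology_kernel :: "'a set \<Rightarrow> 'a set \<Rightarrow> int \<Rightarrow> 'a set" where
  "homology_kernel L Y q = {g \<in> L. \<forall>v\<in>carrier G. \<forall>l\<in>Y \<times> UNIV. q dvd cross L g v l}"

text \<open>By \<open>cross_conj\<close>, conjugation permutes the edges with a given label, and the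
  divisibility is required at all of them.\<close>

lemma homology_kernel_normal:
  assumes L: "L \<lhd> G"
  shows "homology_kernel L Y q \<lhd> G"
proof -
  interpret L: normal L G by (rule L)
  have cl: "cross L (g \<otimes> h) v l = cross L g v l + cross L h v l"
    if "g \<in> L" "h \<in> L" "v \<in> carrier G" for g h v l
  proof -
    have "inv v \<otimes> inv g \<otimes> v \<in> L" using L.inv_op_closed1[OF that(3) L.m_inv_closed[OF that(1)]] .
    then have "cross L h v l = cross L h (inv g \<otimes> v) l"
      using that by (intro cross_cong[OF L.subgroup_axioms]) (simp_all add: m_assoc)
    then show ?thesis using that by (simp add: cross_mult)
  qed
  show ?thesis
    unfolding normal_inv_iff
  proof (intro conjI ballI subgroupI)
    show "homology_kernel L Y q \<subseteq> carrier G" by (auto simp: homology_kernel_def)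
    show "homology_kernel L Y q \<noteq> {}" by (auto simp: homology_kernel_def intro!: exI[of _ \<one>])
  next
    fix a assume "a \<in> homology_kernel L Y q"
    then have a: "a \<in> L" "\<And>v l. v \<in> carrier G \<Longrightarrow> l \<in> Y \<times> UNIV \<Longrightarrow> q dvd cross L a v l"
      by (auto simp: homology_kernel_def)
    have "cross L (inv a) v l = - cross L a v l" if "v \<in> carrier G" for v l
      using cl[OF a(1) L.m_inv_closed[OF a(1)] that, of l] a(1) that by simp
    then show "inv a \<in> homology_kernel L Y q" using a by (simp add: homology_kernel_def)
  next
    fix a b assume "a \<in> homology_kernel L Y q" "b \<in> homology_kernel L Y q"
    then show "a \<otimes> b \<in> homology_kernel L Y q" by (simp add: homology_kernel_def cl)
  next
    fix g a assume "g \<in> carrier G" "a \<in> homology_kernel L Y q"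
    then show "g \<otimes> a \<otimes> inv g \<in> homology_kernel L Y q"
      by (simp add: homology_kernel_def cross_conj[OF L] L.inv_op_closed2)
  qed
qed

definition girth_exceeds :: "'a set \<Rightarrow> 'a set \<Rightarrow> nat \<Rightarrow> bool" where
  "girth_exceeds L Y n \<longleftrightarrow>
     (\<forall>w\<in>words_over Y. reduced_word w \<and> w \<noteq> [] \<and> length w \<le> n \<longrightarrow> word_val G w \<notin> L)"

lemma girth_exceedsD:
  assumes "girth_exceeds L Y n" "Y \<subseteq> X" "w \<in> words_over Y" "length w \<le> n" "word_val G w \<in> L"
  shows "word_val G w = \<one>"
proof -
  have w: "w \<in> words_over (carrier G)" using assms(2,3) words_over_mono words_over_carrier by blast
  have "reduce w = []"
    using assms w reduced_reduce[of w] length_reduce[of w] reduce_words_over[OF assms(3)]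
    by (auto simp: girth_exceeds_def)
  then show ?thesis using word_val_reduce[OF w] by simp
qed

text \<open>No non-empty proper prefix of a reduced loop of length at most \<open>n + 1\<close> lies
  in \<open>L\<close>, so the loop meets its base vertex only at its two ends and traverses its
  first edge exactly once. The crossing number there is 1, which \<open>q\<close> does not
  divide.\<close>

lemma girth_homology_kernel:
  assumes L: "L \<lhd> G" and girth: "girth_exceeds L Y n" and Y: "Y \<subseteq> X" and q: "q > 1"
  shows "girth_exceeds (homology_kernel L Y q) Y (Suc n)"
  unfolding girth_exceeds_def
proof (intro ballI impI notI)
  interpret L: normal L G by (rule L)
  fix w assume w: "w \<in> words_over Y" "reduced_word w \<and> w \<noteq> [] \<and> length w \<le> Suc n"
    and k: "word_val G w \<in> homology_kernel L Y q"
  have short: "word_val G u \<notin> L" if "u \<in> words_over Y" "reduced_word u" "u \<noteq> []" "length u \<le> n" for u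
    using girth that by (auto simp: girth_exceeds_def)
  obtain l w' where lw: "w = l # w'" using w(2) by (cases w) auto
  have wX: "w \<in> words_over X" using w(1) Y words_over_mono by blast
  have wc: "w \<in> words_over (carrier G)" using wX by (rule words_over_carrier)
  have lc: "fst l \<in> carrier G" "w' \<in> words_over (carrier G)" "letter_val G l \<in> carrier G" using wc lw by simp_all
  have tk: "take j w \<in> words_over Y" "take j w \<in> words_over (carrier G)" "reduced_word (take j w)" for j
    using w wc by (auto simp: words_over_iff dest: in_set_takeD intro: reduced_word_take)
  have pre: "inv (word_val G (take j w')) \<otimes> (inv (letter_val G l) \<otimes> \<one>) = inv (word_val G (take (Suc j) w))" for j
  proof -
    have "take j w' \<in> words_over (carrier G)" using tk(2)[of "Suc j"] lw by simp
    then show ?thesis using lc lw by (simp add: inv_mult_group)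
  qed
  have prefix: "word_val G (take j w) \<notin> L" if "0 < j" "j < length w" for j
    using short[OF tk(1,3)] that w(2) by auto
  have prefix': "inv (word_val G (take j w)) \<notin> L" if "0 < j" "j < length w" for j
    using prefix[OF that] L.m_inv_closed inv_inv[OF word_val_closed[OF tk(2)]] by metis
  have "crossing L w' (inv (letter_val G l) \<otimes> \<one>) l = 0"
  proof (rule ccontr)
    assume "crossing L w' (inv (letter_val G l) \<otimes> \<one>) l \<noteq> 0"
    then obtain i where i: "i < length w'" "w' ! i = l \<and> inv (word_val G (take (Suc i) w)) \<in> L \<or>
       w' ! i = inv_letter l \<and> inv (word_val G (take (Suc (Suc i)) w)) \<in> L"
      using crossing_nonzeroD[OF _ lc(2), of L "inv (letter_val G l) \<otimes> \<one>" l] lc(3) unfolding pre by auto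
    \<comment> \<open>The one dangerous case: the last step returns along the first edge. Stripping
      the first and the last letter then leaves a shorter loop \<open>u\<close> in
      \<open>L\<close>.\<close>
    then have last: "Suc (Suc i) = length w" "w' ! i = inv_letter l"
      using prefix'[of "Suc i"] prefix'[of "Suc (Suc i)"] lw by auto
    define u where "u = take i w'"
    have w'u: "w' = u @ [inv_letter l]"
      using last lw take_Suc_conv_app_nth[OF i(1)] by (simp add: u_def)
    have wl: "word_val G w \<in> L" using k by (simp add: homology_kernel_def)
    have uc: "u \<in> words_over (carrier G)" "u \<in> words_over Y" using w'u lw w(1) wc by simp_all
    have ilc: "[inv_letter l] \<in> words_over (carrier G)" using lc by (simp add: inv_letter_def)
    have "word_val G w = letter_val G l \<otimes> word_val G u \<otimes> inv (letter_val G l)"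
      using lw w'u uc lc by (simp add: word_val_append[OF _ ilc] m_assoc)
    then have "inv (letter_val G l) \<otimes> (letter_val G l \<otimes> word_val G u \<otimes> inv (letter_val G l)) \<otimes> letter_val G l \<in> L"
      using wl L.inv_op_closed1[OF lc(3)] by simp
    then have "word_val G u \<in> L" using uc lc by (simp add: group_norm)
    moreover have "u \<noteq> []"
    proof
      assume "u = []"
      then have "w = [l, inv_letter l]" using lw w'u by simp
      then show False using w(2) by (simp add: reduced_word_Cons)
    qed
    moreover have "reduced_word u" using w(2) lw w'u reduced_word_appendD[of "[l]" w'] reduced_word_appendD[of u "[inv_letter l]"] by simp
    ultimately show False using short[OF uc(2)] w(2) lw w'u by simp
  qed
  then have "crossing L w \<one> l = 1" using lw by simp
  then have "cross L (word_val G w) \<one> l = 1" using cross_word_val[OF wX] by simp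
  moreover have "l \<in> Y \<times> UNIV" using w(1) lw by (simp add: mem_Times_iff)
  ultimately have "q dvd 1" using k unfolding homology_kernel_def by (metis (no_types, lifting) mem_Collect_eq one_closed)
  then show False using q by simp
qed

end


section \<open>Cyclic words\<close>

definition cyclically_reduced :: "'a word \<Rightarrow> bool" where
  "cyclically_reduced w \<longleftrightarrow>
     w \<noteq> [] \<and> (\<forall>i. w ! (Suc i mod length w) \<noteq> inv_letter (w ! (i mod length w)))"

text \<open>The infinite repetition of \<open>w\<close>, read for \<open>n\<close> letters from
  position \<open>i\<close>; both numbers may exceed the length of \<open>w\<close>. Rotations of
  \<open>w\<close> and prefixes of its powers are thus handled alike.\<close>

definition cyclic_subword :: "'a word \<Rightarrow> nat \<Rightarrow> nat \<Rightarrow> 'a word" where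
  "cyclic_subword w i n = map (\<lambda>j. w ! (j mod length w)) [i..<i + n]"

lemma length_cyclic_subword [simp]: "length (cyclic_subword w i n) = n"
  by (simp add: cyclic_subword_def)

lemma nth_cyclic_subword: "j < n \<Longrightarrow> cyclic_subword w i n ! j = w ! ((i + j) mod length w)"
  by (simp add: cyclic_subword_def)

lemma take_cyclic_subword: "j \<le> n \<Longrightarrow> take j (cyclic_subword w i n) = cyclic_subword w i j"
  by (simp add: cyclic_subword_def take_map)

lemma cyclic_subword_append: "cyclic_subword w i m @ cyclic_subword w (i + m) n = cyclic_subword w i (m + n)"
  using upt_add_eq_append[of i "i + m" n] by (simp add: cyclic_subword_def add.assoc)

lemma cyclic_subword_self: "cyclic_subword w 0 (length w) = w"
  by (intro nth_equalityI) (simp_all add: nth_cyclic_subword)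

lemma cyclic_subword_shift: "cyclic_subword w (length w + i) n = cyclic_subword w i n"
  by (intro nth_equalityI) (simp_all add: nth_cyclic_subword add.assoc)

lemma cyclic_subword_words_over: "w \<in> words_over Y \<Longrightarrow> w \<noteq> [] \<Longrightarrow> cyclic_subword w i n \<in> words_over Y"
  by (auto simp: words_over_iff cyclic_subword_def)

lemma reduced_cyclic_subword: "cyclically_reduced w \<Longrightarrow> reduced_word (cyclic_subword w i n)"
  unfolding reduced_word_iff_successively successively_conv_nth
  by (auto simp: nth_cyclic_subword cyclically_reduced_def)

context free_group
begin

lemma cyclically_reduced_conj:
  assumes "w \<in> words_over Y" "Y \<subseteq> X" "reduced_word w" "w \<noteq> []"
  shows "\<exists>u c. u \<in> carrier G \<and> c \<in> words_over Y \<and> cyclically_reduced c \<and> word_val G w = u \<otimes> word_val G c \<otimes> inv u"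
  using assms
proof (induction "length w" arbitrary: w rule: less_induct)
  case less
  have wc: "w \<in> words_over (carrier G)" using less.prems words_over_mono words_over_carrier by blast
  obtain l v where w: "w = l # v" using less.prems(4) by (cases w) auto
  show ?case
  proof (cases "last w = inv_letter l")
    case True
    then obtain u where v: "v = u @ [inv_letter l]"
      using w by (cases v rule: rev_cases) (auto split: if_splits)
    have uc: "u \<in> words_over (carrier G)" "u \<in> words_over Y" "fst l \<in> carrier G"
      using wc less.prems(1) w v by simp_all
    have "u \<noteq> []" using less.prems(3) w v by (auto simp: reduced_word_Cons)
    moreover have "reduced_word u"
      using less.prems(3) w v reduced_word_appendD[of "[l]" v] reduced_word_appendD[of u "[inv_letter l]"] by simp
    ultimately obtain x c where c: "x \<in> carrier G" "c \<in> words_over Y" "cyclically_reduced c"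
      "word_val G u = x \<otimes> word_val G c \<otimes> inv x"
      using less.hyps[of u] uc(2) less.prems(2) w v by auto
    have ilc: "[inv_letter l] \<in> words_over (carrier G)" using uc by (simp add: inv_letter_def)
    have cc: "word_val G c \<in> carrier G" using c(2) less.prems(2) words_over_mono words_over_carrier by (intro word_val_closed) blast
    have "word_val G w = letter_val G l \<otimes> word_val G u \<otimes> inv (letter_val G l)"
      using w v uc by (simp add: word_val_append[OF _ ilc] m_assoc)
    also have "\<dots> = (letter_val G l \<otimes> x) \<otimes> word_val G c \<otimes> inv (letter_val G l \<otimes> x)"
      unfolding c(4) using uc c(1) cc by (simp add: group_norm)
    finally show ?thesis
      using c uc by (intro exI[of _ "letter_val G l \<otimes> x"] exI[of _ c]) simp
  next
    case False
    have "cyclically_reduced w"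
      unfolding cyclically_reduced_def
    proof (intro conjI allI less.prems(4))
      fix i
      let ?n = "length w" and ?j = "i mod length w"
      have j: "?j < ?n" using less.prems(4) by simp
      show "w ! (Suc i mod ?n) \<noteq> inv_letter (w ! ?j)"
      proof (cases "Suc ?j = ?n")
        case True
        then have "Suc i mod ?n = 0" by (simp add: mod_Suc)
        moreover have "w ! ?j = last w" using True less.prems(4) by (metis diff_Suc_1 last_conv_nth)
        ultimately show ?thesis using False w by (metis inv_letter_inv_letter nth_Cons_0)
      next
        case False
        then have "Suc i mod ?n = Suc ?j" "Suc ?j < ?n" using j by (simp_all add: mod_Suc)
        then show ?thesis using less.prems(3)
          by (simp add: reduced_word_iff_successively successively_conv_nth)
      qed
    qed
    then show ?thesis using less.prems(1) wc by (intro exI[of _ \<one>] exI[of _ w]) simp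
  qed
qed

end

text \<open>Each edge gives a homomorphism of \<open>L\<close> to the integers, whose reduction
  modulo \<open>q\<close> has an open kernel. As \<open>L\<close> has finite index and
  \<open>Y\<close> is finite, finitely many edges suffice; the joint kernel is open in
  \<open>L\<close>, hence in \<open>F\<close>.\<close>

lemma (in pseudovariety) open_normal_homology_kernel:
  assumes "free_group F X" "open_normal \<C> F L" "finite Y"
    and r: "\<And>c. c \<in> hom (F\<lparr>carrier := L\<rparr>) integer_group \<Longrightarrow>
      open_normal \<C> (F\<lparr>carrier := L\<rparr>) {g \<in> carrier (F\<lparr>carrier := L\<rparr>). q dvd c g}"
  shows "open_normal \<C> F (free_group.homology_kernel F X L Y q)"
proof -
  interpret free_group F X by fact
  interpret L: normal L F using assms(2) by (simp add: open_normal_def)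
  have Ln: "L \<lhd> F" by (rule L.normal_axioms)
  have gL: "group (F\<lparr>carrier := L\<rparr>)" by (rule L.subgroup_is_group[OF is_group])
  define rep where "rep c = (SOME g. g \<in> c)" for c :: "'a set"
  have rep: "rep c \<in> c" if "c \<in> rcosets\<^bsub>F\<^esub> L" for c
    using L.rcosets_non_empty[OF that] by (simp add: rep_def some_in_eq)
  have rep_carrier: "rep c \<in> carrier F" if "c \<in> rcosets\<^bsub>F\<^esub> L" for c
    using rep[OF that] that L.rcosets_carrier[OF is_group] by blast
  let ?I = "(rcosets\<^bsub>F\<^esub> L) \<times> (Y \<times> (UNIV :: bool set))"
  define N where "N i = {g \<in> L. q dvd cross L g (rep (fst i)) (snd i)}" for i
  have N: "open_normal \<C> (F\<lparr>carrier := L\<rparr>) (N i)" if i: "i \<in> ?I" for i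
  proof -
    have v: "rep (fst i) \<in> carrier F" using i rep_carrier by auto
    have "(\<lambda>g. cross L g (rep (fst i)) (snd i)) \<in> hom (F\<lparr>carrier := L\<rparr>) integer_group"
    proof (rule homI)
      fix g h assume "g \<in> carrier (F\<lparr>carrier := L\<rparr>)" "h \<in> carrier (F\<lparr>carrier := L\<rparr>)"
      then have gh: "g \<in> L" "h \<in> L" by simp_all
      let ?v = "rep (fst i)"
      have "inv\<^bsub>F\<^esub> ?v \<otimes>\<^bsub>F\<^esub> inv\<^bsub>F\<^esub> g \<otimes>\<^bsub>F\<^esub> ?v \<in> L" by (rule L.inv_op_closed1[OF v L.m_inv_closed[OF gh(1)]])
      then have "cross L h ?v (snd i) = cross L h (inv\<^bsub>F\<^esub> g \<otimes>\<^bsub>F\<^esub> ?v) (snd i)"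
        using gh v by (intro cross_cong[OF L.subgroup_axioms]) (simp_all add: m_assoc)
      then show "cross L (g \<otimes>\<^bsub>F\<lparr>carrier := L\<rparr>\<^esub> h) ?v (snd i)
          = cross L g ?v (snd i) \<otimes>\<^bsub>integer_group\<^esub> cross L h ?v (snd i)"
        using gh v by (simp add: cross_mult)
    qed simp
    from r[OF this] show ?thesis by (simp add: N_def)
  qed
  have "finite ?I" using open_normal_finite_index[OF assms(2)] assms(3) by simp
  from open_normal_INT[OF gL this N]
  have "open_normal \<C> (F\<lparr>carrier := L\<rparr>) (L \<inter> (\<Inter>i\<in>?I. N i))" by simp
  moreover have "L \<inter> (\<Inter>i\<in>?I. N i) = homology_kernel L Y q"
  proof (intro equalityI subsetI)
    fix g assume g: "g \<in> L \<inter> (\<Inter>i\<in>?I. N i)"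
    have "q dvd cross L g v l" if v: "v \<in> carrier F" and l: "l \<in> Y \<times> UNIV" for v l
    proof -
      let ?c = "L #>\<^bsub>F\<^esub> v"
      have c: "?c \<in> rcosets\<^bsub>F\<^esub> L" using v by (rule rcosetsI[OF L.subset])
      obtain k where k: "k \<in> L" "rep ?c = k \<otimes>\<^bsub>F\<^esub> v" using rep[OF c] by (auto simp: r_coset_def)
      have "inv\<^bsub>F\<^esub> v \<otimes>\<^bsub>F\<^esub> k \<otimes>\<^bsub>F\<^esub> v \<in> L" by (rule L.inv_op_closed1[OF v k(1)])
      then have "cross L g v l = cross L g (rep ?c) l"
        unfolding k(2) using g k v by (intro cross_cong[OF L.subgroup_axioms]) (simp_all add: m_assoc)
      moreover have "g \<in> N (?c, l)" using g c l by blast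
      ultimately show ?thesis by (simp add: N_def)
    qed
    then show "g \<in> homology_kernel L Y q" using g by (simp add: homology_kernel_def)
  next
    fix g assume "g \<in> homology_kernel L Y q"
    then show "g \<in> L \<inter> (\<Inter>i\<in>?I. N i)" using rep_carrier by (auto simp: homology_kernel_def N_def)
  qed
  ultimately show ?thesis
    using open_normal_trans[OF assms(2) _ homology_kernel_normal[OF Ln]] by (simp only:)
qed

text \<open>Each passage to the homology cover modulo \<open>r\<close> raises the girth by one, so
  \<open>n\<close> passages from \<open>K\<close> suffice.\<close>

lemma (in pseudovariety) open_normal_girth:
  assumes F: "free_group F X" and K: "open_normal \<C> F K" and Y: "finite Y" "Y \<subseteq> X"
  obtains L where "open_normal \<C> F L" "L \<subseteq> K" "free_group.girth_exceeds F L Y n"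
proof -
  interpret free_group F X by fact
  obtain r :: nat where r: "r > 1" "\<And>A c e. group (A :: ('a, 'b) monoid_scheme) \<Longrightarrow> c \<in> hom A integer_group \<Longrightarrow>
       open_normal \<C> A {g \<in> carrier A. int (r ^ e) dvd c g}"
    using exists_modulus by blast
  have "\<exists>L. open_normal \<C> F L \<and> L \<subseteq> K \<and> girth_exceeds L Y n"
  proof (induction n)
    case 0
    then show ?case using K by (intro exI[of _ K]) (simp add: girth_exceeds_def)
  next
    case (Suc n)
    then obtain L where L: "open_normal \<C> F L" "L \<subseteq> K" "girth_exceeds L Y n" by blast
    interpret L: normal L F using L(1) by (simp add: open_normal_def)
    have gL: "group (F\<lparr>carrier := L\<rparr>)" by (rule L.subgroup_is_group[OF is_group])
    have "open_normal \<C> F (homology_kernel L Y (int r))"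
      by (rule open_normal_homology_kernel[OF F L(1) Y(1)]) (use r(2)[OF gL, of _ 1] in simp)
    moreover have "girth_exceeds (homology_kernel L Y (int r)) Y (Suc n)"
      using girth_homology_kernel[OF L.normal_axioms L(3) Y(2)] r(1) by simp
    moreover have "homology_kernel L Y (int r) \<subseteq> K" using L(2) by (auto simp: homology_kernel_def)
    ultimately show ?case by blast
  qed
  then show ?thesis using that by blast
qed

lemma (in normal) pow_index_mem:
  assumes "finite (rcosets H)" "x \<in> carrier G"
  shows "x [^] card (rcosets H) \<in> H" "card (rcosets H) > 0"
proof -
  interpret Q: group "G Mod H" by (rule factorgroup_is_group)
  have c: "carrier (G Mod H) = rcosets H" by (simp add: FactGroup_def)
  have xc: "H #> x \<in> carrier (G Mod H)" using assms(2) by (auto simp: carrier_FactGroup)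
  have "(H #> x) [^]\<^bsub>G Mod H\<^esub> order (G Mod H) = H"
    using Q.pow_order_eq_1[OF xc] by simp
  then have "H #> (x [^] card (rcosets H)) = H"
    using FactGroup_pow[OF assms(2)] c by (simp add: order_def)
  then show "x [^] card (rcosets H) \<in> H"
    using coset_join1[OF _ _ subgroup_axioms] assms(2) subset by simp
  show "card (rcosets H) > 0" using assms(1) xc c by (metis card_gt_0_iff empty_iff)
qed

lemma (in normal) pow_congruent:
  fixes n :: nat
  assumes "x \<in> carrier G" "y \<in> carrier G" "x \<otimes> inv y \<in> H"
  shows "x [^] n \<otimes> inv (y [^] n) \<in> H"
proof -
  have "H #> x = H #> y" using rcos_eq_iff[OF subgroup_axioms] assms by simp
  then have "H #> (x [^] n) = H #> (y [^] n)"
    using FactGroup_pow[OF assms(1), of n] FactGroup_pow[OF assms(2), of n] by simp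
  then show ?thesis using rcos_eq_iff[OF subgroup_axioms] assms by simp
qed

section \<open>Recovering a closed path from its homology class\<close>

context free_group
begin

lemma cyclic_subword_carrier:
  "w \<in> words_over X \<Longrightarrow> w \<noteq> [] \<Longrightarrow> cyclic_subword w i n \<in> words_over (carrier G)"
  by (simp add: words_over_carrier cyclic_subword_words_over)

abbreviation prefix_val :: "'a word \<Rightarrow> nat \<Rightarrow> 'a" where
  "prefix_val w i \<equiv> word_val G (cyclic_subword w 0 i)"

lemma prefix_val_closed: "w \<in> words_over X \<Longrightarrow> w \<noteq> [] \<Longrightarrow> prefix_val w i \<in> carrier G"
  by (simp add: cyclic_subword_carrier)

lemma prefix_val_add_length:
  assumes "w \<in> words_over X" "w \<noteq> []"
  shows "prefix_val w (length w + i) = word_val G w \<otimes> prefix_val w i"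
proof -
  have "cyclic_subword w 0 (length w + i) = w @ cyclic_subword w 0 i"
    using cyclic_subword_append[of w 0 "length w" i] cyclic_subword_shift[of w 0 i]
    by (simp add: cyclic_subword_self)
  then show ?thesis using assms by (simp add: words_over_carrier cyclic_subword_carrier)
qed

lemma word_val_rotation:
  assumes "w \<in> words_over X" "w \<noteq> []"
  shows "word_val G (cyclic_subword w i (length w)) = inv (prefix_val w i) \<otimes> word_val G w \<otimes> prefix_val w i"
proof -
  have "prefix_val w i \<otimes> word_val G (cyclic_subword w i (length w)) = word_val G w \<otimes> prefix_val w i"
    using cyclic_subword_append[of w 0 i "length w"] prefix_val_add_length[OF assms, of i]
      word_val_append[OF cyclic_subword_carrier[OF assms, of 0 i] cyclic_subword_carrier[OF assms, of i "length w"]]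
    by (simp add: add.commute)
  then have "inv (prefix_val w i) \<otimes> (prefix_val w i \<otimes> word_val G (cyclic_subword w i (length w))) =
      inv (prefix_val w i) \<otimes> (word_val G w \<otimes> prefix_val w i)" by simp
  then show ?thesis
    using assms by (simp add: inv_m_cancel m_assoc cyclic_subword_carrier words_over_carrier)
qed

lemma prefix_val_period:
  assumes "w \<in> words_over X" "w \<noteq> []"
  shows "prefix_val w (m * length w) = word_val G w [^] m"
proof (induction m)
  case 0
  then show ?case by (simp add: cyclic_subword_def)
next
  case (Suc m)
  then show ?case
    using prefix_val_add_length[OF assms, of "m * length w"]
      nat_pow_Suc2[OF word_val_closed[OF words_over_carrier[OF assms(1)]], of m] by simp
qed

text \<open>The word \<open>inv_word u @ w\<close> is a loop of length at most \<open>n\<close> in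
  the quotient graph, hence already trivial in the free group: balls of radius \<open>n/2\<close> in
  the quotient graph are trees.\<close>

lemma close_reduced_words_eq:
  assumes "girth_exceeds L Y n" "Y \<subseteq> X" "u \<in> words_over Y" "w \<in> words_over Y"
    "reduced_word u" "reduced_word w" "length u + length w \<le> n" "inv (word_val G u) \<otimes> word_val G w \<in> L"
  shows "u = w"
proof -
  have c: "u \<in> words_over X" "w \<in> words_over X" "u \<in> words_over (carrier G)" "w \<in> words_over (carrier G)"
    using assms(2-4) words_over_mono words_over_carrier by blast+
  have "inv_word u @ w \<in> words_over Y" using assms by simp
  then have "word_val G (inv_word u @ w) = \<one>"
    by (rule girth_exceedsD[OF assms(1,2)]) (use assms c in simp_all)
  then have "word_val G u \<otimes> (inv (word_val G u) \<otimes> word_val G w) = word_val G u \<otimes> \<one>" using c by simp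
  then have "word_val G u = word_val G w" using c by (simp add: inv_m_cancel)
  then show ?thesis using word_val_inj c assms(5,6) by blast
qed

text \<open>The rotation of \<open>w\<close> at \<open>i\<close> is the conjugate of
  \<open>w\<close> by \<open>prefix_val w i\<close>. So equal vertices modulo the normal subgroup
  \<open>L\<close> give congruent rotations, which are the same word by the girth.\<close>

lemma close_vertices_rotation_eq:
  assumes "L \<lhd> G" "girth_exceeds L Y n" "Y \<subseteq> X" "w \<in> words_over Y" "cyclically_reduced w" "2 * length w \<le> n"
    "inv (prefix_val w i) \<otimes> prefix_val w j \<in> L"
  shows "cyclic_subword w i (length w) = cyclic_subword w j (length w)"
proof (rule close_reduced_words_eq[OF assms(2,3)])
  interpret L: normal L G by fact
  have w: "w \<noteq> []" "w \<in> words_over X" using assms words_over_mono by (auto simp: cyclically_reduced_def)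
  show "cyclic_subword w i (length w) \<in> words_over Y" "cyclic_subword w j (length w) \<in> words_over Y"
    using assms w by (simp_all add: cyclic_subword_words_over)
  let ?k = "inv (prefix_val w i) \<otimes> prefix_val w j"
  let ?a = "inv (prefix_val w i) \<otimes> word_val G w \<otimes> prefix_val w i"
  have c: "prefix_val w i \<in> carrier G" "prefix_val w j \<in> carrier G" "word_val G w \<in> carrier G"
    using prefix_val_closed w words_over_carrier by auto
  have "inv ?a \<otimes> inv ?k \<otimes> ?a \<in> L" using c assms(7) by (intro L.inv_op_closed1) simp_all
  then have "inv ?a \<otimes> inv ?k \<otimes> ?a \<otimes> ?k \<in> L" using assms(7) by (rule L.m_closed)
  then show "inv (word_val G (cyclic_subword w i (length w))) \<otimes> word_val G (cyclic_subword w j (length w)) \<in> L"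
    unfolding word_val_rotation[OF w(2,1)] using c by (simp add: group_norm)
qed (use assms in \<open>simp_all add: reduced_cyclic_subword\<close>)

text \<open>The closed paths of \<open>y\<^sup>m\<close> and of a translate of \<open>x\<^sup>m\<close> have equal classes modulo \<open>q\<close>. The first one
  traverses its first edge at least once and less than \<open>q\<close> times, so the second one meets that edge;
  by the girth condition they agree from there on.\<close>

lemma conjugate_mod_homology_kernel:
  assumes L: "L \<lhd> G" and girth: "girth_exceeds L Y n" and Y: "Y \<subseteq> X"
    and x: "x \<in> words_over Y" "cyclically_reduced x" and y: "y \<in> words_over Y" "cyclically_reduced y"
    and n: "length x + length y \<le> n" "2 * length y \<le> n"
    and m: "m > 0" "word_val G x [^] m \<in> L" "word_val G y [^] m \<in> L" and q: "q > int (m * length y)"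
    and g: "g \<in> carrier G" "g \<otimes> word_val G x \<otimes> inv g \<otimes> inv (word_val G y) \<in> homology_kernel L Y q"
  shows "\<exists>i. inv (prefix_val x i) \<otimes> inv g \<in> L \<and> cyclic_subword x i (length x) = y"
proof -
  interpret L: normal L G by fact
  have HL: "homology_kernel L Y q \<subseteq> L"
    and Hdvd: "\<And>z v l. z \<in> homology_kernel L Y q \<Longrightarrow> v \<in> carrier G \<Longrightarrow> l \<in> Y \<times> UNIV \<Longrightarrow> q dvd cross L z v l"
    by (auto simp: homology_kernel_def)
  interpret H: normal "homology_kernel L Y q" G by (rule homology_kernel_normal[OF L])
  have xX: "x \<in> words_over X" "x \<noteq> []" and yX: "y \<in> words_over X" "y \<noteq> []"
    using x y Y words_over_mono by (auto simp: cyclically_reduced_def)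
  define a b where "a = word_val G x" and "b = word_val G y"
  have ab: "a \<in> carrier G" "b \<in> carrier G" using xX yX words_over_carrier by (simp_all add: a_def b_def)
  define l where "l = y ! 0"
  have l: "l \<in> Y \<times> UNIV" using y yX by (auto simp: l_def words_over_iff mem_Times_iff)
  define yy xx where "yy = cyclic_subword y 0 (m * length y)" and "xx = cyclic_subword x 0 (m * length x)"
  have yy: "yy \<in> words_over X" "word_val G yy = b [^] m"
    using prefix_val_period[OF yX, of m] by (simp_all add: yy_def b_def cyclic_subword_words_over[OF yX])
  have xx: "xx \<in> words_over X" "word_val G xx = a [^] m"
    using prefix_val_period[OF xX, of m] by (simp_all add: xx_def a_def cyclic_subword_words_over[OF xX])
  have ny: "length y > 0" using yX by simp
  \<comment> \<open>After a backward traversal of the edge, the path of \<open>y^m\<close> is at its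
    base vertex again. There the next letter is \<open>l\<close>, by
    \<open>close_vertices_rotation_eq\<close>, so \<open>l\<close> would follow its own inverse in
    the cyclic word \<open>y\<close>.\<close>
  have noneg: "inv (word_val G (take (Suc i) yy)) \<otimes> \<one> \<notin> L" if "i < length yy" "yy ! i = inv_letter l" for i
  proof
    assume L1: "inv (word_val G (take (Suc i) yy)) \<otimes> \<one> \<in> L"
    have i: "i < m * length y" using that by (simp add: yy_def)
    then have "take (Suc i) yy = cyclic_subword y 0 (Suc i)" unfolding yy_def by (intro take_cyclic_subword) simp
    with L1 have "inv (prefix_val y (Suc i)) \<otimes> prefix_val y 0 \<in> L" by (simp add: cyclic_subword_def)
    from close_vertices_rotation_eq[OF L girth Y y n(2) this]
    have "cyclic_subword y (Suc i) (length y) ! 0 = cyclic_subword y 0 (length y) ! 0" by simp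
    then have "y ! (Suc i mod length y) = l" using ny by (simp add: nth_cyclic_subword l_def)
    moreover have "y ! (i mod length y) = inv_letter l" using that i by (simp add: yy_def nth_cyclic_subword)
    ultimately have "y ! (Suc i mod length y) = inv_letter (y ! (i mod length y))" by simp
    then show False using y(2) unfolding cyclically_reduced_def by blast
  qed
  have yyc: "yy \<in> words_over (carrier G)" using yy(1) by (rule words_over_carrier)
  have "crossing L yy \<one> l \<ge> 1"
  proof -
    obtain yt where yt: "yy = l # yt"
    proof (cases yy)
      case Nil
      then have "length yy = 0" by simp
      then show ?thesis using ny m(1) by (simp add: yy_def)
    next
      case (Cons k u)
      have "yy ! 0 = l" using ny m(1) by (simp add: yy_def nth_cyclic_subword l_def)
      with Cons that show ?thesis by simp
    qed
    have "0 \<le> crossing L yt (inv (letter_val G l) \<otimes> \<one>) l \<and> crossing L yt (inv (letter_val G l) \<otimes> \<one>) l \<le> length yt"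
    proof (rule crossing_bounds)
      show "yt \<in> words_over (carrier G)" "inv (letter_val G l) \<otimes> \<one> \<in> carrier G" using yyc yt by simp_all
      fix i assume i: "i < length yt" "yt ! i = inv_letter l"
      have "take (Suc i) yt \<in> words_over (carrier G)"
        using yyc yt by (auto simp: words_over_iff dest: in_set_takeD)
      then show "inv (word_val G (take (Suc i) yt)) \<otimes> (inv (letter_val G l) \<otimes> \<one>) \<notin> L"
        using noneg[of "Suc i"] i yt yyc by (simp add: inv_mult_group)
    qed
    then show ?thesis using yt by simp
  qed
  moreover have "crossing L yy \<one> l \<le> int (length yy)"
    using crossing_bounds[OF yyc one_closed noneg] by simp
  \<comment> \<open>The crossing number of \<open>y^m\<close> is at least 1 and at most
    \<open>m * length y\<close>, which is less than \<open>q\<close>.\<close>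
  ultimately have cy: "\<not> q dvd cross L (b [^] m) \<one> l"
    using cross_word_val[OF yy(1) one_closed, of L l] yy(2) q zdvd_not_zless[of "crossing L yy \<one> l" q]
    by (simp add: yy_def)
  let ?c = "g \<otimes> a \<otimes> inv g"
  have c: "?c \<in> carrier G" using g ab by simp
  have pc: "?c [^] m = g \<otimes> a [^] m \<otimes> inv g"
  proof (induction m)
    case (Suc m)
    then show ?case using g ab by (simp add: group_norm)
  qed (use g in simp)
  \<comment> \<open>The relation is raised to the power \<open>m\<close>, which puts both sides into
    \<open>L\<close> and so makes the paths closed; the congruence modulo the homology kernel
    survives.\<close>
  define z where "z = ?c [^] m \<otimes> inv (b [^] m)"
  have z: "z \<in> homology_kernel L Y q"
    unfolding z_def by (rule H.pow_congruent[OF c ab(2)]) (use g(2) in \<open>simp add: a_def b_def\<close>)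
  then have zL: "z \<in> L" using HL by blast
  have zc: "z \<in> carrier G" using zL by simp
  have "?c [^] m = z \<otimes> b [^] m" unfolding z_def using c ab by (simp add: group_norm)
  then have "cross L (?c [^] m) \<one> l = cross L z \<one> l + cross L (b [^] m) (inv z \<otimes> \<one>) l"
    using zc ab by (simp add: cross_mult)
  moreover have "cross L (b [^] m) (inv z \<otimes> \<one>) l = cross L (b [^] m) \<one> l"
    by (rule cross_cong[OF L.subgroup_axioms]) (use zc zL ab in simp_all)
  moreover have "q dvd cross L z \<one> l" using Hdvd[OF z one_closed l] .
  ultimately have "\<not> q dvd cross L (?c [^] m) \<one> l" using cy by (simp add: dvd_add_right_iff)
  moreover have "cross L (?c [^] m) \<one> l = cross L (a [^] m) (inv g \<otimes> \<one>) l"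
    unfolding pc using m(2) g by (intro cross_conj[OF L]) (simp_all add: a_def)
  moreover have "cross L (a [^] m) (inv g \<otimes> \<one>) l = crossing L xx (inv g) l"
    using cross_word_val[OF xx(1), of "inv g" L l] xx(2) g by simp
  ultimately have "crossing L xx (inv g) l \<noteq> 0" by auto
  \<comment> \<open>Traversed forwards, the edge starts at the vertex of \<open>g^-1\<close>;
    traversed backwards, it ends there. Either way the path of \<open>x^m\<close> visits this
    vertex.\<close>
  then obtain i where i: "i < length xx"
    "inv (word_val G (take i xx)) \<otimes> inv g \<in> L \<or> inv (word_val G (take (Suc i) xx)) \<otimes> inv g \<in> L"
    using crossing_nonzeroD[of L xx "inv g" l] words_over_carrier[OF xx(1)] g by auto
  have tk: "take j xx = cyclic_subword x 0 j" if "j \<le> length xx" for j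
    using that by (simp add: xx_def take_cyclic_subword)
  obtain j where j: "inv (prefix_val x j) \<otimes> inv g \<in> L"
    using i tk[of i] tk[of "Suc i"] by auto
  let ?p = "prefix_val x j"
  have p: "?p \<in> carrier G" using prefix_val_closed[OF xX] .
  have gl: "g \<otimes> a \<otimes> inv g \<otimes> inv b \<in> L" unfolding a_def b_def using g(2) HL by blast
  \<comment> \<open>The rotation of \<open>x\<close> at \<open>j\<close> is congruent to
    \<open>g x g^-1\<close> modulo \<open>L\<close>, hence to \<open>y\<close>, and both words are
    short compared with the girth.\<close>
  have "cyclic_subword x j (length x) = y"
  proof (rule close_reduced_words_eq[OF girth Y])
    let ?k = "inv ?p \<otimes> inv g"
    let ?r = "inv ?p \<otimes> a \<otimes> ?p"
    let ?d = "inv (g \<otimes> a \<otimes> inv g \<otimes> inv b) \<otimes> inv ?k"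
    have d: "?d \<in> L" by (rule L.m_closed[OF L.m_inv_closed[OF gl] L.m_inv_closed[OF j]])
    have r: "?r \<in> carrier G" using p ab by simp
    have "inv ?r \<otimes> ?d \<otimes> ?r \<otimes> ?k = inv ?r \<otimes> b"
      using p g(1) ab by (simp add: group_norm)
    from subst[OF this, of "\<lambda>u. u \<in> L", OF L.m_closed[OF L.inv_op_closed1[OF r d] j]] have "inv ?r \<otimes> b \<in> L" .
    then show "inv (word_val G (cyclic_subword x j (length x))) \<otimes> word_val G y \<in> L"
      unfolding word_val_rotation[OF xX] by (simp add: a_def b_def)
    show "reduced_word y"
      using reduced_cyclic_subword[OF y(2), of 0 "length y"] by (simp add: cyclic_subword_self)
  qed (use x y n xX in \<open>simp_all add: reduced_cyclic_subword cyclic_subword_words_over\<close>)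
  with j show ?thesis by blast
qed

end

lemma (in pseudovariety) open_normal_separates_rotations:
  assumes F: "free_group F X" and K: "open_normal \<C> F K" and Y: "finite Y" "Y \<subseteq> X"
    and x: "x \<in> words_over Y" "cyclically_reduced x" and y: "y \<in> words_over Y" "cyclically_reduced y"
  obtains L where "open_normal \<C> F L" "L \<subseteq> K"
    "\<And>g. g \<in> carrier F \<Longrightarrow>
       g \<otimes>\<^bsub>F\<^esub> word_val F x \<otimes>\<^bsub>F\<^esub> inv\<^bsub>F\<^esub> g \<otimes>\<^bsub>F\<^esub> inv\<^bsub>F\<^esub> (word_val F y) \<in> L \<Longrightarrow>
       \<exists>i. inv\<^bsub>F\<^esub> (word_val F (cyclic_subword x 0 i)) \<otimes>\<^bsub>F\<^esub> inv\<^bsub>F\<^esub> g \<in> K \<and> cyclic_subword x i (length x) = y"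
proof -
  interpret free_group F X by fact
  \<comment> \<open>Large enough for both length conditions of
    \<open>conjugate_mod_homology_kernel\<close>.\<close>
  define n where "n = 2 * (length x + length y)"
  obtain L where L: "open_normal \<C> F L" "L \<subseteq> K" "girth_exceeds L Y n"
    by (rule open_normal_girth[OF F K Y])
  interpret L: normal L F using L(1) by (simp add: open_normal_def)
  have gL: "group (F\<lparr>carrier := L\<rparr>)" by (rule L.subgroup_is_group[OF is_group])
  define m where "m = card (rcosets\<^bsub>F\<^esub> L)"
  have xy: "word_val F x \<in> carrier F" "word_val F y \<in> carrier F"
    using x(1) y(1) Y(2) words_over_mono words_over_carrier word_val_closed by blast+
  note m = L.pow_index_mem[OF open_normal_finite_index[OF L(1)], folded m_def]
  obtain r :: nat where r: "r > 1" "\<And>A c e. group (A :: ('a, 'b) monoid_scheme) \<Longrightarrow> c \<in> hom A integer_group \<Longrightarrow>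
       open_normal \<C> A {g \<in> carrier A. int (r ^ e) dvd c g}"
    using exists_modulus by blast
  \<comment> \<open>As \<open>r \<ge> 2\<close>, this power of \<open>r\<close> exceeds its own
    exponent \<open>m * length y\<close>, the bound for the crossing number of
    \<open>y^m\<close>.\<close>
  define q where "q = int (r ^ (m * length y))"
  have "m * length y < 2 ^ (m * length y)" by (rule less_exp)
  also have "2 ^ (m * length y) \<le> r ^ (m * length y)" using r(1) by (intro power_mono) simp_all
  finally have q: "q > int (m * length y)" unfolding q_def by (simp only: of_nat_less_iff)
  have "open_normal \<C> F (homology_kernel L Y q)"
    by (rule open_normal_homology_kernel[OF F L(1) Y(1)]) (use r(2)[OF gL] in \<open>simp only: q_def\<close>)
  moreover have "homology_kernel L Y q \<subseteq> K" using L(2) by (auto simp: homology_kernel_def)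
  moreover have "\<exists>i. inv\<^bsub>F\<^esub> (prefix_val x i) \<otimes>\<^bsub>F\<^esub> inv\<^bsub>F\<^esub> g \<in> K \<and> cyclic_subword x i (length x) = y"
    if g: "g \<in> carrier F" "g \<otimes>\<^bsub>F\<^esub> word_val F x \<otimes>\<^bsub>F\<^esub> inv\<^bsub>F\<^esub> g \<otimes>\<^bsub>F\<^esub> inv\<^bsub>F\<^esub> (word_val F y) \<in> homology_kernel L Y q"
    for g
  proof -
    have "\<exists>i. inv\<^bsub>F\<^esub> (prefix_val x i) \<otimes>\<^bsub>F\<^esub> inv\<^bsub>F\<^esub> g \<in> L \<and> cyclic_subword x i (length x) = y"
      by (rule conjugate_mod_homology_kernel[OF L.normal_axioms L(3) Y(2) x y _ _ m(2)[OF xy(1)]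
            m(1)[OF xy(1)] m(1)[OF xy(2)] q g]) (simp_all add: n_def)
    then show ?thesis using L(2) by blast
  qed
  ultimately show ?thesis by (rule that)
qed

text \<open>Non-trivial elements are replaced by cyclically reduced conjugates, for which conjugacy
  becomes rotation. The trivial element has no such conjugate; it is separated from the others by
  the girth alone.\<close>

lemma (in pseudovariety) coset_conjugacy_separable_free:
  assumes F: "free_group F X"
  shows "coset_conjugacy_separable \<C> F"
  unfolding coset_conjugacy_separable_def
proof (intro ballI allI impI)
  interpret free_group F X by fact
  fix x y K assume x: "x \<in> carrier F" and y: "y \<in> carrier F" and K: "open_normal \<C> F K"
  interpret K: normal K F using K by (simp add: open_normal_def)
  \<comment> \<open>The basis may be infinite; only the finitely many letters of \<open>x\<close>
    and \<open>y\<close> enter the graphs.\<close>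
  define Y where "Y = fst ` (set (normal_form x) \<union> set (normal_form y))"
  have Y: "finite Y" "Y \<subseteq> X" "normal_form x \<in> words_over Y" "normal_form y \<in> words_over Y"
    using normal_form(1)[OF x] normal_form(1)[OF y] by (auto simp: Y_def words_over_iff)
  let ?sep = "\<lambda>L g. g \<otimes>\<^bsub>F\<^esub> x \<otimes>\<^bsub>F\<^esub> inv\<^bsub>F\<^esub> g \<otimes>\<^bsub>F\<^esub> inv\<^bsub>F\<^esub> y \<in> L \<longrightarrow>
              (\<exists>k\<in>K. (g \<otimes>\<^bsub>F\<^esub> k) \<otimes>\<^bsub>F\<^esub> x \<otimes>\<^bsub>F\<^esub> inv\<^bsub>F\<^esub> (g \<otimes>\<^bsub>F\<^esub> k) = y)"
  have nontrivial: "\<exists>L. open_normal \<C> F L \<and> L \<subseteq> K \<and> z \<notin> L"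
    if z: "z \<in> carrier F" "z \<noteq> \<one>\<^bsub>F\<^esub>" "normal_form z \<in> words_over Y" for z
  proof -
    obtain L where L: "open_normal \<C> F L" "L \<subseteq> K" "girth_exceeds L Y (length (normal_form z))"
      by (rule open_normal_girth[OF F K Y(1,2)])
    have "normal_form z \<noteq> []" using normal_form(3)[OF z(1)] z(2) by auto
    then have "z \<notin> L" using L(3) normal_form[OF z(1)] z(3) by (auto simp: girth_exceeds_def)
    then show ?thesis using L by blast
  qed
  consider "x = \<one>\<^bsub>F\<^esub>" "y = \<one>\<^bsub>F\<^esub>" | "x = \<one>\<^bsub>F\<^esub>" "y \<noteq> \<one>\<^bsub>F\<^esub>" | "x \<noteq> \<one>\<^bsub>F\<^esub>" "y = \<one>\<^bsub>F\<^esub>"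
    | "x \<noteq> \<one>\<^bsub>F\<^esub>" "y \<noteq> \<one>\<^bsub>F\<^esub>" by blast
  then have "\<exists>L. open_normal \<C> F L \<and> L \<subseteq> K \<and> (\<forall>g\<in>carrier F. ?sep L g)"
  proof cases
    case 1
    have "\<exists>k\<in>K. (g \<otimes>\<^bsub>F\<^esub> k) \<otimes>\<^bsub>F\<^esub> x \<otimes>\<^bsub>F\<^esub> inv\<^bsub>F\<^esub> (g \<otimes>\<^bsub>F\<^esub> k) = y" if "g \<in> carrier F" for g
      using 1 that by (intro bexI[of _ "\<one>\<^bsub>F\<^esub>"]) simp_all
    then show ?thesis using K by blast
  next
    case 2
    then obtain L where L: "open_normal \<C> F L" "L \<subseteq> K" "y \<notin> L" using nontrivial[OF y _ Y(4)] by blast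
    interpret L: normal L F using L(1) by (simp add: open_normal_def)
    have "\<not> g \<otimes>\<^bsub>F\<^esub> x \<otimes>\<^bsub>F\<^esub> inv\<^bsub>F\<^esub> g \<otimes>\<^bsub>F\<^esub> inv\<^bsub>F\<^esub> y \<in> L" if "g \<in> carrier F" for g
    proof
      assume "g \<otimes>\<^bsub>F\<^esub> x \<otimes>\<^bsub>F\<^esub> inv\<^bsub>F\<^esub> g \<otimes>\<^bsub>F\<^esub> inv\<^bsub>F\<^esub> y \<in> L"
      then have "inv\<^bsub>F\<^esub> y \<in> L" using 2 that y by simp
      then have "inv\<^bsub>F\<^esub> (inv\<^bsub>F\<^esub> y) \<in> L" by (rule L.m_inv_closed)
      then show False using L(3) y by simp
    qed
    then show ?thesis using L(1,2) by blast
  next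
    case 3
    then obtain L where L: "open_normal \<C> F L" "L \<subseteq> K" "x \<notin> L" using nontrivial[OF x _ Y(3)] by blast
    interpret L: normal L F using L(1) by (simp add: open_normal_def)
    have "\<not> g \<otimes>\<^bsub>F\<^esub> x \<otimes>\<^bsub>F\<^esub> inv\<^bsub>F\<^esub> g \<otimes>\<^bsub>F\<^esub> inv\<^bsub>F\<^esub> y \<in> L" if g: "g \<in> carrier F" for g
    proof
      assume "g \<otimes>\<^bsub>F\<^esub> x \<otimes>\<^bsub>F\<^esub> inv\<^bsub>F\<^esub> g \<otimes>\<^bsub>F\<^esub> inv\<^bsub>F\<^esub> y \<in> L"
      then have "g \<otimes>\<^bsub>F\<^esub> x \<otimes>\<^bsub>F\<^esub> inv\<^bsub>F\<^esub> g \<in> L" using 3 g x by simp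
      from L.inv_op_closed1[OF g this] have "x \<in> L" using g x by (simp add: group_norm)
      then show False using L(3) by simp
    qed
    then show ?thesis using L(1,2) by blast
  next
    case 4
    then have "normal_form x \<noteq> []" "normal_form y \<noteq> []"
      using normal_form(3)[OF x] normal_form(3)[OF y] by auto
    then obtain a u b w where
      u: "a \<in> carrier F" "u \<in> words_over Y" "cyclically_reduced u" "x = a \<otimes>\<^bsub>F\<^esub> word_val F u \<otimes>\<^bsub>F\<^esub> inv\<^bsub>F\<^esub> a" and
      w: "b \<in> carrier F" "w \<in> words_over Y" "cyclically_reduced w" "y = b \<otimes>\<^bsub>F\<^esub> word_val F w \<otimes>\<^bsub>F\<^esub> inv\<^bsub>F\<^esub> b"
      using cyclically_reduced_conj[OF Y(3,2)] cyclically_reduced_conj[OF Y(4,2)] normal_form[OF x] normal_form[OF y]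
      by metis
    have uX: "u \<in> words_over X" "u \<noteq> []" using u Y words_over_mono by (auto simp: cyclically_reduced_def)
    have c: "word_val F u \<in> carrier F" "word_val F w \<in> carrier F"
      using u(2) w(2) Y(2) words_over_mono words_over_carrier word_val_closed by blast+
    obtain L where L: "open_normal \<C> F L" "L \<subseteq> K"
      "\<And>g. g \<in> carrier F \<Longrightarrow>
       g \<otimes>\<^bsub>F\<^esub> word_val F u \<otimes>\<^bsub>F\<^esub> inv\<^bsub>F\<^esub> g \<otimes>\<^bsub>F\<^esub> inv\<^bsub>F\<^esub> (word_val F w) \<in> L \<Longrightarrow>
       \<exists>i. inv\<^bsub>F\<^esub> (prefix_val u i) \<otimes>\<^bsub>F\<^esub> inv\<^bsub>F\<^esub> g \<in> K \<and> cyclic_subword u i (length u) = w"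
      using open_normal_separates_rotations[OF F K Y(1,2) u(2,3) w(2,3)] by metis
    interpret L: normal L F using L(1) by (simp add: open_normal_def)
    have "\<exists>k\<in>K. (g \<otimes>\<^bsub>F\<^esub> k) \<otimes>\<^bsub>F\<^esub> x \<otimes>\<^bsub>F\<^esub> inv\<^bsub>F\<^esub> (g \<otimes>\<^bsub>F\<^esub> k) = y"
      if g: "g \<in> carrier F" and gL: "g \<otimes>\<^bsub>F\<^esub> x \<otimes>\<^bsub>F\<^esub> inv\<^bsub>F\<^esub> g \<otimes>\<^bsub>F\<^esub> inv\<^bsub>F\<^esub> y \<in> L" for g
    proof -
      let ?g = "inv\<^bsub>F\<^esub> b \<otimes>\<^bsub>F\<^esub> g \<otimes>\<^bsub>F\<^esub> a"
      have gc: "?g \<in> carrier F" using g u(1) w(1) by simp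
      have e: "inv\<^bsub>F\<^esub> b \<otimes>\<^bsub>F\<^esub> (g \<otimes>\<^bsub>F\<^esub> x \<otimes>\<^bsub>F\<^esub> inv\<^bsub>F\<^esub> g \<otimes>\<^bsub>F\<^esub> inv\<^bsub>F\<^esub> y) \<otimes>\<^bsub>F\<^esub> b =
        ?g \<otimes>\<^bsub>F\<^esub> word_val F u \<otimes>\<^bsub>F\<^esub> inv\<^bsub>F\<^esub> ?g \<otimes>\<^bsub>F\<^esub> inv\<^bsub>F\<^esub> (word_val F w)"
        unfolding u(4) w(4) using g u(1) w(1) c by (simp add: group_norm)
      have "?g \<otimes>\<^bsub>F\<^esub> word_val F u \<otimes>\<^bsub>F\<^esub> inv\<^bsub>F\<^esub> ?g \<otimes>\<^bsub>F\<^esub> inv\<^bsub>F\<^esub> (word_val F w) \<in> L"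
        using L.inv_op_closed1[OF w(1) gL] unfolding e .
      then obtain i where i: "inv\<^bsub>F\<^esub> (prefix_val u i) \<otimes>\<^bsub>F\<^esub> inv\<^bsub>F\<^esub> ?g \<in> K" "cyclic_subword u i (length u) = w"
        using L(3)[OF gc] by blast
      let ?p = "prefix_val u i"
      have p: "?p \<in> carrier F" by (rule prefix_val_closed[OF uX])
      have wv: "inv\<^bsub>F\<^esub> ?p \<otimes>\<^bsub>F\<^esub> word_val F u \<otimes>\<^bsub>F\<^esub> ?p = word_val F w"
        using word_val_rotation[OF uX, of i] i(2) by simp
      have ap: "a \<otimes>\<^bsub>F\<^esub> ?p \<in> carrier F" using u(1) p by simp
      \<comment> \<open>The corrected conjugator \<open>g k = b p^-1 a^-1\<close> leads from
        \<open>x\<close> to \<open>u\<close> by \<open>a^-1\<close>, on to the rotation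
        \<open>w\<close> by \<open>p^-1\<close>, and to \<open>y\<close> by \<open>b\<close>. It
        differs from \<open>g\<close> by \<open>?k\<close>, a conjugate of the element
        \<open>inv ?p \<otimes> inv ?g\<close> of \<open>K\<close>.\<close>
      let ?k = "(a \<otimes>\<^bsub>F\<^esub> ?p) \<otimes>\<^bsub>F\<^esub> (inv\<^bsub>F\<^esub> ?p \<otimes>\<^bsub>F\<^esub> inv\<^bsub>F\<^esub> ?g) \<otimes>\<^bsub>F\<^esub> inv\<^bsub>F\<^esub> (a \<otimes>\<^bsub>F\<^esub> ?p)"
      have k: "?k \<in> K" by (rule K.inv_op_closed2[OF ap i(1)])
      have gk: "g \<otimes>\<^bsub>F\<^esub> ?k = b \<otimes>\<^bsub>F\<^esub> inv\<^bsub>F\<^esub> ?p \<otimes>\<^bsub>F\<^esub> inv\<^bsub>F\<^esub> a"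
        using g u(1) w(1) p by (simp add: group_norm)
      have "(g \<otimes>\<^bsub>F\<^esub> ?k) \<otimes>\<^bsub>F\<^esub> x \<otimes>\<^bsub>F\<^esub> inv\<^bsub>F\<^esub> (g \<otimes>\<^bsub>F\<^esub> ?k) =
          b \<otimes>\<^bsub>F\<^esub> (inv\<^bsub>F\<^esub> ?p \<otimes>\<^bsub>F\<^esub> word_val F u \<otimes>\<^bsub>F\<^esub> ?p) \<otimes>\<^bsub>F\<^esub> inv\<^bsub>F\<^esub> b"
        unfolding gk u(4) using u(1) w(1) p c by (simp add: group_norm)
      also have "\<dots> = y" unfolding wv w(4) ..
      finally show ?thesis using k by (rule bexI)
    qed
    then show ?thesis using L(1,2) by blast
  qed
  then show "\<exists>L\<subseteq>K. open_normal \<C> F L \<and> (\<forall>g\<in>carrier F. ?sep L g)" by (elim exE conjE) (rule exI, intro conjI)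
qed

section \<open>Centralizers in non-abelian free groups\<close>

definition finite_groups :: "nat monoid set" where
  "finite_groups = {M. group M \<and> finite (carrier M)}"

lemma in_class_finite_groups: "in_class finite_groups A \<longleftrightarrow> group A \<and> finite (carrier A)"
proof
  assume "in_class finite_groups A"
  then show "group A \<and> finite (carrier A)"
    using iso_finite by (auto simp: in_class_def finite_groups_def)
next
  assume A: "group A \<and> finite (carrier A)"
  then obtain M :: "nat monoid" and h where M: "group M" "h \<in> iso A M"
    using group.finite_group_iso_nat by blast
  then have "A \<cong> M" by (blast intro: is_isoI)
  then show "in_class finite_groups A"
    using A M(1) iso_finite[of A M] by (auto simp: in_class_def finite_groups_def)
qed

lemma pseudovariety_finite_groups: "pseudovariety finite_groups"
proof
  show "pseudovariety_of_finite_groups finite_groups"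
    unfolding pseudovariety_of_finite_groups_def in_class_finite_groups
  proof (intro conjI ballI allI impI)
    fix A H assume A: "A \<in> finite_groups" and H: "subgroup H A"
    then show "group (A\<lparr>carrier := H\<rparr>)" by (auto simp: finite_groups_def intro: subgroup.subgroup_is_group)
    show "finite (carrier (A\<lparr>carrier := H\<rparr>))"
      using A finite_subset[OF subgroup.subset[OF H]] by (simp add: finite_groups_def)
  next
    fix A N assume A: "A \<in> finite_groups" and N: "N \<lhd> A"
    then show "group (A Mod N)" by (intro normal.factorgroup_is_group)
    show "finite (carrier (A Mod N))" using A by (simp add: carrier_FactGroup finite_groups_def)
  qed (auto simp: finite_groups_def intro: DirProd_group)
  show "extension_closed finite_groups"
    unfolding extension_closed_def in_class_finite_groups
  proof (intro allI impI)
    fix A :: "nat monoid" and N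
    assume N: "N \<lhd> A" "group (A\<lparr>carrier := N\<rparr>) \<and> finite (carrier (A\<lparr>carrier := N\<rparr>))"
      "group (A Mod N) \<and> finite (carrier (A Mod N))"
    interpret normal N A by (rule N(1))
    have "finite (rcosets\<^bsub>A\<^esub> N)" using N(3) by (simp add: FactGroup_def)
    moreover have "finite c" if "c \<in> rcosets\<^bsub>A\<^esub> N" for c
      using that N(2) by (auto simp: RCOSETS_def r_coset_def)
    moreover have "\<Union> (rcosets\<^bsub>A\<^esub> N) = carrier A" using rcosets_part_G subgroup_axioms by simp
    ultimately have "finite (carrier A)" by (metis finite_Union)
    then show "group A \<and> finite (carrier A)" using is_group by simp
  qed
  let ?Z = "\<lparr>carrier = {0, 1}, monoid.mult = (\<lambda>x y. (x + y) mod 2), one = 0\<rparr> :: nat monoid"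
  have "group ?Z" by (rule groupI) (auto simp: mod_simps)
  then show "nontrivial_class finite_groups"
    unfolding nontrivial_class_def by (intro bexI[of _ ?Z]) (auto simp: finite_groups_def trivial_group_def)
qed

text \<open>\<open>N\<close> has finite index but need not be open for a given \<C>, so rotations
  are separated within the class of all finite groups. For \<open>h = a^m b^m\<close>, with
  \<open>m\<close> the index of \<open>N\<close>, only rotations by multiples of the length fix the
  word. An element commuting with \<open>h\<close> is then congruent modulo \<open>N\<close> to a
  power of \<open>h\<close>, and \<open>h \<in> N\<close>.\<close>

lemma free_group_centralizer:
  assumes F: "free_group F X" and ab: "a \<in> X" "b \<in> X" "a \<noteq> b"
    and N: "N \<lhd> F" "finite (rcosets\<^bsub>F\<^esub> N)"
  shows "\<exists>h\<in>N. \<forall>f\<in>carrier F. f \<otimes>\<^bsub>F\<^esub> h = h \<otimes>\<^bsub>F\<^esub> f \<longrightarrow> f \<in> N"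
proof -
  interpret free_group F X by fact
  interpret pseudovariety finite_groups by (rule pseudovariety_finite_groups)
  interpret N: normal N F by fact
  define m where "m = card (rcosets\<^bsub>F\<^esub> N)"
  have abc: "a \<in> carrier F" "b \<in> carrier F" using ab basis_carrier by auto
  note m = N.pow_index_mem[OF N(2), folded m_def]
  have m0: "m > 0" by (rule m(2)[OF abc(1)])
  define x where "x = replicate m (a, True) @ replicate m (b, True)"
  have len: "length x = 2 * m" by (simp add: x_def)
  have nth: "x ! i = (if i < m then (a, True) else (b, True))" if "i < 2 * m" for i
    using that by (auto simp: x_def nth_append)
  have rep: "word_val F (replicate k (c, True)) = c [^]\<^bsub>F\<^esub> k" if "c \<in> carrier F" for c and k :: nat
    by (induction k) (simp_all add: nat_pow_Suc2[OF that, symmetric] letter_val_def del: nat_pow_Suc)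
  have replw: "replicate k (c, True) \<in> words_over X" if "c \<in> X" for c and k :: nat
    using that by (simp add: words_over_iff)
  have xv: "word_val F x = a [^]\<^bsub>F\<^esub> m \<otimes>\<^bsub>F\<^esub> b [^]\<^bsub>F\<^esub> m"
    unfolding x_def using abc ab replw words_over_carrier by (simp add: rep)
  have xN: "word_val F x \<in> N" unfolding xv using m(1) abc by blast
  have xw: "x \<in> words_over {a, b}" by (auto simp: x_def words_over_iff)
  have x0: "x \<noteq> []" using m0 by (simp add: x_def)
  have xX: "x \<in> words_over X" using xw ab words_over_mono by blast
  have cyc: "cyclically_reduced x"
    unfolding cyclically_reduced_def len
  proof (intro conjI allI x0)
    fix i
    have "Suc i mod (2 * m) < 2 * m" "i mod (2 * m) < 2 * m" using m0 by simp_all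
    then show "x ! (Suc i mod (2 * m)) \<noteq> inv_letter (x ! (i mod (2 * m)))"
      by (simp add: nth inv_letter_def)
  qed
  have "in_class finite_groups (F Mod N)"
    unfolding in_class_finite_groups using N N.factorgroup_is_group by (simp add: FactGroup_def)
  then have oN: "open_normal finite_groups F N" using N(1) by (simp add: open_normal_def)
  obtain L where L: "open_normal finite_groups F L" 
    "\<And>g. g \<in> carrier F \<Longrightarrow>
       g \<otimes>\<^bsub>F\<^esub> word_val F x \<otimes>\<^bsub>F\<^esub> inv\<^bsub>F\<^esub> g \<otimes>\<^bsub>F\<^esub> inv\<^bsub>F\<^esub> (word_val F x) \<in> L \<Longrightarrow>
       \<exists>i. inv\<^bsub>F\<^esub> (prefix_val x i) \<otimes>\<^bsub>F\<^esub> inv\<^bsub>F\<^esub> g \<in> N \<and> cyclic_subword x i (length x) = x"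
    using open_normal_separates_rotations[OF F oN _ _ xw cyc xw cyc] ab by (metis empty_subsetI finite.emptyI finite_insert insert_subset)
  interpret L: normal L F using L(1) by (simp add: open_normal_def)
  have xc: "word_val F x \<in> carrier F" using xN by simp
  have "f \<in> N" if f: "f \<in> carrier F" "f \<otimes>\<^bsub>F\<^esub> word_val F x = word_val F x \<otimes>\<^bsub>F\<^esub> f" for f
  proof -
    have "f \<otimes>\<^bsub>F\<^esub> word_val F x \<otimes>\<^bsub>F\<^esub> inv\<^bsub>F\<^esub> f \<otimes>\<^bsub>F\<^esub> inv\<^bsub>F\<^esub> (word_val F x) = \<one>\<^bsub>F\<^esub>"
      unfolding f(2) using f(1) xc by (simp add: group_norm)
    then obtain i where i: "inv\<^bsub>F\<^esub> (prefix_val x i) \<otimes>\<^bsub>F\<^esub> inv\<^bsub>F\<^esub> f \<in> N" "cyclic_subword x i (length x) = x"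
      using L(2)[OF f(1)] L.one_closed by auto
    let ?j = "i mod (2 * m)"
    have j: "?j < 2 * m" using m0 by simp
    \<comment> \<open>A rotation that fixes \<open>x\<close> starts with \<open>a\<close>, so it
      starts inside the block of \<open>a\<close>. It also ends with \<open>b\<close>, whereas the
      letter before position \<open>?j\<close> is an \<open>a\<close> unless
      \<open>?j = 0\<close>.\<close>
    have "x ! ?j = x ! 0" using i(2) nth_cyclic_subword[of 0 "length x" x i] m0 by (simp add: len)
    then have jm: "?j < m" using nth[OF j] nth[of 0] m0 ab(3) by (auto split: if_splits)
    have "?j = 0"
    proof (rule ccontr)
      assume "?j \<noteq> 0"
      have "x ! ((i + (2 * m - 1)) mod (2 * m)) = x ! (2 * m - 1)"
        using i(2) nth_cyclic_subword[of "2 * m - 1" "length x" x i] m0 by (simp add: len)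
      moreover have "(i + (2 * m - 1)) mod (2 * m) = ?j - 1"
      proof -
        have "(i + (2 * m - 1)) mod (2 * m) = (?j + (2 * m - 1)) mod (2 * m)" by (simp add: mod_add_left_eq)
        also have "?j + (2 * m - 1) = (?j - 1) + 2 * m" using \<open>?j \<noteq> 0\<close> m0 by simp
        also have "((?j - 1) + 2 * m) mod (2 * m) = ?j - 1" using j by simp
        finally show ?thesis .
      qed
      ultimately show False using nth[of "?j - 1"] nth[of "2 * m - 1"] jm m0 ab(3) by (auto split: if_splits)
    qed
    then have "i = (i div (2 * m)) * length x" using len by (metis add.right_neutral div_mult_mod_eq)
    then have "prefix_val x i = word_val F x [^]\<^bsub>F\<^esub> (i div (2 * m))" using prefix_val_period[OF xX x0] by metis
    then have pN: "prefix_val x i \<in> N" using subgroup_int_pow_closed[OF N.subgroup_axioms xN, of "int (i div (2 * m))"] by (simp add: int_pow_int)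
    have "inv\<^bsub>F\<^esub> (prefix_val x i \<otimes>\<^bsub>F\<^esub> (inv\<^bsub>F\<^esub> (prefix_val x i) \<otimes>\<^bsub>F\<^esub> inv\<^bsub>F\<^esub> f)) \<in> N"
      by (rule N.m_inv_closed[OF N.m_closed[OF pN i(1)]])
    moreover have "inv\<^bsub>F\<^esub> (prefix_val x i \<otimes>\<^bsub>F\<^esub> (inv\<^bsub>F\<^esub> (prefix_val x i) \<otimes>\<^bsub>F\<^esub> inv\<^bsub>F\<^esub> f)) = f"
      using prefix_val_closed[OF xX x0, of i] f(1) by (simp add: inv_m_cancel)
    ultimately show "f \<in> N" by (simp only:)
  qed
  then show ?thesis using xN by blast
qed

lemma is_free_group_nonabelian:
  assumes "is_free_group F" "\<not> comm_group F"
  obtains X a b where "free_group F X" "a \<in> X" "b \<in> X" "a \<noteq> b"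
proof -
  obtain X where X: "group F" "free_basis F X" using assms(1) by (auto simp: is_free_group_def)
  then have F: "free_group F X" by (simp add: free_group_def free_group_axioms_def)
  interpret free_group F X by (rule F)
  have "\<exists>a b. a \<in> X \<and> b \<in> X \<and> a \<noteq> b"
  proof (rule ccontr)
    assume no: "\<not> ?thesis"
    obtain a where a: "a \<in> carrier F" "X \<subseteq> {a}"
    proof (cases "X = {}")
      case True
      then show ?thesis using that[of "\<one>\<^bsub>F\<^esub>"] by simp
    next
      case False
      then obtain a where "a \<in> X" by blast
      then show ?thesis using that[of a] no basis_carrier by blast
    qed
    have "\<exists>n::int. word_val F w = a [^]\<^bsub>F\<^esub> n" if "w \<in> words_over X" for w
      using that
    proof (induction w)
      case Nil
      have "word_val F [] = a [^]\<^bsub>F\<^esub> (0::int)" by simp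
      then show ?case by blast
    next
      case (Cons l w)
      then obtain n :: int where n: "word_val F w = a [^]\<^bsub>F\<^esub> n" by auto
      have "fst l = a" using Cons.prems a by auto
      then have "letter_val F l = a [^]\<^bsub>F\<^esub> (if snd l then 1 else -1 :: int)"
        using a(1) by (simp add: letter_val_def int_pow_neg)
      then have "word_val F (l # w) = a [^]\<^bsub>F\<^esub> ((if snd l then 1 else -1 :: int) + n)"
        using n a(1) by (simp only: word_val_Cons int_pow_mult)
      then show ?case by blast
    qed
    then have p: "\<exists>n::int. g = a [^]\<^bsub>F\<^esub> n" if "g \<in> carrier F" for g
      using normal_form(1,3)[OF that] by metis
    have "comm_group F"
    proof (rule group_comm_groupI)
      fix g h assume "g \<in> carrier F" "h \<in> carrier F"
      then obtain i j :: int where "g = a [^]\<^bsub>F\<^esub> i" "h = a [^]\<^bsub>F\<^esub> j" using p by metis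
      then show "g \<otimes>\<^bsub>F\<^esub> h = h \<otimes>\<^bsub>F\<^esub> g" using a(1) by (simp add: add.commute flip: int_pow_mult)
    qed
    then show False using assms(2) by simp
  qed
  then show ?thesis using that[OF F] by blast
qed

section \<open>Subgroups of infinite index and finite conjugacy classes\<close>

context group
begin

lemma finite_rcosets_if_covered:
  assumes "subgroup H G" "finite T" "T \<subseteq> carrier G" "\<And>x. x \<in> carrier G \<Longrightarrow> \<exists>t\<in>T. x \<otimes> inv t \<in> H"
  shows "finite (rcosets H)"
proof -
  have "rcosets H \<subseteq> (\<lambda>t. H #> t) ` T"
  proof
    fix c assume "c \<in> rcosets H"
    then obtain x where x: "x \<in> carrier G" "c = H #> x" by (auto simp: RCOSETS_def)
    then obtain t where "t \<in> T" "x \<otimes> inv t \<in> H" using assms(4) by blast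
    then show "c \<in> (\<lambda>t. H #> t) ` T" using rcos_eq_iff[OF assms(1) x(1)] x(2) assms(3) by blast
  qed
  then show ?thesis using assms(2) finite_surj by blast
qed

lemma Neumann_finite_index:
  assumes "finite \<H>" "\<And>H. H \<in> \<H> \<Longrightarrow> subgroup H G" "\<And>H. H \<in> \<H> \<Longrightarrow> finite (T H)"
    "\<And>H. H \<in> \<H> \<Longrightarrow> T H \<subseteq> carrier G"
    "\<And>x. x \<in> carrier G \<Longrightarrow> \<exists>H\<in>\<H>. \<exists>t\<in>T H. x \<otimes> inv t \<in> H"
  shows "\<exists>H\<in>\<H>. finite (rcosets H)"
  using assms
proof (induction \<H> arbitrary: T rule: finite_induct)
  case empty
  then show ?case using one_closed by blast
next
  case (insert H \<H>)
  have H: "subgroup H G" using insert.prems(1) by blast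
  interpret H: subgroup H G by (rule H)
  show ?case
  proof (cases "\<forall>x\<in>carrier G. \<exists>t\<in>T H. x \<otimes> inv t \<in> H")
    case True
    then have "finite (rcosets H)"
      by (intro finite_rcosets_if_covered[OF H, of "T H"]) (use insert.prems in auto)
    then show ?thesis by blast
  next
    case False
    then obtain c where c: "c \<in> carrier G" "\<And>t. t \<in> T H \<Longrightarrow> c \<otimes> inv t \<notin> H" by blast
    \<comment> \<open>If \<open>H c\<close> is covered by cosets \<open>K s\<close>, then
      \<open>H t = H c (c^-1 t)\<close> is covered by the cosets
      \<open>K (s c^-1 t)\<close>.\<close>
    define T' where "T' K = T K \<union> (\<Union>t\<in>T H. (\<lambda>s. s \<otimes> inv c \<otimes> t) ` T K)" for K
    have tc: "t \<in> carrier G" if "t \<in> T K" "K \<in> insert H \<H>" for t K using insert.prems(3) that by blast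
    have "\<exists>K\<in>\<H>. finite (rcosets K)"
    proof (rule insert.IH[of T'])
      show "subgroup K G" if "K \<in> \<H>" for K using insert.prems(1) that by blast
      show "finite (T' K)" if "K \<in> \<H>" for K using insert.prems(2) that by (auto simp: T'_def)
      show "T' K \<subseteq> carrier G" if "K \<in> \<H>" for K using tc that c(1) by (auto simp: T'_def)
      fix x assume x: "x \<in> carrier G"
      obtain K t where K: "K \<in> insert H \<H>" "t \<in> T K" "x \<otimes> inv t \<in> K" using insert.prems(4)[OF x] by blast
      show "\<exists>K\<in>\<H>. \<exists>t\<in>T' K. x \<otimes> inv t \<in> K"
      proof (cases "K \<in> \<H>")
        case True
        then show ?thesis using K by (auto simp: T'_def)
      next
        case False
        then have KH: "t \<in> T H" "x \<otimes> inv t \<in> H" using K by auto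
        have t: "t \<in> carrier G" using tc KH by blast
        let ?y = "x \<otimes> inv t \<otimes> c"
        have y: "?y \<in> carrier G" using x t c by simp
        obtain K' s where K': "K' \<in> insert H \<H>" "s \<in> T K'" "?y \<otimes> inv s \<in> K'" using insert.prems(4)[OF y] by blast
        have s: "s \<in> carrier G" using tc K' by blast
        have "K' \<noteq> H"
        proof
          assume e: "K' = H"
          have "inv (x \<otimes> inv t) \<otimes> (?y \<otimes> inv s) \<in> H"
            using K'(3) e by (intro H.m_closed[OF H.m_inv_closed[OF KH(2)]]) simp
          moreover have "inv (x \<otimes> inv t) \<otimes> (?y \<otimes> inv s) = c \<otimes> inv s" using x t c s by (simp add: group_norm)
          ultimately show False using c(2) K'(2) e by simp
        qed
        then have "K' \<in> \<H>" using K'(1) by blast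
        moreover have "s \<otimes> inv c \<otimes> t \<in> T' K'" using K'(2) KH(1) by (auto simp: T'_def)
        moreover have "x \<otimes> inv (s \<otimes> inv c \<otimes> t) = ?y \<otimes> inv s" using x t c s by (simp add: group_norm)
        ultimately show ?thesis using K'(3) by metis
      qed
    qed
    then show ?thesis by blast
  qed
qed

text \<open>If the cosets covered \<open>N\<close>, their translates by representatives of the
  finitely many cosets of \<open>N\<close> would cover the group, and Neumann's theorem would give
  one of the subgroups finite index.\<close>

lemma avoid_cosets_infinite_index:
  assumes N: "subgroup N G" "finite (rcosets N)"
    and I: "finite I" "\<And>i. i \<in> I \<Longrightarrow> subgroup (H i) G" "\<And>i. i \<in> I \<Longrightarrow> t i \<in> carrier G"
      "\<And>i. i \<in> I \<Longrightarrow> infinite (rcosets (H i))"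
  shows "\<exists>w\<in>N. \<forall>i\<in>I. w \<otimes> inv (t i) \<notin> H i"
proof (rule ccontr)
  assume contr: "\<not> ?thesis"
  interpret N: subgroup N G by (rule N(1))
  define rep where "rep c = (SOME g. g \<in> c)" for c :: "'a set"
  have rep: "rep c \<in> c" if "c \<in> rcosets N" for c
    using N.rcosets_non_empty[OF that] by (simp add: rep_def some_in_eq)
  have rep_carrier: "rep c \<in> carrier G" if "c \<in> rcosets N" for c
    using rep[OF that] that N.rcosets_carrier[OF is_group] by blast
  define T where "T K = (\<lambda>(i, c). t i \<otimes> rep c) ` ({i \<in> I. H i = K} \<times> (rcosets N))" for K
  have "\<exists>K\<in>H ` I. finite (rcosets K)"
  proof (rule Neumann_finite_index[of _ T])
    show "finite (H ` I)" using I(1) by simp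
    show "subgroup K G" if "K \<in> H ` I" for K using I(2) that by blast
    show "finite (T K)" for K using I(1) N(2) by (simp add: T_def)
    show "T K \<subseteq> carrier G" for K using I(3) rep_carrier by (auto simp: T_def)
    fix x assume x: "x \<in> carrier G"
    have c: "N #> x \<in> rcosets N" using x by (rule rcosetsI[OF N.subset])
    obtain n where n: "n \<in> N" "rep (N #> x) = n \<otimes> x" using rep[OF c] by (auto simp: r_coset_def)
    obtain i where i: "i \<in> I" "inv n \<otimes> inv (t i) \<in> H i" using contr N.m_inv_closed[OF n(1)] by blast
    have "t i \<otimes> rep (N #> x) \<in> T (H i)" using i(1) c by (auto simp: T_def)
    moreover have "x \<otimes> inv (t i \<otimes> rep (N #> x)) = inv n \<otimes> inv (t i)"
      unfolding n(2) using x n(1) I(3)[OF i(1)] by (simp add: group_norm)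
    ultimately show "\<exists>K\<in>H ` I. \<exists>s\<in>T K. x \<otimes> inv s \<in> K" using i by (metis imageI)
  qed
  then show False using I(4) by blast
qed

section \<open>Centralizers and finite conjugacy classes\<close>

definition centralizer_of :: "'a \<Rightarrow> 'a set" where
  "centralizer_of t = {g \<in> carrier G. g \<otimes> t = t \<otimes> g}"

lemma subgroup_centralizer_of:
  assumes t: "t \<in> carrier G"
  shows "subgroup (centralizer_of t) G"
proof (rule subgroupI)
  show "centralizer_of t \<subseteq> carrier G" by (auto simp: centralizer_of_def)
  have "\<one> \<in> centralizer_of t" using t by (simp add: centralizer_of_def)
  then show "centralizer_of t \<noteq> {}" by blast
next
  fix a assume "a \<in> centralizer_of t"
  then have a: "a \<in> carrier G" "a \<otimes> t = t \<otimes> a" by (simp_all add: centralizer_of_def)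
  have "inv a \<otimes> t = inv a \<otimes> (t \<otimes> a) \<otimes> inv a" using a(1) t by (simp add: group_norm)
  also have "\<dots> = t \<otimes> inv a" unfolding a(2)[symmetric] using a(1) t by (simp add: group_norm)
  finally show "inv a \<in> centralizer_of t" using a(1) by (simp add: centralizer_of_def)
next
  fix a b assume "a \<in> centralizer_of t" "b \<in> centralizer_of t"
  then have a: "a \<in> carrier G" "a \<otimes> t = t \<otimes> a" and b: "b \<in> carrier G" "b \<otimes> t = t \<otimes> b"
    by (simp_all add: centralizer_of_def)
  have "a \<otimes> b \<otimes> t = a \<otimes> t \<otimes> b" using a(1) b t by (simp add: m_assoc)
  also have "\<dots> = t \<otimes> (a \<otimes> b)" unfolding a(2) using a(1) b(1) t by (simp add: m_assoc)
  finally show "a \<otimes> b \<in> centralizer_of t" using a(1) b(1) by (simp add: centralizer_of_def)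
qed

definition list_product :: "'a list \<Rightarrow> 'a" where
  "list_product xs = foldr (\<otimes>) xs \<one>"

lemma list_product_simps [simp]: "list_product [] = \<one>" "list_product (x # xs) = x \<otimes> list_product xs"
  by (simp_all add: list_product_def)

lemma list_product_closed [simp]: "set xs \<subseteq> carrier G \<Longrightarrow> list_product xs \<in> carrier G"
  by (induction xs) auto

lemma list_product_append:
  "set xs \<subseteq> carrier G \<Longrightarrow> set ys \<subseteq> carrier G \<Longrightarrow> list_product (xs @ ys) = list_product xs \<otimes> list_product ys"
  by (induction xs) (auto simp: m_assoc)

text \<open>By \<open>y s = s (s^-1 y s)\<close> an occurrence of \<open>s\<close> moves to the
  front at the price of conjugating the entries that it passes. A conjugate \<open>s^-1 y s\<close>
  with \<open>y \<noteq> s\<close> is not \<open>s\<close>, so the other occurrences of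
  \<open>s\<close> keep their number.\<close>

lemma list_product_move:
  assumes S: "S \<subseteq> carrier G" "\<And>s t. s \<in> S \<Longrightarrow> t \<in> S \<Longrightarrow> inv s \<otimes> t \<otimes> s \<in> S"
  shows "set xs \<subseteq> S \<Longrightarrow> count_list xs s = Suc c \<Longrightarrow>
    \<exists>ys. set ys \<subseteq> S \<and> length xs = Suc (length ys) \<and> list_product xs = s \<otimes> list_product ys \<and> count_list ys s = c"
proof (induction xs)
  case (Cons y zs)
  show ?case
  proof (cases "y = s")
    case True
    then show ?thesis using Cons.prems by (intro exI[of _ zs]) simp
  next
    case False
    then obtain ys where ys: "set ys \<subseteq> S" "length zs = Suc (length ys)" "list_product zs = s \<otimes> list_product ys"
      "count_list ys s = c"
      using Cons by auto
    have "s \<in> set zs" using Cons.prems(2) False by (metis count_list.simps(2) count_notin nat.distinct(1))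
    then have s: "s \<in> S" "y \<in> S" "s \<in> carrier G" "y \<in> carrier G" using Cons.prems(1) S(1) by auto
    have yc: "set ys \<subseteq> carrier G" using ys(1) S(1) by blast
    have ne: "inv s \<otimes> y \<otimes> s \<noteq> s"
    proof
      assume e: "inv s \<otimes> y \<otimes> s = s"
      have "y = s \<otimes> (inv s \<otimes> y \<otimes> s) \<otimes> inv s" using s by (simp add: group_norm)
      also have "\<dots> = s" unfolding e using s by (simp add: group_norm)
      finally show False using False by simp
    qed
    have "list_product (y # zs) = s \<otimes> list_product ((inv s \<otimes> y \<otimes> s) # ys)"
      using ys(3) s yc by (simp add: group_norm)
    then show ?thesis using ys ne S(2)[OF s(1,2)]
      by (intro exI[of _ "(inv s \<otimes> y \<otimes> s) # ys"]) simp
  qed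
qed simp

lemma list_product_move_pow:
  assumes S: "S \<subseteq> carrier G" "\<And>s t. s \<in> S \<Longrightarrow> t \<in> S \<Longrightarrow> inv s \<otimes> t \<otimes> s \<in> S" and s: "s \<in> S"
  shows "set xs \<subseteq> S \<Longrightarrow> d \<le> count_list xs s \<Longrightarrow>
    \<exists>ys. set ys \<subseteq> S \<and> length xs = d + length ys \<and> list_product xs = s [^] d \<otimes> list_product ys"
proof (induction d arbitrary: xs)
  case 0
  then have "set xs \<subseteq> carrier G" using S(1) by blast
  then show ?case using 0 by (intro exI[of _ xs]) simp
next
  case (Suc d)
  then obtain c where c: "count_list xs s = Suc c" "d \<le> c" by (metis Suc_le_D Suc_le_mono)
  obtain ys where ys: "set ys \<subseteq> S" "length xs = Suc (length ys)" "list_product xs = s \<otimes> list_product ys"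
    "count_list ys s = c"
    using list_product_move[OF S Suc.prems(1) c(1)] by blast
  obtain zs where zs: "set zs \<subseteq> S" "length ys = d + length zs" "list_product ys = s [^] d \<otimes> list_product zs"
    using Suc.IH[OF ys(1)] c(2) ys(4) by blast
  have sc: "s \<in> carrier G" "set zs \<subseteq> carrier G" using s zs(1) S(1) by auto
  have "list_product xs = s [^] Suc d \<otimes> list_product zs"
    unfolding ys(3) zs(3) nat_pow_Suc2[OF sc(1)] using sc by (simp only: m_assoc nat_pow_closed list_product_closed)
  then show ?case using ys(2) zs(1,2) by (intro exI[of _ zs]) simp
qed

text \<open>Dietzmann's lemma\<close>

lemma finite_normal_closure:
  assumes "finite S" "S \<subseteq> carrier G" and inv: "\<And>s. s \<in> S \<Longrightarrow> inv s \<in> S"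
    and conj: "\<And>g s. g \<in> carrier G \<Longrightarrow> s \<in> S \<Longrightarrow> inv g \<otimes> s \<otimes> g \<in> S"
    and torsion: "d > (0::nat)" "\<And>s. s \<in> S \<Longrightarrow> s [^] d = \<one>"
  shows "\<exists>N. N \<lhd> G \<and> finite N \<and> S \<subseteq> N"
proof -
  have conj': "\<And>s t. s \<in> S \<Longrightarrow> t \<in> S \<Longrightarrow> inv s \<otimes> t \<otimes> s \<in> S" using conj assms(2) by blast
  define N where "N = list_product ` lists S"
  \<comment> \<open>Collected at the front, \<open>d\<close> occurrences of the same
    \<open>s\<close> disappear by \<open>s^d = 1\<close>. When this is no longer possible, each
    \<open>s\<close> occurs fewer than \<open>d\<close> times, which bounds the length.\<close>
  have short: "\<exists>ys\<in>lists S. length ys \<le> card S * d \<and> list_product ys = list_product xs" if "xs \<in> lists S" for xs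
    using that
  proof (induction "length xs" arbitrary: xs rule: less_induct)
    case less
    have xs: "set xs \<subseteq> S" using less.prems by auto
    show ?case
    proof (cases "\<exists>s\<in>S. d \<le> count_list xs s")
      case True
      then obtain s where s: "s \<in> S" "d \<le> count_list xs s" by blast
      obtain ys where ys: "set ys \<subseteq> S" "length xs = d + length ys" "list_product xs = s [^] d \<otimes> list_product ys"
        using list_product_move_pow[OF assms(2) conj' s(1) xs s(2)] by blast
      have "set ys \<subseteq> carrier G" using ys(1) assms(2) by blast
      then have "list_product xs = list_product ys" using ys(3) torsion(2)[OF s(1)] by simp
      then show ?thesis using less.hyps[of ys] ys torsion(1) by (auto simp: lists_eq_set)
    next
      case False
      have "length xs = (\<Sum>s\<in>set xs. count_list xs s)" by (rule sum_count_set[symmetric]) auto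
      also have "\<dots> \<le> (\<Sum>s\<in>set xs. d)" using False xs by (intro sum_mono) (meson linear subsetD)
      also have "\<dots> \<le> card S * d" using card_mono[OF assms(1) xs] by simp
      finally show ?thesis using less.prems by blast
    qed
  qed
  have "N \<subseteq> list_product ` {ys. set ys \<subseteq> S \<and> length ys \<le> card S * d}"
  proof
    fix x assume "x \<in> N"
    then obtain xs where "xs \<in> lists S" "x = list_product xs" by (auto simp: N_def)
    moreover obtain ys where "ys \<in> lists S" "length ys \<le> card S * d" "list_product ys = list_product xs"
      using short[OF calculation(1)] by blast
    ultimately show "x \<in> list_product ` {ys. set ys \<subseteq> S \<and> length ys \<le> card S * d}"
      by (intro image_eqI[of _ _ ys]) (simp_all add: lists_eq_set)
  qed
  then have "finite N" using finite_lists_length_le[OF assms(1)] finite_surj by blast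
  moreover have "S \<subseteq> N"
  proof
    fix s assume s: "s \<in> S"
    then have "list_product [s] = s" using assms(2) by auto
    moreover have "[s] \<in> lists S" using s by simp
    ultimately show "s \<in> N" unfolding N_def by (metis imageI)
  qed
  moreover have "N \<lhd> G"
    unfolding normal_inv_iff
  proof (intro conjI ballI subgroupI)
    show "N \<subseteq> carrier G" using assms(2) by (auto simp: N_def lists_eq_set)
    show "N \<noteq> {}" by (auto simp: N_def)
  next
    fix a assume "a \<in> N"
    then obtain xs where xs: "xs \<in> lists S" "a = list_product xs" by (auto simp: N_def)
    have "\<exists>ys\<in>lists S. list_product ys = inv (list_product xs)" using xs(1)
    proof (induction xs)
      case (Cons x xs)
      then obtain ys where ys: "ys \<in> lists S" "list_product ys = inv (list_product xs)" by auto
      have c: "x \<in> carrier G" "set xs \<subseteq> carrier G" "set ys \<subseteq> carrier G" "inv x \<in> S"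
        using Cons.hyps ys(1) assms(2) inv by (auto simp: lists_eq_set)
      have "list_product (ys @ [inv x]) = inv (list_product (x # xs))"
        using c ys(2) by (simp add: list_product_append inv_mult_group)
      then show ?case using ys(1) c(4) by (intro bexI[of _ "ys @ [inv x]"]) auto
    qed (auto intro!: bexI[of _ "[]"])
    then show "inv a \<in> N" unfolding xs(2) N_def by (metis imageI)
  next
    fix a b assume "a \<in> N" "b \<in> N"
    then obtain xs ys where xy: "xs \<in> lists S" "a = list_product xs" "ys \<in> lists S" "b = list_product ys"
      by (auto simp: N_def)
    have "set xs \<subseteq> carrier G" "set ys \<subseteq> carrier G" using xy(1,3) assms(2) by (auto simp: lists_eq_set)
    then have "list_product (xs @ ys) = a \<otimes> b" using xy by (simp add: list_product_append)
    moreover have "xs @ ys \<in> lists S" using xy by simp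
    ultimately show "a \<otimes> b \<in> N" unfolding N_def by (metis imageI)
  next
    fix g a assume g: "g \<in> carrier G" and "a \<in> N"
    then obtain xs where xs: "xs \<in> lists S" "a = list_product xs" by (auto simp: N_def)
    have "\<exists>ys\<in>lists S. list_product ys = g \<otimes> list_product xs \<otimes> inv g" using xs(1)
    proof (induction xs)
      case (Cons x xs)
      then obtain ys where ys: "ys \<in> lists S" "list_product ys = g \<otimes> list_product xs \<otimes> inv g" by auto
      have c: "x \<in> carrier G" "set xs \<subseteq> carrier G" "g \<otimes> x \<otimes> inv g \<in> S"
        using Cons.hyps assms(2) conj[of "inv g" x] g by (auto simp: lists_eq_set)
      have "list_product ((g \<otimes> x \<otimes> inv g) # ys) = g \<otimes> list_product (x # xs) \<otimes> inv g"
        using c g ys(2) by (simp add: group_norm)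
      then show ?case using ys(1) c(3) by (intro bexI[of _ "(g \<otimes> x \<otimes> inv g) # ys"]) auto
    qed (use g in \<open>auto intro!: bexI[of _ "[]"]\<close>)
    then show "g \<otimes> a \<otimes> inv g \<in> N" unfolding xs(2) N_def by (metis imageI)
  qed
  ultimately show ?thesis by blast
qed

text \<open>The conjugates of \<open>t\<close> are parametrised by the cosets of its centralizer, so
  there are finitely many. Together with their inverses they satisfy the hypotheses of Dietzmann's
  lemma.\<close>

lemma finite_normal_subgroup_torsion:
  assumes t: "t \<in> carrier G" and d: "d > (0::nat)" "t [^] d = \<one>"
    and fin: "finite (rcosets (centralizer_of t))"
  shows "\<exists>N. N \<lhd> G \<and> finite N \<and> t \<in> N"
proof -
  let ?C = "centralizer_of t"
  interpret C: subgroup ?C G by (rule subgroup_centralizer_of[OF t])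
  define rep where "rep c = (SOME g. g \<in> c)" for c :: "'a set"
  have rep: "rep c \<in> c" if "c \<in> rcosets ?C" for c
    using C.rcosets_non_empty[OF that] by (simp add: rep_def some_in_eq)
  define S1 where "S1 = (\<lambda>g. inv g \<otimes> t \<otimes> g) ` carrier G"
  have "S1 \<subseteq> (\<lambda>c. inv (rep c) \<otimes> t \<otimes> rep c) ` (rcosets ?C)"
  proof
    fix x assume "x \<in> S1"
    then obtain g where g: "g \<in> carrier G" "x = inv g \<otimes> t \<otimes> g" by (auto simp: S1_def)
    have c: "?C #> g \<in> rcosets ?C" using g(1) by (rule rcosetsI[OF C.subset])
    obtain k where k: "k \<in> ?C" "rep (?C #> g) = k \<otimes> g" using rep[OF c] by (auto simp: r_coset_def)
    have kc: "k \<in> carrier G" "k \<otimes> t = t \<otimes> k" using k(1) unfolding centralizer_of_def by auto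
    have "inv (k \<otimes> g) \<otimes> t \<otimes> (k \<otimes> g) = inv g \<otimes> (inv k \<otimes> (t \<otimes> k)) \<otimes> g"
      using kc(1) g(1) t by (simp add: group_norm)
    also have "\<dots> = x" unfolding kc(2)[symmetric] g(2) using kc(1) g(1) t by (simp add: group_norm)
    finally show "x \<in> (\<lambda>c. inv (rep c) \<otimes> t \<otimes> rep c) ` (rcosets ?C)"
      using c k(2) by (intro image_eqI[of _ _ "?C #> g"]) simp_all
  qed
  then have fin1: "finite S1" using fin finite_surj by blast
  have pw: "(inv g \<otimes> t \<otimes> g) [^] n = inv g \<otimes> t [^] n \<otimes> g" if "g \<in> carrier G" for g and n :: nat
    by (induction n) (use that t in \<open>simp_all add: group_norm\<close>)
  have "\<exists>N. N \<lhd> G \<and> finite N \<and> S1 \<union> m_inv G ` S1 \<subseteq> N"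
  proof (rule finite_normal_closure[OF _ _ _ _ d(1)])
    show "finite (S1 \<union> m_inv G ` S1)" using fin1 by simp
    show "S1 \<union> m_inv G ` S1 \<subseteq> carrier G" using t by (auto simp: S1_def)
    show "inv s \<in> S1 \<union> m_inv G ` S1" if "s \<in> S1 \<union> m_inv G ` S1" for s
      using that t by (auto simp: S1_def)
    have cj: "inv g \<otimes> s \<otimes> g \<in> S1" if g: "g \<in> carrier G" and s: "s \<in> S1" for g s
    proof -
      obtain h where h: "h \<in> carrier G" "s = inv h \<otimes> t \<otimes> h" using s by (auto simp: S1_def)
      then have "inv g \<otimes> s \<otimes> g = inv (h \<otimes> g) \<otimes> t \<otimes> (h \<otimes> g)" using g t by (simp add: group_norm)
      then show ?thesis using h(1) g by (auto simp: S1_def)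
    qed
    show "inv g \<otimes> s \<otimes> g \<in> S1 \<union> m_inv G ` S1" if g: "g \<in> carrier G" and s: "s \<in> S1 \<union> m_inv G ` S1" for g s
    proof (cases "s \<in> S1")
      case True
      then show ?thesis using cj[OF g] by blast
    next
      case False
      then obtain u where u: "u \<in> S1" "s = inv u" using s by blast
      have "u \<in> carrier G" using u(1) t by (auto simp: S1_def)
      then have "inv g \<otimes> s \<otimes> g = inv (inv g \<otimes> u \<otimes> g)" using u(2) g by (simp add: group_norm)
      then show ?thesis using cj[OF g u(1)] by blast
    qed
    show "s [^] d = \<one>" if s: "s \<in> S1 \<union> m_inv G ` S1" for s
    proof -
      have 1: "u [^] d = \<one>" "u \<in> carrier G" if "u \<in> S1" for u
        using that pw[of _ d] d(2) t by (auto simp: S1_def)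
      show ?thesis
      proof (cases "s \<in> S1")
        case True
        then show ?thesis by (rule 1(1))
      next
        case False
        then obtain u where u: "u \<in> S1" "s = inv u" using s by blast
        then show ?thesis using 1[OF u(1)] nat_pow_inv[of u d] by simp
      qed
    qed
  qed
  moreover have "t \<in> S1" unfolding S1_def using t by (intro image_eqI[OF _ one_closed]) simp
  ultimately show ?thesis by blast
qed

end

section \<open>Hyperbolic groups\<close>

locale hyperbolic = group G for G (structure) +
  fixes S :: "'a set" and \<delta> :: real
  assumes finite_S: "finite S" and S_carrier: "S \<subseteq> carrier G" and generate_S: "generate G S = carrier G"
    and \<delta>_nonneg: "\<delta> \<ge> 0"
    and hyp: "\<And>w x y z. w \<in> carrier G \<Longrightarrow> x \<in> carrier G \<Longrightarrow> y \<in> carrier G \<Longrightarrow> z \<in> carrier G \<Longrightarrow>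
      Gromov_product (word_metric G S) w x z \<ge>
        min (Gromov_product (word_metric G S) w x y) (Gromov_product (word_metric G S) w y z) - \<delta>"
begin

abbreviation len :: "'a \<Rightarrow> nat" where "len \<equiv> word_length G S"
abbreviation d :: "'a \<Rightarrow> 'a \<Rightarrow> real" where "d \<equiv> word_metric G S"
abbreviation gp :: "'a \<Rightarrow> 'a \<Rightarrow> 'a \<Rightarrow> real" where "gp \<equiv> Gromov_product (word_metric G S)"

lemma words_over_S: "w \<in> words_over S \<Longrightarrow> w \<in> words_over (carrier G)"
  using words_over_mono S_carrier by blast

lemma exists_word: "g \<in> carrier G \<Longrightarrow> \<exists>w\<in>words_over S. word_val G w = g"
  unfolding generate_S[symmetric]
proof (induction rule: generate.induct)
  case one
  show ?case by (intro bexI[of _ "[]"]) simp_all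
next
  case (incl h)
  then show ?case using S_carrier by (intro bexI[of _ "[(h, True)]"]) (auto simp: letter_val_def)
next
  case (inv h)
  then show ?case using S_carrier by (intro bexI[of _ "[(h, False)]"]) (auto simp: letter_val_def)
next
  case (eng h1 h2)
  then obtain u v where "u \<in> words_over S" "word_val G u = h1" "v \<in> words_over S" "word_val G v = h2" by blast
  then show ?case by (intro bexI[of _ "u @ v"]) (auto simp: words_over_S)
qed

lemma shortest_word:
  assumes "g \<in> carrier G"
  obtains w where "w \<in> words_over S" "length w = len g" "word_val G w = g"
proof -
  have "\<exists>n. \<exists>w\<in>words_over S. length w = n \<and> word_val G w = g" using exists_word[OF assms] by blast
  from LeastI_ex[OF this] that show ?thesis unfolding word_length_def by blast
qed

lemma len_word_val: "w \<in> words_over S \<Longrightarrow> len (word_val G w) \<le> length w"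
  unfolding word_length_def by (rule Least_le) blast

lemma len_one [simp]: "len \<one> = 0"
  using len_word_val[of "[]"] by simp

lemma len_eq_0: "g \<in> carrier G \<Longrightarrow> len g = 0 \<longleftrightarrow> g = \<one>"
  using shortest_word[of g] by (metis len_one length_0_conv word_val_Nil)

lemma len_mult: "g \<in> carrier G \<Longrightarrow> h \<in> carrier G \<Longrightarrow> len (g \<otimes> h) \<le> len g + len h"
proof -
  assume g: "g \<in> carrier G" and h: "h \<in> carrier G"
  obtain u where u: "u \<in> words_over S" "length u = len g" "word_val G u = g" by (rule shortest_word[OF g])
  obtain v where v: "v \<in> words_over S" "length v = len h" "word_val G v = h" by (rule shortest_word[OF h])
  show ?thesis using len_word_val[of "u @ v"] u v by (simp add: words_over_S)
qed

lemma len_inv [simp]: "g \<in> carrier G \<Longrightarrow> len (inv g) = len g"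
proof -
  have le: "len (inv g) \<le> len g" if g: "g \<in> carrier G" for g
  proof -
    obtain u where u: "u \<in> words_over S" "length u = len g" "word_val G u = g" by (rule shortest_word[OF g])
    show ?thesis using len_word_val[of "inv_word u"] u by (simp add: words_over_S)
  qed
  assume "g \<in> carrier G"
  then show ?thesis using le[of g] le[of "inv g"] by simp
qed

lemma len_split:
  assumes "g \<in> carrier G" "k \<le> len g"
  obtains u v where "u \<in> carrier G" "v \<in> carrier G" "g = u \<otimes> v" "len u = k" "len v = len g - k"
proof -
  obtain w where w: "w \<in> words_over S" "length w = len g" "word_val G w = g" by (rule shortest_word[OF assms(1)])
  let ?u = "take k w" and ?v = "drop k w"
  have uv: "?u \<in> words_over S" "?v \<in> words_over S" using w(1) words_over_append[of ?u ?v S] by simp_all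
  have g: "g = word_val G ?u \<otimes> word_val G ?v" using word_val_append[OF words_over_S[OF uv(1)] words_over_S[OF uv(2)]] w(3) by simp
  have c: "word_val G ?u \<in> carrier G" "word_val G ?v \<in> carrier G" using uv words_over_S by simp_all
  have "len (word_val G ?u) \<le> k" "len (word_val G ?v) \<le> len g - k"
    using len_word_val[OF uv(1)] len_word_val[OF uv(2)] w(2) assms(2) by simp_all
  moreover have "len g \<le> len (word_val G ?u) + len (word_val G ?v)" using len_mult[OF c] g by simp
  ultimately show ?thesis using that[OF c g] assms(2) by simp
qed

lemma finite_ball: "finite {g \<in> carrier G. len g \<le> n}"
proof -
  have "{g \<in> carrier G. len g \<le> n} \<subseteq> word_val G ` {w. set w \<subseteq> S \<times> UNIV \<and> length w \<le> n}"
  proof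
    fix g assume "g \<in> {g \<in> carrier G. len g \<le> n}"
    then have g: "g \<in> carrier G" "len g \<le> n" by simp_all
    obtain w where w: "w \<in> words_over S" "length w = len g" "word_val G w = g" by (rule shortest_word[OF g(1)])
    then show "g \<in> word_val G ` {w. set w \<subseteq> S \<times> UNIV \<and> length w \<le> n}"
      using g(2) by (intro image_eqI[of _ _ w]) (auto simp: words_over_def)
  qed
  moreover have "finite {w :: 'a word. set w \<subseteq> S \<times> UNIV \<and> length w \<le> n}"
    by (rule finite_lists_length_le) (simp add: finite_S)
  ultimately show ?thesis using finite_surj by blast
qed

lemma d_def: "d x y = len (inv x \<otimes> y)"
  by (simp add: word_metric_def)

lemma d_nonneg [simp]: "0 \<le> d x y"
  by (simp add: d_def)

lemma d_one: "x \<in> carrier G \<Longrightarrow> d \<one> x = len x"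
  by (simp add: d_def)

lemma d_commute: "x \<in> carrier G \<Longrightarrow> y \<in> carrier G \<Longrightarrow> d x y = d y x"
  using len_inv[of "inv x \<otimes> y"] by (simp add: d_def inv_mult_group)

lemma d_triangle: "x \<in> carrier G \<Longrightarrow> y \<in> carrier G \<Longrightarrow> z \<in> carrier G \<Longrightarrow> d x z \<le> d x y + d y z"
  using len_mult[of "inv x \<otimes> y" "inv y \<otimes> z"] by (simp add: d_def group_norm flip: of_nat_add)

lemma d_translate: "g \<in> carrier G \<Longrightarrow> x \<in> carrier G \<Longrightarrow> y \<in> carrier G \<Longrightarrow> d (g \<otimes> x) (g \<otimes> y) = d x y"
  by (simp add: d_def group_norm)

lemma d_mult: "x \<in> carrier G \<Longrightarrow> y \<in> carrier G \<Longrightarrow> d x (x \<otimes> y) = len y"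
  by (simp add: d_def group_norm)

lemma gp_translate:
  "g \<in> carrier G \<Longrightarrow> w \<in> carrier G \<Longrightarrow> x \<in> carrier G \<Longrightarrow> y \<in> carrier G \<Longrightarrow>
    gp (g \<otimes> w) (g \<otimes> x) (g \<otimes> y) = gp w x y"
  by (simp add: Gromov_product_def d_translate)

lemma gp_commute: "x \<in> carrier G \<Longrightarrow> y \<in> carrier G \<Longrightarrow> gp w x y = gp w y x"
  by (simp add: Gromov_product_def d_commute)

lemma gp_double: "2 * gp w x y = d w x + d w y - d x y"
  by (simp add: Gromov_product_def)

text \<open>Hyperbolicity written with distances: of the three sums obtained by pairing four points,
  the largest exceeds the second largest by at most 2\<delta>.\<close>

lemma four_point:
  assumes "w \<in> carrier G" "x \<in> carrier G" "y \<in> carrier G" "z \<in> carrier G"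
  shows "d x z + d w y \<le> max (d x y + d w z) (d y z + d w x) + 2 * \<delta>"
  using hyp[OF assms] gp_double[of w x z] gp_double[of w x y] gp_double[of w y z] by linarith

lemma gp_near:
  assumes "w \<in> carrier G" "x \<in> carrier G" "y \<in> carrier G"
  shows "gp w x y \<ge> d w x - d x y"
  using d_triangle[of w y x] d_commute[of x y] assms by (simp add: Gromov_product_def)

lemma gp_base:
  assumes "w \<in> carrier G" "w' \<in> carrier G" "x \<in> carrier G" "y \<in> carrier G"
  shows "gp w' x y \<le> gp w x y + d w w'"
  using d_triangle[of w' w x] d_triangle[of w' w y] d_commute[of w w'] assms
    gp_double[of w x y] gp_double[of w' x y] by linarith

lemma gp_move:
  assumes "w \<in> carrier G" "x \<in> carrier G" "x' \<in> carrier G" "y \<in> carrier G"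
  shows "gp w x' y \<le> gp w x y + d x x'"
  using d_triangle[of w x x'] d_triangle[of x x' y] assms
    gp_double[of w x y] gp_double[of w x' y] by linarith

text \<open>A small Gromov product \<open>gp p x y\<close> puts \<open>p\<close> near a geodesic
  from \<open>x\<close> to \<open>y\<close>. Two such points at about the same distance from
  \<open>x\<close> are close, by the four-point inequality.\<close>

lemma near_if_same_position:
  assumes "x \<in> carrier G" "y \<in> carrier G" "p \<in> carrier G" "q \<in> carrier G"
    and "gp p x y \<le> R" "gp q x y \<le> R" "\<bar>d x p - d x q\<bar> \<le> \<epsilon>"
  shows "d p q \<le> 2 * R + \<epsilon> + 2 * \<delta>"
  using four_point[of x p y q] assms d_commute[of x p] d_commute[of x q] d_commute[of p y] d_commute[of q y]
  by (auto simp: Gromov_product_def max_def split: if_splits)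

text \<open>A large product \<open>gp q x x'\<close> means that \<open>x\<close> and
  \<open>x'\<close> are seen from \<open>q\<close> in the same direction. Replacing
  \<open>x'\<close> by \<open>x\<close> and \<open>y'\<close> by \<open>y\<close> costs \<delta>
  each.\<close>

lemma gp_perturb:
  assumes "q \<in> carrier G" "x \<in> carrier G" "y \<in> carrier G" "x' \<in> carrier G" "y' \<in> carrier G"
    and "gp q x' y' \<le> R" "gp q x x' > R + 2 * \<delta>" "gp q y y' > R + 2 * \<delta>"
  shows "gp q x y \<le> R + 2 * \<delta>"
  using hyp[of q x' x y'] hyp[of q x y y'] gp_commute[of x x' q] \<delta>_nonneg assms
  by (auto simp: min_def split: if_splits)

text \<open>If \<open>k \<ge> 2\<delta> + 2\<close>, this finite set determines the cone of \<open>g\<close>, i.e. the set of all \<open>h\<close> with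
  \<open>len (g h) = len g + len h\<close>.\<close>

definition cone_type :: "nat \<Rightarrow> 'a \<Rightarrow> 'a set" where
  "cone_type k g = {h \<in> carrier G. len h \<le> k \<and> len (g \<otimes> h) < len g}"

text \<open>Cannon's argument. If \<open>g' h\<close> were too short, a geodesic to
  \<open>g' h\<close> would pass, within \<open>2\<delta> + 2\<close> of \<open>g'\<close>, through
  a point \<open>u\<close> of length \<open>len g' - 1\<close>. Then \<open>g'^-1 u\<close> lies in
  the cone type of \<open>g'\<close>, hence in that of \<open>g\<close>, and gives a shortcut to
  \<open>g h\<close>.\<close>

lemma cone_subset:
  assumes k: "real k \<ge> 2 * \<delta> + 2" and g: "g \<in> carrier G" "g' \<in> carrier G" and T: "cone_type k g = cone_type k g'"
  shows "h \<in> carrier G \<Longrightarrow> len (g \<otimes> h) = len g + len h \<Longrightarrow> len (g' \<otimes> h) = len g' + len h"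
proof (induction "len h" arbitrary: h)
  case 0
  then show ?case using len_eq_0[of h] g by simp
next
  case (Suc n)
  obtain h1 s where h1: "h1 \<in> carrier G" "s \<in> carrier G" "h = h1 \<otimes> s" "len h1 = n" "len s = Suc 0"
    using len_split[OF Suc.prems(1), of n] Suc.hyps(2) by (metis Suc_n_not_le_n diff_Suc_Suc diff_add_inverse lessI less_or_eq_imp_le add_diff_cancel_right' plus_1_eq_Suc One_nat_def)
  have "len (g \<otimes> h) \<le> len (g \<otimes> h1) + len s" using len_mult[of "g \<otimes> h1" s] h1 g by (simp add: m_assoc)
  moreover have "len (g \<otimes> h1) \<le> len g + len h1" using len_mult g h1 by blast
  ultimately have "len (g \<otimes> h1) = len g + len h1" using Suc.prems(2) h1 Suc.hyps(2) by simp
  then have IH: "len (g' \<otimes> h1) = len g' + n" using Suc.hyps(1)[of h1] h1 by simp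
  have up: "len (g' \<otimes> h) \<le> len g' + len h" using len_mult g Suc.prems(1) by blast
  have "g' \<otimes> h1 = (g' \<otimes> h) \<otimes> inv s" using h1 g by (simp add: group_norm)
  then have "len (g' \<otimes> h1) \<le> len (g' \<otimes> h) + 1"
    using len_mult[of "g' \<otimes> h" "inv s"] h1 g Suc.prems(1) by simp
  then have low: "len g' + n \<le> len (g' \<otimes> h) + 1" using IH by simp
  show ?case
  proof (rule ccontr)
    assume "len (g' \<otimes> h) \<noteq> len g' + len h"
    then have lt: "len (g' \<otimes> h) \<le> len g' + n" using up Suc.hyps(2) by simp
    have g1: "len g' \<ge> 1"
    proof (rule ccontr)
      assume "\<not> ?thesis"
      then have "g' = \<one>" using len_eq_0[of g'] g by simp
      then show False using \<open>len (g' \<otimes> h) \<noteq> len g' + len h\<close> Suc.prems(1) by simp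
    qed
    have le: "len g' - 1 \<le> len (g' \<otimes> h)" using low by simp
    have g'h: "g' \<otimes> h \<in> carrier G" using g Suc.prems(1) by simp
    obtain u v where uv: "u \<in> carrier G" "v \<in> carrier G" "g' \<otimes> h = u \<otimes> v" "len u = len g' - 1"
      "len v = len (g' \<otimes> h) - (len g' - 1)"
      by (rule len_split[OF g'h le])
    have vh: "len v \<le> len h" using uv(5) lt g1 Suc.hyps(2) by simp
    let ?k = "inv g' \<otimes> u"
    have kc: "?k \<in> carrier G" using g uv by simp
    have "d g' u + d \<one> (g' \<otimes> h) \<le> max (d g' (g' \<otimes> h) + d \<one> u) (d (g' \<otimes> h) u + d \<one> g') + 2 * \<delta>"
      using four_point[of \<one> g' "g' \<otimes> h" u] g uv(1) Suc.prems(1) by simp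
    moreover have "d g' (g' \<otimes> h) = len h" using d_mult g Suc.prems(1) by simp
    moreover have "d (g' \<otimes> h) u = len v" using d_commute[of "g' \<otimes> h" u] d_mult[of u v] uv g'h by simp
    ultimately have "d g' u + len (g' \<otimes> h) \<le> len g' + len h + 2 * \<delta>"
      using vh uv(4) g g'h uv(1) by (simp add: d_one max_def split: if_splits)
    \<comment> \<open>By induction the product has full length before the last letter of
      \<open>h\<close>, so the deficit of \<open>g' h\<close> is at most 2. This is the 2 in the
      bound on \<open>k\<close>.\<close>
    moreover have "len (g' \<otimes> h) + 2 \<ge> len g' + len h" using low Suc.hyps(2) by simp
    ultimately have "d g' u \<le> 2 * \<delta> + 2" by linarith
    then have "real (len ?k) \<le> real k" using k by (simp add: d_def)
    moreover have "g' \<otimes> ?k = u" using g uv(1) by (simp add: inv_m_cancel)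
    then have "len (g' \<otimes> ?k) < len g'" using uv(4) g1 by simp
    ultimately have "?k \<in> cone_type k g'" using kc by (simp add: cone_type_def)
    then have "len (g \<otimes> ?k) < len g" using T by (auto simp: cone_type_def)
    moreover have "g \<otimes> h = (g \<otimes> ?k) \<otimes> v"
    proof -
      have "v = inv u \<otimes> (g' \<otimes> h)" using uv(1-3) by (simp add: inv_m_cancel)
      then show ?thesis using g uv(1) Suc.prems(1) by (simp add: group_norm)
    qed
    then have "len (g \<otimes> h) \<le> len (g \<otimes> ?k) + len v" using len_mult[of "g \<otimes> ?k" v] g kc uv(2) by simp
    ultimately show False using Suc.prems(2) vh by simp
  qed
qed

text \<open>A geodesic with more vertices than there are cone types has two vertices
  \<open>g\<close> and \<open>g u\<close> of the same type. Whatever continues \<open>g\<close>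
  geodesically then also continues \<open>g u\<close>, in particular another \<open>u\<close>; so
  each \<open>g u^n\<close> has full length, and hence each \<open>u^n\<close>.\<close>

lemma exists_straight_element:
  assumes inf: "infinite (carrier G)"
  obtains u where "u \<in> carrier G" "len u > 0" "\<And>n::nat. len (u [^] n) = n * len u"
proof -
  define k where "k = nat \<lceil>2 * \<delta> + 2\<rceil>"
  have k: "real k \<ge> 2 * \<delta> + 2" unfolding k_def by linarith
  let ?B = "{g \<in> carrier G. len g \<le> k}"
  define N where "N = card (Pow ?B)"
  have "infinite (carrier G - {g \<in> carrier G. len g \<le> N})" using inf finite_ball by simp
  then obtain g0 where "g0 \<in> carrier G - {g \<in> carrier G. len g \<le> N}" by (metis ex_in_conv finite.emptyI)
  then have g0: "g0 \<in> carrier G" "len g0 > N" by auto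
  obtain w where w: "w \<in> words_over S" "length w = len g0" "word_val G w = g0" by (rule shortest_word[OF g0(1)])
  define p where "p i = word_val G (take i w)" for i
  have tk: "take i w \<in> words_over S" "drop i w \<in> words_over S" for i
    using w(1) words_over_append[of "take i w" "drop i w" S] by simp_all
  have p: "p i \<in> carrier G" for i unfolding p_def using tk words_over_S by simp
  have sub: "drop i (take j w) \<in> words_over S" for i j
    using tk(1)[of j] by (auto simp: words_over_iff dest: in_set_dropD)
  have pq: "inv (p i) \<otimes> p j = word_val G (drop i (take j w))" if "i \<le> j" for i j
  proof -
    have "take j w = take i w @ drop i (take j w)" using that by (metis append_take_drop_id min.absorb2 min.commute take_take)
    then have "p j = p i \<otimes> word_val G (drop i (take j w))"
      unfolding p_def using word_val_append[OF words_over_S[OF tk(1)] words_over_S[OF sub]] by metis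
    then show ?thesis using p sub words_over_S by (simp add: inv_m_cancel)
  qed
  have p0: "p 0 = \<one>" "p (length w) = g0" using w(3) by (simp_all add: p_def)
  have le: "len (inv (p i) \<otimes> p j) \<le> j - i" if "i \<le> j" "j \<le> length w" for i j
    using pq[OF that(1)] len_word_val[OF sub[of i j]] that by simp
  have len_p: "len (inv (p i) \<otimes> p j) = j - i" if ij: "i \<le> j" "j \<le> length w" for i j
  proof -
    have "p i = inv (p 0) \<otimes> p i" "p j = p i \<otimes> (inv (p i) \<otimes> p j)" "g0 = p j \<otimes> (inv (p j) \<otimes> p (length w))"
      using p p0 g0(1) by (simp_all add: inv_m_cancel)
    then have "len (p i) \<le> i" "len (p j) \<le> len (p i) + len (inv (p i) \<otimes> p j)"
      "len g0 \<le> len (p j) + len (inv (p j) \<otimes> p (length w))"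
      using le[of 0 i] len_mult[of "p i" "inv (p i) \<otimes> p j"] len_mult[of "p j" "inv (p j) \<otimes> p (length w)"] p ij by simp_all
    then show ?thesis using le[OF ij] le[of j "length w"] ij w(2) by linarith
  qed
  have "\<not> inj_on (\<lambda>i. cone_type k (p i)) {0..length w}"
  proof
    assume inj: "inj_on (\<lambda>i. cone_type k (p i)) {0..length w}"
    have "(\<lambda>i. cone_type k (p i)) ` {0..length w} \<subseteq> Pow ?B" by (auto simp: cone_type_def)
    then have "card {0..length w} \<le> N"
      unfolding N_def using card_inj_on_le[OF inj] finite_ball by simp
    then show False using g0(2) w(2) by simp
  qed
  then obtain i j where ij: "i < j" "j \<le> length w" "cone_type k (p i) = cone_type k (p j)"
    unfolding inj_on_def by (metis atLeastAtMost_iff linorder_neqE_nat)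
  define g u where "g = p i" and "u = inv (p i) \<otimes> p j"
  have gu: "g \<in> carrier G" "u \<in> carrier G" "g \<otimes> u = p j" using p by (simp_all add: g_def u_def inv_m_cancel)
  have lu: "len u = j - i" unfolding u_def using len_p ij by simp
  have lp: "len (p m) = m" if "m \<le> length w" for m using len_p[of 0 m] p0(1) p that by simp
  have same: "len (g \<otimes> h) = len g + len h \<longleftrightarrow> len (g \<otimes> u \<otimes> h) = len (g \<otimes> u) + len h" if "h \<in> carrier G" for h
    using cone_subset[OF k _ _ ij(3), of h] cone_subset[OF k _ _ ij(3)[symmetric], of h] p that gu(3) by (auto simp: g_def)
  have cu: "len (g \<otimes> u) = len g + len u" using lp ij lu gu(3) by (simp add: g_def)
  \<comment> \<open>The second conjunct, that \<open>g u^n\<close> has the same cone as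
    \<open>g\<close>, carries the induction.\<close>
  have "len (g \<otimes> u [^] n) = len g + n * len u \<and>
     (\<forall>h\<in>carrier G. len (g \<otimes> u [^] n \<otimes> h) = len (g \<otimes> u [^] n) + len h \<longleftrightarrow> len (g \<otimes> h) = len g + len h)" for n :: nat
  proof (induction n)
    case 0
    then show ?case using gu by simp
  next
    case (Suc n)
    let ?x = "g \<otimes> u [^] n"
    have x: "?x \<in> carrier G" "g \<otimes> u [^] Suc n = ?x \<otimes> u" using gu by (simp_all add: m_assoc)
    have xu: "len (?x \<otimes> u) = len ?x + len u" using Suc cu gu(2) by blast
    have "len (?x \<otimes> u \<otimes> h) = len (?x \<otimes> u) + len h \<longleftrightarrow> len (g \<otimes> h) = len g + len h" if h: "h \<in> carrier G" for h
    proof -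
      have "len (?x \<otimes> (u \<otimes> h)) = len ?x + (len u + len h) \<longleftrightarrow> len (g \<otimes> (u \<otimes> h)) = len g + (len u + len h)"
      proof -
        have uh: "u \<otimes> h \<in> carrier G" "len (u \<otimes> h) \<le> len u + len h" using gu h len_mult by auto
        have eq: "len (y \<otimes> (u \<otimes> h)) = len y + (len u + len h) \<longleftrightarrow>
            len (u \<otimes> h) = len u + len h \<and> len (y \<otimes> (u \<otimes> h)) = len y + len (u \<otimes> h)" if "y \<in> carrier G" for y
          using len_mult[OF that uh(1)] uh(2) by auto
        show ?thesis unfolding eq[OF x(1)] eq[OF gu(1)] using Suc.IH uh(1) by blast
      qed
      then have "len (?x \<otimes> u \<otimes> h) = len (?x \<otimes> u) + len h \<longleftrightarrow> len (g \<otimes> u \<otimes> h) = len (g \<otimes> u) + len h"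
        using xu cu x(1) gu(1,2) h by (simp add: m_assoc add.assoc)
      then show ?thesis using same[OF h] by blast
    qed
    then show ?case using Suc.IH xu unfolding x(2) by simp
  qed
  then have gun: "len (g \<otimes> u [^] n) = len g + n * len u" for n :: nat by blast
  have "len (u [^] n) = n * len u" for n :: nat
  proof (rule antisym)
    show "len (u [^] n) \<le> n * len u"
    proof (induction n)
      case (Suc n)
      then show ?case using len_mult[of "u [^] n" u] gu(2) by simp
    qed simp
    show "n * len u \<le> len (u [^] n)" using gun[of n] len_mult[of g "u [^] n"] gu by simp
  qed
  then show ?thesis using that[OF gu(2)] lu ij(1) by simp
qed

end

context group
begin

lemma commute_inv:
  assumes "x \<in> carrier G" "y \<in> carrier G" "x \<otimes> y = y \<otimes> x"
  shows "x \<otimes> inv y = inv y \<otimes> x"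
proof -
  have "x \<otimes> inv y = inv y \<otimes> (y \<otimes> x) \<otimes> inv y" using assms(1,2) by (simp add: group_norm)
  also have "\<dots> = inv y \<otimes> x" unfolding assms(3)[symmetric] using assms(1,2) by (simp add: group_norm)
  finally show ?thesis .
qed

lemma commute_nat_pow:
  fixes n :: nat
  assumes "x \<in> carrier G" "y \<in> carrier G" "x \<otimes> y = y \<otimes> x"
  shows "x \<otimes> y [^] n = y [^] n \<otimes> x"
proof (induction n)
  case (Suc n)
  have "x \<otimes> y [^] Suc n = (x \<otimes> y [^] n) \<otimes> y" using assms(1,2) by (simp add: m_assoc)
  also have "\<dots> = y [^] n \<otimes> (x \<otimes> y)" unfolding Suc using assms(1,2) by (simp add: m_assoc)
  also have "\<dots> = y [^] Suc n \<otimes> x" unfolding assms(3) using assms(1,2) by (simp add: m_assoc)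
  finally show ?case .
qed (use assms in simp)

lemma commute_int_pow:
  fixes i :: int
  assumes "x \<in> carrier G" "y \<in> carrier G" "x \<otimes> y = y \<otimes> x"
  shows "x \<otimes> y [^] i = y [^] i \<otimes> x"
proof (cases "i < 0")
  case True
  have "x \<otimes> inv (y [^] nat (- i)) = inv (y [^] nat (- i)) \<otimes> x"
    by (rule commute_inv) (use assms commute_nat_pow in auto)
  then show ?thesis unfolding int_pow_def2 using True by (simp only: if_True)
next
  case False
  then show ?thesis unfolding int_pow_def2 using commute_nat_pow[OF assms, of "nat i"] by (simp only: if_False)
qed

lemma commute_mult:
  assumes "x \<in> carrier G" "y \<in> carrier G" "z \<in> carrier G" "x \<otimes> z = z \<otimes> x" "y \<otimes> z = z \<otimes> y"
  shows "x \<otimes> y \<otimes> z = z \<otimes> (x \<otimes> y)"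
proof -
  have "x \<otimes> y \<otimes> z = x \<otimes> (y \<otimes> z)" using assms(1-3) by (simp add: m_assoc)
  also have "\<dots> = x \<otimes> z \<otimes> y" unfolding assms(5) using assms(1-3) by (simp add: m_assoc)
  also have "\<dots> = z \<otimes> (x \<otimes> y)" unfolding assms(4) using assms(1-3) by (simp add: m_assoc)
  finally show ?thesis .
qed

end

section \<open>Straight elements and their centralizers\<close>

context hyperbolic
begin

definition straight :: "'a \<Rightarrow> bool" where
  "straight a \<longleftrightarrow> a \<in> carrier G \<and> len a > 0 \<and> (\<forall>n::nat. len (a [^] n) = n * len a)"

lemma straightD:
  assumes "straight a"
  shows "a \<in> carrier G" "len a > 0" "len (a [^] (n::nat)) = n * len a"
  using assms by (simp_all add: straight_def)

lemma straight_pow: "straight a \<Longrightarrow> m > 0 \<Longrightarrow> straight (a [^] (m::nat))"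
  by (simp add: straight_def nat_pow_pow)

lemma straight_pow_eq_one: "straight a \<Longrightarrow> a [^] (n::nat) = \<one> \<Longrightarrow> n = 0"
  using straightD(2,3)[of a] len_one by (metis mult_is_0 not_gr_zero)

lemma straight_int_pow_eq_one:
  assumes "straight a" "a [^] (i::int) = \<one>"
  shows "i = 0"
proof (rule ccontr)
  assume "i \<noteq> 0"
  have ac: "a \<in> carrier G" by (rule straightD(1)[OF assms(1)])
  have "a [^] nat \<bar>i\<bar> = \<one>"
  proof (cases "i < 0")
    case True
    then have "inv (a [^] nat (- i)) = \<one>" using assms(2) unfolding int_pow_def2 by (simp only: if_True)
    then have "inv (inv (a [^] nat (- i))) = inv \<one>" by (rule arg_cong)
    then show ?thesis using True ac by simp
  next
    case False
    then have "a [^] nat i = \<one>" using assms(2) unfolding int_pow_def2 by (simp only: if_False)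
    moreover have "\<bar>i\<bar> = i" using False by simp
    ultimately show ?thesis by (simp only:)
  qed
  from straight_pow_eq_one[OF assms(1) this] show False using \<open>i \<noteq> 0\<close> by simp
qed

text \<open>Commuting with a large power \<open>Y\<close> of \<open>a\<close>, the element
  \<open>g\<close> moves \<open>Y\<close> and \<open>Y^-1\<close> only by \<open>len g\<close>. Seen
  from \<open>g\<close> these points are far away, so \<open>g\<close> lies near the powers of
  \<open>a\<close> between them. It matters later that the bound on \<open>b\<close> depends neither
  on \<open>g\<close> nor on \<open>s\<close>.\<close>

lemma straight_axis_near:
  assumes a: "straight a" and g: "g \<in> carrier G" and s: "s > (0::nat)" "g \<otimes> a [^] s = a [^] s \<otimes> g"
  shows "\<exists>(i::int) b. b \<in> carrier G \<and> real (len b) \<le> 6 * \<delta> + len a \<and> g = a [^] i \<otimes> b"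
proof -
  note ac = straightD(1)[OF a] and la = straightD(2)[OF a] and lp = straightD(3)[OF a]
  \<comment> \<open>The factor \<open>s\<close> in \<open>M\<close> makes \<open>g\<close> commute
    with \<open>a^M\<close>; the size of \<open>k\<close> puts \<open>a^M\<close> farther than
    \<open>2 len g + 2\<delta>\<close> from the identity, as \<open>gp_perturb\<close>
    requires.\<close>
  define k where "k = 2 * len g + nat \<lceil>2 * \<delta>\<rceil> + 1"
  define M where "M = s * k"
  have kM: "k \<le> M * len a" "len g \<le> M * len a"
  proof -
    have "1 * k \<le> (s * len a) * k" using s(1) la by (intro mult_right_mono) simp_all
    then show "k \<le> M * len a" by (simp add: M_def ac_simps)
    then show "len g \<le> M * len a" by (simp add: k_def)
  qed
  have kr: "real k > 2 * len g + 2 * \<delta>" unfolding k_def by linarith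
  define Y X where "Y = a [^] M" and "X = inv Y"
  have Y: "Y \<in> carrier G" "X \<in> carrier G" using ac by (simp_all add: Y_def X_def)
  have gY: "g \<otimes> Y = Y \<otimes> g"
    using commute_nat_pow[OF g _ s(2), of k] ac by (simp add: Y_def M_def nat_pow_pow)
  have gX: "g \<otimes> X = X \<otimes> g" unfolding X_def by (rule commute_inv[OF g Y(1) gY])
  have lY: "real (len Y) = M * len a" "real (len X) = M * len a" using Y lp by (simp_all add: X_def Y_def)
  have dXY: "d X Y = 2 * M * len a"
    unfolding d_def X_def using Y(1) ac lp[of "M + M"] by (simp add: Y_def nat_pow_mult algebra_simps)
  have gp0: "gp \<one> X Y = 0"
    using gp_double[of \<one> X Y] dXY lY Y by (simp add: d_one)
  have "gp (g \<otimes> \<one>) (g \<otimes> X) (g \<otimes> Y) = 0"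
    unfolding gp0[symmetric] using g Y by (intro gp_translate) simp_all
  then have gpg: "gp g (g \<otimes> X) (g \<otimes> Y) \<le> 0" using g by simp
  have dX: "d X (g \<otimes> X) = len g" and dY: "d Y (g \<otimes> Y) = len g"
    unfolding gX gY using d_mult g Y by simp_all
  have far: "d g Z \<ge> real M * real (len a) - real (len g)" if "Z \<in> carrier G" "real (len Z) = M * len a" for Z
    using d_triangle[of \<one> g Z] d_one[of g] d_one[of Z] g that by simp
  have big: "real M * real (len a) - real (len g) - real (len g) > 2 * \<delta>"
  proof -
    have "real k \<le> real (M * len a)" using kM(1) by (simp only: of_nat_le_iff)
    then show ?thesis using kr by simp
  qed
  have "gp g X (g \<otimes> X) > 0 + 2 * \<delta>" "gp g Y (g \<otimes> Y) > 0 + 2 * \<delta>"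
    using gp_near[of g X "g \<otimes> X"] gp_near[of g Y "g \<otimes> Y"] far[OF Y(2) lY(2)] far[OF Y(1) lY(1)] dX dY big g Y
    by simp_all
  then have gpXY: "gp g X Y \<le> 2 * \<delta>"
    using gp_perturb[of g X Y "g \<otimes> X" "g \<otimes> Y" 0] gpg g Y by simp
  \<comment> \<open>\<open>L\<close> is the distance from \<open>X\<close> to \<open>g\<close>;
    \<open>p = a^(j-M)\<close> will be the power of \<open>a\<close> at the same distance from
    \<open>X\<close>, up to \<open>len a\<close>.\<close>
  define L where "L = len (inv X \<otimes> g)"
  define j where "j = L div len a"
  have "L \<le> M * len a + len g" unfolding L_def using len_mult[of "inv X" g] Y g lp by (simp add: X_def Y_def)
  then have "L \<le> 2 * M * len a" using kM(2) by simp
  then have j: "j \<le> 2 * M" unfolding j_def using la by (metis div_le_mono div_mult_self_is_m)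
  define p where "p = X \<otimes> a [^] j"
  have p: "p \<in> carrier G" using Y ac by (simp add: p_def)
  have dXp: "d X p = j * len a" unfolding p_def using d_mult[of X "a [^] j"] Y ac lp by simp
  have "inv p \<otimes> Y = a [^] (2 * M - j)"
  proof -
    have "a [^] j \<otimes> a [^] (2 * M - j) = Y \<otimes> Y"
      using j ac by (simp add: Y_def nat_pow_mult mult_2)
    then have "inv (a [^] j) \<otimes> (Y \<otimes> Y) = a [^] (2 * M - j)" using ac by (metis inv_m_cancel(1) nat_pow_closed)
    then show ?thesis unfolding p_def X_def using Y(1) ac by (simp add: group_norm)
  qed
  then have dpY: "d p Y = (2 * M - j) * len a" using lp by (simp add: d_def)
  have gpp: "gp p X Y \<le> 2 * \<delta>"
  proof -
    have "2 * gp p X Y = real j * real (len a) + real (2 * M - j) * real (len a) - 2 * real M * real (len a)"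
      using gp_double[of p X Y] dXp dpY dXY d_commute[of p X] p Y by simp
    also have "\<dots> = 0" using j by (simp add: of_nat_diff algebra_simps)
    finally show ?thesis using \<delta>_nonneg by simp
  qed
  have "\<bar>d X g - d X p\<bar> \<le> len a"
  proof -
    have "d X g = L" by (simp add: d_def L_def)
    moreover have "j * len a \<le> L" "L < j * len a + len a"
      unfolding j_def using div_times_less_eq_dividend dividend_less_div_times[OF la] by (auto simp: add.commute)
    then have "real (j * len a) \<le> real L" "real L < real (j * len a + len a)" by (simp_all only: of_nat_le_iff of_nat_less_iff)
    ultimately show ?thesis using dXp by simp
  qed
  then have "d g p \<le> 2 * (2 * \<delta>) + len a + 2 * \<delta>"
    using near_if_same_position[of X Y g p "2 * \<delta>" "len a"] gpXY gpp g p Y by simp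
  then have "d p g \<le> 6 * \<delta> + len a" using d_commute g p by simp
  moreover have "p = a [^] (int j - int M)"
  proof -
    have "p = a [^] (- int M) \<otimes> a [^] int j"
      unfolding p_def X_def Y_def using ac by (simp add: int_pow_neg_int int_pow_int)
    also have "\<dots> = a [^] (- int M + int j)" using ac by (simp only: int_pow_mult)
    finally show ?thesis by simp
  qed
  ultimately show ?thesis
    using g p by (intro exI[of _ "int j - int M"] exI[of _ "inv p \<otimes> g"]) (simp add: d_def inv_m_cancel)
qed

text \<open>Replacing a straight element by a suitable power makes the centralizers of its powers coincide, so
  that they form a single subgroup of infinite index.\<close>

definition full_centralizer :: "'a \<Rightarrow> bool" where
  "full_centralizer a \<longleftrightarrow> straight a \<and>
     (\<forall>g\<in>carrier G. \<forall>s::nat. s > 0 \<longrightarrow> g \<otimes> a [^] s = a [^] s \<otimes> g \<longrightarrow> g \<otimes> a = a \<otimes> g)"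

text \<open>Some power \<open>u\<close> of a straight element lies in \<open>N\<close>. By
  \<open>straight_axis_near\<close> an element commuting with a power of \<open>u\<close> is
  \<open>u^i b\<close> with \<open>b\<close> in a finite set \<open>B\<close>, and \<open>b\<close>
  commutes with the power of exponent \<open>\<sigma> b\<close>. The product \<open>s0\<close> of
  these exponents serves all of them.\<close>

lemma exists_full_centralizer:
  assumes "infinite (carrier G)" "N \<lhd> G" "finite (rcosets N)"
  obtains a where "a \<in> N" "full_centralizer a"
proof -
  interpret N: normal N G by fact
  obtain v where "v \<in> carrier G" "len v > 0" "\<And>n::nat. len (v [^] n) = n * len v"
    using exists_straight_element[OF assms(1)] by blast
  then have v: "straight v" by (simp add: straight_def)
  define m where "m = card (rcosets N)"
  note m = N.pow_index_mem[OF assms(3) straightD(1)[OF v], folded m_def]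
  define u where "u = v [^] m"
  have u: "straight u" "u \<in> N" unfolding u_def using straight_pow[OF v m(2)] m(1) by auto
  have uc: "u \<in> carrier G" by (rule straightD(1)[OF u(1)])
  define Z where "Z g \<longleftrightarrow> (\<exists>s::nat. s > 0 \<and> g \<otimes> u [^] s = u [^] s \<otimes> g)" for g
  define B where "B = {b \<in> carrier G. real (len b) \<le> 6 * \<delta> + len u \<and> Z b}"
  have "B \<subseteq> {g \<in> carrier G. len g \<le> nat \<lceil>6 * \<delta> + len u\<rceil>}"
    by (auto simp: B_def) linarith
  then have B: "finite B" using finite_ball finite_subset by blast
  define \<sigma> where "\<sigma> b = (SOME s::nat. s > 0 \<and> b \<otimes> u [^] s = u [^] s \<otimes> b)" for b
  have \<sigma>: "\<sigma> b > 0" "b \<otimes> u [^] \<sigma> b = u [^] \<sigma> b \<otimes> b" if "b \<in> B" for b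
    using someI_ex[of "\<lambda>s::nat. s > 0 \<and> b \<otimes> u [^] s = u [^] s \<otimes> b"] that by (auto simp: B_def Z_def \<sigma>_def)
  define s0 where "s0 = (\<Prod>b\<in>B. \<sigma> b)"
  have s0: "s0 > 0" unfolding s0_def using \<sigma>(1) by (simp add: prod_pos)
  have Zs0: "g \<otimes> u [^] s0 = u [^] s0 \<otimes> g" if g: "g \<in> carrier G" "Z g" for g
  proof -
    obtain s :: nat where s: "s > 0" "g \<otimes> u [^] s = u [^] s \<otimes> g" using g(2) by (auto simp: Z_def)
    obtain i :: int and b where b: "b \<in> carrier G" "real (len b) \<le> 6 * \<delta> + len u" "g = u [^] i \<otimes> b"
      using straight_axis_near[OF u(1) g(1) s] by blast
    have ui: "u [^] i \<otimes> u [^] k = u [^] k \<otimes> u [^] i" for k :: nat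
      using uc int_pow_mult[of u i "int k"] int_pow_mult[of u "int k" i] by (simp add: int_pow_int add.commute)
    have "b = inv (u [^] i) \<otimes> g" using b uc by (simp add: inv_m_cancel)
    moreover have "inv (u [^] i) \<otimes> u [^] s = u [^] s \<otimes> inv (u [^] i)"
      using commute_inv[of "u [^] s" "u [^] i"] ui uc by simp
    ultimately have "b \<otimes> u [^] s = u [^] s \<otimes> b" using commute_mult s(2) uc g(1) by simp
    then have bB: "b \<in> B" using b s(1) by (auto simp: B_def Z_def)
    obtain r where "s0 = \<sigma> b * r" unfolding s0_def using dvd_prodI[OF B bB, of \<sigma>] by (auto elim: dvdE)
    then have "b \<otimes> u [^] s0 = u [^] s0 \<otimes> b"
      using commute_nat_pow[OF b(1) _ \<sigma>(2)[OF bB], of r] uc by (simp add: nat_pow_pow)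
    then show ?thesis unfolding b(3) using commute_mult ui b(1) uc by simp
  qed
  have "full_centralizer (u [^] s0)"
    unfolding full_centralizer_def
  proof (intro conjI ballI allI impI straight_pow[OF u(1) s0])
    fix g and s :: nat assume g: "g \<in> carrier G" and s: "s > 0" "g \<otimes> (u [^] s0) [^] s = (u [^] s0) [^] s \<otimes> g"
    then have "Z g" unfolding Z_def using s0 uc by (intro exI[of _ "s0 * s"]) (simp add: nat_pow_pow)
    then show "g \<otimes> u [^] s0 = u [^] s0 \<otimes> g" by (rule Zs0[OF g])
  qed
  moreover have "u [^] s0 \<in> N"
    using subgroup_int_pow_closed[OF N.subgroup_axioms u(2), of "int s0"] by (simp add: int_pow_int)
  ultimately show ?thesis using that by blast
qed

end

context hyperbolic
begin

lemma full_centralizerD: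
  assumes "full_centralizer a"
  shows "straight a" "a \<in> carrier G"
    "g \<in> carrier G \<Longrightarrow> s > (0::nat) \<Longrightarrow> g \<otimes> a [^] s = a [^] s \<otimes> g \<Longrightarrow> g \<otimes> a = a \<otimes> g"
  using assms by (auto simp: full_centralizer_def straight_def)

lemma mem_centralizer_of: "g \<in> centralizer_of a \<longleftrightarrow> g \<in> carrier G \<and> g \<otimes> a = a \<otimes> g"
  by (simp add: centralizer_of_def)

lemma centralizer_near_axis:
  assumes a: "straight a"
  obtains B where "finite B" "B \<subseteq> carrier G" "\<And>g. g \<in> centralizer_of a \<Longrightarrow> \<exists>(i::int). \<exists>b\<in>B. g = a [^] i \<otimes> b"
proof -
  define B where "B = {b \<in> carrier G. real (len b) \<le> 6 * \<delta> + len a}"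
  have "B \<subseteq> {g \<in> carrier G. len g \<le> nat \<lceil>6 * \<delta> + len a\<rceil>}"
    by (auto simp: B_def) linarith
  then have B: "finite B" using finite_ball finite_subset by blast
  have "\<exists>(i::int). \<exists>b\<in>B. g = a [^] i \<otimes> b" if g: "g \<in> centralizer_of a" for g
  proof -
    have "g \<otimes> a [^] (1::nat) = a [^] (1::nat) \<otimes> g" using g straightD(1)[OF a] by (simp add: mem_centralizer_of)
    then obtain i :: int and b where "b \<in> carrier G" "real (len b) \<le> 6 * \<delta> + len a" "g = a [^] i \<otimes> b"
      using straight_axis_near[OF a, of g 1] g by (auto simp: mem_centralizer_of)
    then show ?thesis by (auto simp: B_def)
  qed
  then show ?thesis using that[OF B] by (auto simp: B_def)
qed

lemma infinite_carrier:
  assumes "\<not> elementary_group G"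
  shows "infinite (carrier G)"
proof
  assume fin: "finite (carrier G)"
  have "group (G\<lparr>carrier := {\<one>}\<rparr>)" using subgroup.subgroup_is_group[OF triv_subgroup is_group] .
  then have "cyclic_group (G\<lparr>carrier := {\<one>}\<rparr>)"
    by (intro trivial_imp_cyclic_group) (simp add: trivial_group_def)
  moreover have "finite (rcosets {\<one>})" using fin by (simp add: RCOSETS_def)
  ultimately show False
    using assms triv_subgroup unfolding elementary_group_def finite_index_def by blast
qed

text \<open>The centralizer is covered by finitely many cosets of the cyclic group generated by
  \<open>a\<close>. If it had finite index, so would that cyclic group, and the group would be
  elementary.\<close>

lemma infinite_index_centralizer:
  assumes "\<not> elementary_group G" and a: "straight a"
  shows "infinite (rcosets (centralizer_of a))"
proof
  assume fin: "finite (rcosets (centralizer_of a))"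
  let ?C = "centralizer_of a"
  have ac: "a \<in> carrier G" by (rule straightD(1)[OF a])
  interpret C: subgroup ?C G by (rule subgroup_centralizer_of[OF ac])
  define rep where "rep c = (SOME g. g \<in> c)" for c :: "'a set"
  have rep: "rep c \<in> c" if "c \<in> rcosets ?C" for c
    using C.rcosets_non_empty[OF that] by (simp add: rep_def some_in_eq)
  have rep_carrier: "rep c \<in> carrier G" if "c \<in> rcosets ?C" for c
    using rep[OF that] that C.rcosets_carrier[OF is_group] by blast
  obtain B where B: "finite B" "B \<subseteq> carrier G" "\<And>g. g \<in> ?C \<Longrightarrow> \<exists>(i::int). \<exists>b\<in>B. g = a [^] i \<otimes> b"
    using centralizer_near_axis[OF a] by blast
  define H where "H = generate G {a}"
  have H: "subgroup H G" unfolding H_def using ac by (simp add: generate_is_subgroup)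
  have Hp: "H = range (\<lambda>i::int. a [^] i)" unfolding H_def generate_pow[OF ac] by auto
  define T where "T = (\<lambda>(b, c). b \<otimes> rep c) ` (B \<times> (rcosets ?C))"
  have "finite (rcosets H)"
  proof (rule finite_rcosets_if_covered[OF H])
    show "finite T" unfolding T_def using B(1) fin by simp
    show "T \<subseteq> carrier G" unfolding T_def using B(2) rep_carrier by auto
    fix x assume x: "x \<in> carrier G"
    have c: "?C #> x \<in> rcosets ?C" using x by (rule rcosetsI[OF C.subset])
    obtain k where k: "k \<in> ?C" "rep (?C #> x) = k \<otimes> x" using rep[OF c] by (auto simp: r_coset_def)
    obtain i :: int and b where b: "b \<in> B" "inv k = a [^] i \<otimes> b" using B(3)[OF C.m_inv_closed[OF k(1)]] by blast
    have kc: "k \<in> carrier G" "b \<in> carrier G" using k(1) b(1) B(2) by auto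
    have "b \<otimes> rep (?C #> x) \<in> T" unfolding T_def using b(1) c by auto
    moreover have "x \<otimes> inv (b \<otimes> rep (?C #> x)) = inv k \<otimes> inv b"
      unfolding k(2) using kc x by (simp add: group_norm)
    then have "x \<otimes> inv (b \<otimes> rep (?C #> x)) = a [^] i" unfolding b(2) using kc ac by (simp add: m_assoc)
    then have "x \<otimes> inv (b \<otimes> rep (?C #> x)) \<in> H" unfolding Hp by blast
    ultimately show "\<exists>t\<in>T. x \<otimes> inv t \<in> H" by blast
  qed
  moreover have "cyclic_group (G\<lparr>carrier := H\<rparr>)"
  proof -
    interpret HG: group "G\<lparr>carrier := H\<rparr>" by (rule subgroup.subgroup_is_group[OF H is_group])
    have aH: "a \<in> H" unfolding H_def by (simp add: generate.incl)
    have "H = range (\<lambda>i::int. a [^]\<^bsub>G\<lparr>carrier := H\<rparr>\<^esub> i)"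
      using Hp int_pow_consistent[OF H aH] by simp
    then show ?thesis unfolding HG.cyclic_group using aH by auto
  qed
  ultimately show False using assms(1) H unfolding elementary_group_def finite_index_def by blast
qed

text \<open>In \<open>t = a^i b\<close> the bounded part \<open>b\<close> determines the torsion
  element \<open>t\<close>: two of them with the same \<open>b\<close> differ by a power of
  \<open>a\<close> commuting with them, which has finite order and is therefore trivial.\<close>

lemma finite_torsion_centralizer:
  assumes a: "straight a"
  shows "finite {t \<in> centralizer_of a. \<exists>n>0. t [^] (n::nat) = \<one>}" (is "finite ?T")
proof -
  have ac: "a \<in> carrier G" by (rule straightD(1)[OF a])
  obtain B where B: "finite B" "B \<subseteq> carrier G" "\<And>g. g \<in> centralizer_of a \<Longrightarrow> \<exists>(i::int). \<exists>b\<in>B. g = a [^] i \<otimes> b"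
    using centralizer_near_axis[OF a] by blast
  define \<beta> where "\<beta> t = (SOME b. b \<in> B \<and> (\<exists>i::int. t = a [^] i \<otimes> b))" for t
  have \<beta>: "\<beta> t \<in> B" "\<exists>i::int. t = a [^] i \<otimes> \<beta> t" if "t \<in> ?T" for t
  proof -
    have "\<exists>b. b \<in> B \<and> (\<exists>i::int. t = a [^] i \<otimes> b)" using B(3)[of t] that by blast
    from someI_ex[OF this, folded \<beta>_def] show "\<beta> t \<in> B" "\<exists>i::int. t = a [^] i \<otimes> \<beta> t" by simp_all
  qed
  have "inj_on \<beta> ?T"
  proof (rule inj_onI)
    fix t t' assume t: "t \<in> ?T" and t': "t' \<in> ?T" and eq: "\<beta> t = \<beta> t'"
    have tc: "t \<in> carrier G" "t \<otimes> a = a \<otimes> t" "t' \<in> carrier G" using t t' by (auto simp: mem_centralizer_of)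
    obtain n n' :: nat where n: "n > 0" "t [^] n = \<one>" "n' > 0" "t' [^] n' = \<one>" using t t' by blast
    obtain i j :: int where ij: "t = a [^] i \<otimes> \<beta> t" "t' = a [^] j \<otimes> \<beta> t" using \<beta>(2)[OF t] \<beta>(2)[OF t'] unfolding eq[symmetric] by blast
    have bc: "\<beta> t \<in> carrier G" using \<beta>(1)[OF t] B(2) by blast
    define l where "l = j - i"
    have "a [^] j = a [^] l \<otimes> a [^] i" using int_pow_mult[OF ac, of l i] by (simp add: l_def)
    then have t'l: "t' = a [^] l \<otimes> t" using ij bc ac by (simp add: m_assoc)
    have comm: "a [^] l \<otimes> t = t \<otimes> a [^] l" using commute_int_pow[OF tc(1) ac tc(2), of l] by simp
    have "t' [^] (n * n') = (a [^] l) [^] (n * n') \<otimes> t [^] (n * n')"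
      unfolding t'l using comm ac tc(1) by (intro pow_mult_distrib) simp_all
    moreover have "t' [^] (n * n') = \<one>" using nat_pow_pow[OF tc(3), of n' n] n by (simp add: mult.commute)
    moreover have "t [^] (n * n') = \<one>" using nat_pow_pow[OF tc(1), of n n'] n by simp
    ultimately have "(a [^] l) [^] (n * n') = \<one>" using ac by simp
    then have "a [^] (l * int (n * n')) = \<one>"
      using int_pow_pow[OF ac, of l "int (n * n')"] by (simp only: int_pow_int)
    then have "l * int (n * n') = 0" by (rule straight_int_pow_eq_one[OF a])
    then have "l = 0" using n by simp
    then show "t = t'" using t'l tc by simp
  qed
  moreover have "finite (\<beta> ` ?T)" using finite_subset[OF _ B(1)] \<beta>(1) by blast
  ultimately show ?thesis by (rule finite_imageD[rotated])
qed

text \<open>Two powers of \<open>f\<close> share the bounded part \<open>b\<close>, so their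
  quotient is a power of \<open>a\<close>.\<close>

lemma centralizer_power_in_axis:
  assumes a: "straight a" and f: "f \<in> centralizer_of a"
  obtains n :: nat and i :: int where "n > 0" "f [^] n = a [^] i"
proof -
  have ac: "a \<in> carrier G" by (rule straightD(1)[OF a])
  interpret C: subgroup "centralizer_of a" G by (rule subgroup_centralizer_of[OF ac])
  have fc: "f \<in> carrier G" using f by simp
  obtain B where B: "finite B" "B \<subseteq> carrier G" "\<And>g. g \<in> centralizer_of a \<Longrightarrow> \<exists>(i::int). \<exists>b\<in>B. g = a [^] i \<otimes> b"
    using centralizer_near_axis[OF a] by blast
  have fp: "f [^] n \<in> centralizer_of a" for n :: nat
    using subgroup_int_pow_closed[OF C.subgroup_axioms f, of "int n"] by (simp add: int_pow_int)
  have "\<forall>n::nat. \<exists>b. b \<in> B \<and> (\<exists>i::int. f [^] n = a [^] i \<otimes> b)" using B(3)[OF fp] by blast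
  then obtain \<beta> where \<beta>: "\<And>n::nat. \<beta> n \<in> B \<and> (\<exists>i::int. f [^] n = a [^] i \<otimes> \<beta> n)" by metis
  have "\<not> inj \<beta>" using B(1) \<beta> by (metis finite_subset image_subsetI infinite_UNIV_nat finite_imageD)
  then obtain m n where mn: "\<beta> m = \<beta> n" "m < n" unfolding inj_on_def by (metis UNIV_I linorder_neqE_nat)
  obtain i j :: int where ij: "f [^] m = a [^] i \<otimes> \<beta> m" "f [^] n = a [^] j \<otimes> \<beta> m" using \<beta> mn(1) by metis
  have bc: "\<beta> m \<in> carrier G" using \<beta> B(2) by blast
  have "f [^] (n - m) \<otimes> f [^] m = f [^] n" using nat_pow_mult[OF fc, of "n - m" m] mn(2) by simp
  then have "f [^] (n - m) = f [^] n \<otimes> inv (f [^] m)" using fc by (metis inv_solve_right nat_pow_closed)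
  also have "\<dots> = a [^] j \<otimes> inv (a [^] i)" unfolding ij using ac bc by (simp add: group_norm)
  also have "\<dots> = a [^] (j - i)" using ac by (simp add: int_pow_diff)
  finally show ?thesis using that[of "n - m" "j - i"] mn(2) by simp
qed

text \<open>If the product were large, the rays \<open>a^-i\<close> and \<open>w a^i\<close> would
  run close together for \<open>i \<le> K\<close>, so \<open>a^i w a^i\<close> would stay in the
  finite ball \<open>B\<close>. There are more values of \<open>i\<close> than elements of
  \<open>B\<close>, so two agree; this yields \<open>a^s w a^s = w\<close>, that is,
  \<open>w\<close> inverts \<open>a^s\<close>.\<close>

lemma opposite_rays_diverge:
  assumes a: "straight a" and w: "w \<in> carrier G"
    and no: "\<And>s::nat. s > 0 \<Longrightarrow> w \<otimes> a [^] s \<otimes> inv w \<noteq> inv (a [^] s)"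
  obtains R where "\<And>(m::nat) (n::nat). gp \<one> (inv (a [^] n)) (w \<otimes> a [^] m) \<le> R"
proof -
  note ac = straightD(1)[OF a] and la = straightD(2)[OF a] and lp = straightD(3)[OF a]
  define B where "B = {b \<in> carrier G. real (len b) \<le> 3 * len w + 4 * \<delta>}"
  have "B \<subseteq> {g \<in> carrier G. len g \<le> nat \<lceil>3 * len w + 4 * \<delta>\<rceil>}"
    by (auto simp: B_def) linarith
  then have B: "finite B" using finite_ball finite_subset by blast
  define K where "K = card B"
  \<comment> \<open>\<open>K * len a\<close> makes both rays longer than \<open>K\<close> steps and
    keeps them together that far; \<open>len w\<close> accounts for the second ray starting at
    \<open>w\<close>.\<close>
  define R where "R = real K * len a + len w"
  have bound: "gp \<one> (inv (a [^] n)) (w \<otimes> a [^] m) \<le> R" for m n :: nat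
  proof (rule ccontr)
    assume "\<not> ?thesis"
    then have gt: "gp \<one> (inv (a [^] n)) (w \<otimes> a [^] m) > R" by simp
    let ?x = "inv (a [^] n)" and ?y = "w \<otimes> a [^] m"
    have c: "?x \<in> carrier G" "?y \<in> carrier G" using ac w by simp_all
    have d1x: "d \<one> ?x = real n * len a" using c(1) ac lp by (simp add: d_one)
    have d1y: "d \<one> ?y \<le> len w + real m * len a" "d \<one> ?y \<ge> real m * len a - len w"
    proof -
      have dw: "d w ?y = real m * len a" using d_mult[OF w, of "a [^] m"] ac lp by simp
      show "d \<one> ?y \<le> len w + real m * len a" using d_triangle[of \<one> w ?y] dw d_one[OF w] w c by simp
      show "d \<one> ?y \<ge> real m * len a - len w"
        using d_triangle[of w \<one> ?y] dw d_commute[of w \<one>] d_one[OF w] w c by simp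
    qed
    have "gp \<one> ?x ?y \<le> d \<one> ?x" "gp \<one> ?x ?y \<le> d \<one> ?y"
      using gp_double[of \<one> ?x ?y] d_triangle[of \<one> ?x ?y] d_triangle[of \<one> ?y ?x] d_commute[of ?x ?y] c by simp_all
    then have "real n * len a > K * len a" "real m * len a > K * len a"
      using gt d1x d1y(1) by (simp_all add: R_def)
    then have nm: "n \<ge> K" "m \<ge> K" using la by simp_all
    have mem: "a [^] i \<otimes> w \<otimes> a [^] i \<in> B" if i: "i \<le> K" for i
    proof -
      let ?p = "inv (a [^] i)" and ?q = "w \<otimes> a [^] i"
      have pq: "?p \<in> carrier G" "?q \<in> carrier G" using ac w by simp_all
      have d1p: "d \<one> ?p = real i * len a" using ac lp by (simp add: d_one)
      have dpx: "d ?p ?x = real n * len a - real i * len a"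
      proof -
        have "inv ?p \<otimes> ?x = a [^] i \<otimes> inv (a [^] i \<otimes> a [^] (n - i))"
          using ac i nm by (simp add: nat_pow_mult)
        also have "a [^] i \<otimes> a [^] (n - i) = a [^] (n - i) \<otimes> a [^] i"
          using ac by (simp add: nat_pow_comm)
        also have "a [^] i \<otimes> inv (a [^] (n - i) \<otimes> a [^] i) = inv (a [^] (n - i))"
          using ac by (simp add: group_norm)
        finally have "d ?p ?x = real ((n - i) * len a)" unfolding d_def using ac lp by simp
        then show ?thesis using i nm by (simp add: of_nat_diff algebra_simps)
      qed
      have g1: "gp \<one> ?p ?x = real i * len a"
        using gp_double[of \<one> ?p ?x] d1p d1x dpx by simp
      have dqy: "d ?q ?y = real m * len a - real i * len a"
      proof -
        have "a [^] m = a [^] i \<otimes> a [^] (m - i)" using ac i nm by (simp add: nat_pow_mult)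
        then have "?y = ?q \<otimes> a [^] (m - i)" using ac w by (simp add: m_assoc)
        then have "d ?q ?y = real ((m - i) * len a)" using d_mult[OF pq(2), of "a [^] (m - i)"] ac lp by simp
        then show ?thesis using i nm by (simp add: of_nat_diff algebra_simps)
      qed
      have d1q: "d \<one> ?q \<le> len w + real i * len a" "d \<one> ?q \<ge> real i * len a - len w"
      proof -
        have dw: "d w ?q = real i * len a" using d_mult[OF w, of "a [^] i"] ac lp by simp
        show "d \<one> ?q \<le> len w + real i * len a" using d_triangle[of \<one> w ?q] dw d_one[OF w] w pq by simp
        show "d \<one> ?q \<ge> real i * len a - len w"
          using d_triangle[of w \<one> ?q] dw d_commute[of w \<one>] d_one[OF w] w pq by simp
      qed
      have g2: "gp \<one> ?y ?q \<ge> real i * len a - len w"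
        using gp_double[of \<one> ?y ?q] d1y(2) d1q(2) dqy d_commute[OF pq(2) c(2)] by simp
      have iR: "real i * len a \<le> R" unfolding R_def using i by (simp add: mult_right_mono add_increasing2)
      have h1: "gp \<one> ?p ?y \<ge> min (gp \<one> ?p ?x) (gp \<one> ?x ?y) - \<delta>" using hyp c pq by simp
      have h2: "gp \<one> ?p ?q \<ge> min (gp \<one> ?p ?y) (gp \<one> ?y ?q) - \<delta>" using hyp c pq by simp
      have "gp \<one> ?p ?y \<ge> real i * len a - \<delta>" using h1 g1 gt iR by linarith
      then have "gp \<one> ?p ?q \<ge> real i * len a - len w - 2 * \<delta>" using h2 g2 \<delta>_nonneg by linarith
      then have "d ?p ?q \<le> 3 * len w + 4 * \<delta>"
        using gp_double[of \<one> ?p ?q] d1p d1q(1) by linarith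
      moreover have "d ?p ?q = len (a [^] i \<otimes> w \<otimes> a [^] i)" using ac w by (simp add: d_def m_assoc)
      ultimately show ?thesis using ac w by (simp add: B_def)
    qed
    have "\<not> inj_on (\<lambda>i::nat. a [^] i \<otimes> w \<otimes> a [^] i) {0..K}"
    proof
      assume "inj_on (\<lambda>i::nat. a [^] i \<otimes> w \<otimes> a [^] i) {0..K}"
      then have "card {0..K} \<le> K" unfolding K_def using mem by (intro card_inj_on_le) (auto simp: B K_def)
      then show False by simp
    qed
    then obtain i j :: nat where ij: "i < j" "a [^] i \<otimes> w \<otimes> a [^] i = a [^] j \<otimes> w \<otimes> a [^] j"
      unfolding inj_on_def by (metis linorder_neqE_nat)
    define s where "s = j - i"
    have s: "s > 0" "a [^] j = a [^] i \<otimes> a [^] s" "a [^] j = a [^] s \<otimes> a [^] i"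
      using ij(1) ac nat_pow_mult[OF ac, of i s] nat_pow_mult[OF ac, of s i] by (simp_all add: s_def)
    have e: "a [^] i \<otimes> (w \<otimes> a [^] i) = a [^] i \<otimes> ((a [^] s \<otimes> w \<otimes> a [^] s) \<otimes> a [^] i)"
    proof -
      have "a [^] j \<otimes> w \<otimes> a [^] j = (a [^] i \<otimes> a [^] s) \<otimes> w \<otimes> (a [^] s \<otimes> a [^] i)" using s(2,3) by metis
      then show ?thesis using ij(2) ac w by (simp add: m_assoc)
    qed
    have "w \<otimes> a [^] i = (a [^] s \<otimes> w \<otimes> a [^] s) \<otimes> a [^] i"
      using e ac w by simp
    then have "w = a [^] s \<otimes> w \<otimes> a [^] s" using ac w by simp
    then have "inv (a [^] s) \<otimes> w \<otimes> inv w = inv (a [^] s) \<otimes> (a [^] s \<otimes> w \<otimes> a [^] s) \<otimes> inv w" by simp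
    then have "inv (a [^] s) = w \<otimes> a [^] s \<otimes> inv w" using ac w by (simp add: group_norm)
    then show False using no[OF s(1)] by simp
  qed
  show ?thesis by (rule that) (rule bound)
qed

end

section \<open>The quasi-axis of \<open>w a^n\<close>\<close>

context hyperbolic
begin

lemma gp_nonneg: "w \<in> carrier G \<Longrightarrow> x \<in> carrier G \<Longrightarrow> y \<in> carrier G \<Longrightarrow> gp w x y \<ge> 0"
  using d_triangle[of x w y] d_commute[of x w] gp_double[of w x y] by simp

end

text \<open>The quasi-axis of \<open>h\<close> is the broken path through the powers of
  \<open>h\<close> whose pieces are translates of the path \<open>w a^i\<close>,
  \<open>i \<le> n\<close>. \<open>turn\<close> bounds the backtracking at the powers of
  \<open>h\<close>, and \<open>long\<close> makes the pieces long compared with it, so that local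
  control becomes global. The 3\<delta> is the margin spent in \<open>pow_add\<close>.\<close>

locale quasi_axis = hyperbolic +
  fixes a w :: 'a and n :: nat and R :: real and h :: 'a
  assumes a: "straight a" and w: "w \<in> carrier G" and h_def: "h = w \<otimes> a [^] n"
    and turn: "gp \<one> (inv h) h \<le> R" and long: "len h \<ge> 2 * R + 3 * \<delta> + 1"
begin

lemma ac: "a \<in> carrier G" and la: "len a > 0" and lp: "len (a [^] (m::nat)) = m * len a"
  using straightD[OF a] by simp_all

lemma h: "h \<in> carrier G"
  using ac w by (simp add: h_def)

lemma R_nonneg: "R \<ge> 0"
  using gp_nonneg[of \<one> "inv h" h] turn h by simp

lemma h_pow: "h [^] i \<otimes> h [^] j = h [^] (i + j)" for i j :: nat
  using h by (simp add: nat_pow_mult)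

lemma inv_h_pow: "j \<le> i \<Longrightarrow> inv (h [^] j) \<otimes> h [^] i = h [^] (i - j)" for i j :: nat
  using h h_pow[of j "i - j"] inv_m_cancel(1)[of "h [^] j" "h [^] (i - j)"] by simp

text \<open>By induction \<open>h^(k+1)\<close> is long enough compared with \<open>h^k\<close> to
  start in the direction of \<open>h\<close>. As \<open>turn\<close> separates \<open>h\<close> from
  \<open>h^-1\<close>, it separates \<open>h^(k+1)\<close> from \<open>h^-1\<close> up to \<delta>,
  so one more factor \<open>h\<close> loses little length.\<close>

lemma pow_step: "len (h [^] Suc k) \<ge> len (h [^] k) + real (len h) - 2 * R - 2 * \<delta>"
proof (induction k)
  case 0
  then show ?case using h R_nonneg \<delta>_nonneg by simp
next
  case (Suc k)
  let ?y = "h [^] Suc k"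
  have y: "?y \<in> carrier G" using h by simp
  have "inv ?y \<otimes> h = inv (h [^] k)"
    unfolding nat_pow_Suc2[OF h] using h by (simp add: group_norm)
  then have d1: "d ?y h = len (h [^] k)" using h by (simp add: d_def)
  have d2: "d (inv h) ?y = len (h [^] Suc (Suc k))" using h h_pow[of 1 "Suc k"] by (simp add: d_def del: nat_pow_Suc)
  have d3: "d \<one> h = len h" "d \<one> (inv h) = len h" "d \<one> ?y = len ?y" using h by (simp_all add: d_one del: nat_pow_Suc)
  have "gp \<one> ?y h > R + \<delta>" using gp_double[of \<one> ?y h] d1 d3 Suc long \<delta>_nonneg by linarith
  moreover have "gp \<one> (inv h) h \<ge> min (gp \<one> (inv h) ?y) (gp \<one> ?y h) - \<delta>" using hyp h y by simp
  ultimately have "gp \<one> (inv h) ?y \<le> R + \<delta>" using turn by linarith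
  then show ?case using gp_double[of \<one> "inv h" ?y] d2 d3 by linarith
qed

text \<open>By \<open>long\<close>, each application of \<open>pow_step\<close> gains at least
  1.\<close>

lemma pow_lower: "real (len (h [^] k)) \<ge> real k" for k :: nat
proof (induction k)
  case (Suc k)
  then show ?case using pow_step[of k] long \<delta>_nonneg by simp
qed simp

definition R1 where "R1 = R + 2 * \<delta>"

text \<open>Seen from the identity, \<open>h^j\<close> lies in the direction of \<open>h\<close>,
  and \<open>pow_step\<close> bounds the Gromov product of \<open>h^-i\<close> and \<open>h\<close>.
  So the product of \<open>h^-i\<close> and \<open>h^j\<close> is at most \<open>R1\<close>: the
  path does not backtrack at the identity.\<close>

lemma pow_add: "real (len (h [^] i)) + len (h [^] j) \<le> len (h [^] (i + j)) + 2 * R1" for i j :: nat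
proof -
  consider "j = 0" | "j = 1" | k where "j = Suc (Suc k)" by (metis One_nat_def not0_implies_Suc)
  then show ?thesis
  proof cases
    case 1
    then show ?thesis using R_nonneg \<delta>_nonneg by (simp add: R1_def)
  next
    case 2
    then show ?thesis using pow_step[of i] h \<delta>_nonneg by (simp add: R1_def)
  next
    case 3
    let ?x = "inv (h [^] i)" and ?y = "h [^] j"
    have c: "?x \<in> carrier G" "?y \<in> carrier G" using h by simp_all
    have d1: "d ?x h = len (h [^] Suc i)" using h by (simp add: d_def)
    have d2: "d ?x ?y = len (h [^] (i + j))" using h h_pow by (simp add: d_def)
    have "d h ?y = len (h [^] Suc k)" using h inv_h_pow[of 1 j] 3 by (simp add: d_def del: nat_pow_Suc)
    then have d3: "d ?y h = len (h [^] Suc k)" using d_commute[OF c(2) h] by simp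
    have d4: "d \<one> h = len h" "d \<one> ?x = len (h [^] i)" "d \<one> ?y = len ?y" using h by (simp_all add: d_one)
    have "len ?y \<ge> len (h [^] Suc k) + real (len h) - 2 * R - 2 * \<delta>" using pow_step[of "Suc k"] 3 by simp
    then have "gp \<one> ?y h > R + 2 * \<delta>" using gp_double[of \<one> ?y h] d3 d4 long \<delta>_nonneg by linarith
    moreover have "gp \<one> ?x h \<le> R + \<delta>" using gp_double[of \<one> ?x h] d1 d4 pow_step[of i] by linarith
    moreover have "gp \<one> ?x h \<ge> min (gp \<one> ?x ?y) (gp \<one> ?y h) - \<delta>" using hyp c h by simp
    ultimately have "gp \<one> ?x ?y \<le> R + 2 * \<delta>" by linarith
    then show ?thesis using gp_double[of \<one> ?x ?y] d2 d4 by (simp add: R1_def)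
  qed
qed

abbreviation \<kappa> :: real where "\<kappa> \<equiv> real (len a)"
abbreviation v :: "nat \<Rightarrow> 'a" where "v i \<equiv> w \<otimes> a [^] i"

definition c where "c = R1 + len w"

lemma c_nonneg: "c \<ge> 0"
  using R_nonneg \<delta>_nonneg by (simp add: c_def R1_def)

lemma v: "v i \<in> carrier G"
  using ac w by simp

lemma vn: "v n = h"
  by (simp add: h_def)

lemma d_v: "d (v i) (v (i + m)) = m * \<kappa>"
proof -
  have "v (i + m) = v i \<otimes> a [^] m" using ac w by (simp add: m_assoc nat_pow_mult)
  then show ?thesis using d_mult[OF v, of "a [^] m" i] ac lp by simp
qed

lemma d_one_v: "d \<one> (v i) \<le> len w + i * \<kappa>"
  using d_triangle[of \<one> w "v i"] d_one[OF w] d_mult[OF w, of "a [^] i"] ac w lp by simp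

lemma len_h: "n * \<kappa> \<le> len h + len w"
  using d_triangle[of w \<one> h] d_commute[of w \<one>] d_one[OF w] d_one[OF h] d_mult[OF w, of "a [^] n"] ac w h lp
  by (simp add: h_def)

lemma d_inv_pow: "p \<in> carrier G \<Longrightarrow> d (inv (h [^] (J::nat))) p \<le> len (h [^] J) + d \<one> p"
  using d_triangle[of "inv (h [^] J)" \<one> p] d_commute[of "inv (h [^] J)" \<one>] d_one[of "inv (h [^] J)"] h by simp

lemma d_inv_pow_h: "d (inv (h [^] (J::nat))) h = len (h [^] Suc J)"
  using h by (simp add: d_def)

lemma d_h_pow: "d h (h [^] Suc J) = len (h [^] (J::nat))"
  using h inv_h_pow[of 1 "Suc J"] by (simp add: d_def del: nat_pow_Suc)

text \<open>The path from \<open>h^-J\<close> to \<open>h\<close> loses little length, since powers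
  add up by \<open>pow_add\<close> and the powers of \<open>a\<close> are geodesic once the detour
  through \<open>w\<close> is paid for. So from \<open>v i\<close> the earlier point
  \<open>v (i - m)\<close> lies in the direction of \<open>h^-J\<close>; \<open>c\<close> collects
  the two errors.\<close>

lemma backward:
  assumes "m \<le> i" "i \<le> n"
  shows "gp (v i) (inv (h [^] (J::nat))) (v (i - m)) \<ge> m * \<kappa> - c"
proof -
  let ?X = "inv (h [^] J)"
  have X: "?X \<in> carrier G" using h by simp
  have dq: "d (v i) (v (i - m)) = m * \<kappa>"
    using d_v[of "i - m" m] assms(1) d_commute[OF v v] by simp
  have dXq: "d ?X (v (i - m)) \<le> len (h [^] J) + (len w + real i * \<kappa> - real m * \<kappa>)"
  proof -
    have "real (i - m) * \<kappa> = real i * \<kappa> - real m * \<kappa>" using assms(1) by (simp add: of_nat_diff algebra_simps)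
    then show ?thesis using d_inv_pow[OF v, of J "i - m"] d_one_v[of "i - m"] by linarith
  qed
  have "d (v i) h = real n * \<kappa> - real i * \<kappa>"
    using d_v[of i "n - i"] assms(2) by (simp add: h_def of_nat_diff algebra_simps)
  moreover have "d ?X h \<le> d ?X (v i) + d (v i) h" using d_triangle[OF X v h] .
  moreover have "real (len (h [^] J)) + len h \<le> d ?X h + 2 * R1"
    using pow_add[of J 1] h unfolding d_inv_pow_h by simp
  moreover have "d (v i) ?X = d ?X (v i)" by (rule d_commute[OF v X])
  ultimately have "2 * gp (v i) ?X (v (i - m)) \<ge> 2 * (m * \<kappa>) - 2 * len w - 2 * R1"
    using gp_double[of "v i" ?X "v (i - m)"] dq dXq len_h by linarith
  then show ?thesis by (simp add: c_def)
qed

text \<open>This is \<open>backward\<close> at the end \<open>v n = h\<close> of the piece,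
  translated by \<open>h^-1\<close>.\<close>

lemma backward_one:
  assumes "m \<le> n"
  shows "gp \<one> (inv (a [^] m)) (inv (h [^] Suc J)) \<ge> m * \<kappa> - c"
proof -
  have "gp \<one> (inv (a [^] m)) (inv (h [^] Suc J)) = gp (h \<otimes> \<one>) (h \<otimes> inv (a [^] m)) (h \<otimes> inv (h [^] Suc J))"
    using h ac by (intro gp_translate[symmetric]) (simp_all del: nat_pow_Suc)
  moreover have "h \<otimes> inv (a [^] m) = v (n - m)"
  proof -
    have "a [^] n = a [^] (n - m) \<otimes> a [^] m" using ac assms by (simp add: nat_pow_mult)
    then show ?thesis unfolding h_def using ac w by (simp add: group_norm)
  qed
  moreover have "h \<otimes> inv (h [^] Suc J) = inv (h [^] J)"
    using h by (simp add: group_norm)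
  ultimately have "gp \<one> (inv (a [^] m)) (inv (h [^] Suc J)) = gp h (v (n - m)) (inv (h [^] J))" using h by simp
  also have "\<dots> = gp h (inv (h [^] J)) (v (n - m))" using h v by (intro gp_commute) simp_all
  finally show ?thesis using backward[of m n J] assms by (simp add: vn)
qed

lemma forward:
  assumes "i + m \<le> n"
  shows "gp (v i) (h [^] Suc J) (v (i + m)) \<ge> m * \<kappa> - c"
proof -
  let ?Y = "h [^] Suc J"
  have Y: "?Y \<in> carrier G" using h by (simp del: nat_pow_Suc)
  have "d (v (i + m)) h = real n * \<kappa> - real i * \<kappa> - real m * \<kappa>"
    using d_v[of "i + m" "n - (i + m)"] assms by (simp add: h_def of_nat_diff algebra_simps)
  moreover have "d (v (i + m)) ?Y \<le> d (v (i + m)) h + d h ?Y" using d_triangle[OF v h Y] .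
  moreover have "d \<one> ?Y \<le> d \<one> (v i) + d (v i) ?Y" using d_triangle[OF _ v Y] by simp
  moreover have "real (len (h [^] J)) + len h \<le> d \<one> ?Y + 2 * R1"
    using pow_add[of J 1] h d_one[OF Y] by simp
  ultimately have "2 * gp (v i) ?Y (v (i + m)) \<ge> 2 * (m * \<kappa>) - 2 * len w - 2 * R1"
    using gp_double[of "v i" ?Y "v (i + m)"] d_v[of i m] d_h_pow[of J] d_one_v[of i] len_h d_commute[OF Y v, of "i + m"]
    by linarith
  then show ?thesis by (simp add: c_def)
qed

text \<open>Joining \<open>h^-e\<close>, the piece up to \<open>v i\<close>, its rest up to
  \<open>h\<close>, and the remaining powers loses \<open>2 R1\<close> at each of two joints and
  \<open>len w\<close> twice. This bounds twice the Gromov product.\<close>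

lemma on_axis:
  assumes "i \<le> n"
  shows "gp (v i) (inv (h [^] (e::nat))) (h [^] Suc E) \<le> 2 * R1 + len w"
proof -
  let ?X = "inv (h [^] e)" and ?Y = "h [^] Suc E"
  have c: "?X \<in> carrier G" "?Y \<in> carrier G" using h by (simp_all del: nat_pow_Suc)
  have "d (v i) ?X \<le> len (h [^] e) + (len w + i * \<kappa>)"
    using d_inv_pow[OF v, of e i] d_one_v[of i] d_commute[OF v c(1)] by simp
  moreover have "d (v i) h = real n * \<kappa> - real i * \<kappa>"
    using d_v[of i "n - i"] assms by (simp add: h_def of_nat_diff algebra_simps)
  moreover have "d (v i) ?Y \<le> d (v i) h + d h ?Y" using d_triangle[OF v h c(2)] .
  moreover have "d ?X ?Y = len (h [^] (e + 1 + E))" using h h_pow[of e "Suc E"] by (simp add: d_def del: nat_pow_Suc)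
  moreover have "real (len (h [^] e)) + len h \<le> len (h [^] (e + 1)) + 2 * R1" using pow_add[of e 1] h by simp
  moreover have "real (len (h [^] (e + 1))) + len (h [^] E) \<le> len (h [^] (e + 1 + E)) + 2 * R1" by (rule pow_add)
  ultimately show ?thesis
    using gp_double[of "v i" ?X ?Y] d_h_pow[of E] len_h by linarith
qed

text \<open>Since \<open>f z = z f\<close>, the point \<open>z\<close> is moved by
  \<open>len f\<close> only, however far away it is.\<close>

lemma commute_far:
  assumes f: "f \<in> carrier G" and z: "z \<in> carrier G" "f \<otimes> z = z \<otimes> f" and q: "q \<in> carrier G"
  shows "gp q z (f \<otimes> z) \<ge> d \<one> z - d \<one> q - len f"
proof -
  have "d z (f \<otimes> z) = len f" unfolding z(2) by (rule d_mult[OF z(1) f])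
  then show ?thesis
    using gp_near[of q z "f \<otimes> z"] d_triangle[of \<one> q z] q z(1) f by simp
qed

text \<open>The bound of \<open>near_if_same_position\<close> for Gromov products at most
  \<open>2 R1 + 2\<delta> + len w\<close> and positions agreeing up to
  \<open>len w + len a\<close>.\<close>

definition R3 where "R3 = 2 * (2 * R1 + 2 * \<delta> + len w) + (len w + len a) + 2 * \<delta>"

text \<open>\<open>f\<close> moves \<open>h^J\<close> and \<open>h^-J\<close> only by
  \<open>len f\<close>, so it lies near the quasi-axis between them, as in
  \<open>straight_axis_near\<close>. A power of \<open>h\<close> brings it to the piece between the
  identity and \<open>h\<close>, where the distance from the far end selects
  \<open>i\<close>.\<close>

lemma commuting_near_axis:
  assumes f: "f \<in> carrier G" "f \<otimes> h = h \<otimes> f"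
  shows "\<exists>(k::int) i. i \<le> n \<and> d (h [^] k \<otimes> f) (v i) \<le> R3"
proof -
  obtain J :: nat where J: "real J > 2 * R1 + 2 * \<delta> + 2 * len f" using reals_Archimedean2 by blast
  have R1: "R1 \<ge> 0" using R_nonneg \<delta>_nonneg by (simp add: R1_def)
  have J0: "J > 0" using J R1 \<delta>_nonneg by (cases J) auto
  define X Y where "X = inv (h [^] J)" and "Y = h [^] J"
  have XY: "X \<in> carrier G" "Y \<in> carrier G" using h by (simp_all add: X_def Y_def)
  have lY: "d \<one> X = len (h [^] J)" "d \<one> Y = len (h [^] J)" using XY h by (simp_all add: d_one X_def Y_def)
  have fY: "f \<otimes> Y = Y \<otimes> f" unfolding Y_def by (rule commute_nat_pow[OF f(1) h f(2)])
  have fX: "f \<otimes> X = X \<otimes> f" using commute_inv[OF f(1) XY(2) fY] by (simp add: X_def Y_def)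
  have dXY: "d X Y = len (h [^] (J + J))" using h h_pow by (simp add: d_def X_def Y_def)
  have "gp \<one> X Y \<le> R1" using gp_double[of \<one> X Y] pow_add[of J J] dXY lY by simp
  then have g1: "gp f (f \<otimes> X) (f \<otimes> Y) \<le> R1" using gp_translate[of f \<one> X Y] f XY by simp
  have big: "real (len (h [^] J)) > 2 * R1 + 2 * \<delta> + 2 * len f" using pow_lower[of J] J by simp
  have lf: "d \<one> f = len f" using f d_one by simp
  have "gp f X (f \<otimes> X) > R1 + 2 * \<delta>" "gp f Y (f \<otimes> Y) > R1 + 2 * \<delta>"
    using commute_far[OF f(1) XY(1) fX f(1)] commute_far[OF f(1) XY(2) fY f(1)] lY lf big R1 by linarith+
  then have gf: "gp f X Y \<le> R1 + 2 * \<delta>" using gp_perturb[of f X Y "f \<otimes> X" "f \<otimes> Y" R1] g1 f XY by simp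
  define D where "D = d X f"
  have D: "D < len (h [^] Suc (2 * J - 1))"
  proof -
    have "D \<le> len (h [^] J) + len f" unfolding D_def X_def using d_inv_pow[OF f(1), of J] lf by simp
    moreover have "2 * real (len (h [^] J)) \<le> len (h [^] (J + J)) + 2 * R1" using pow_add[of J J] by simp
    moreover have "Suc (2 * J - 1) = J + J" using J0 by simp
    ultimately show ?thesis using big \<delta>_nonneg by simp
  qed
  \<comment> \<open>\<open>D\<close> lies between the distances of \<open>h^-e\<close> to the
    identity and to \<open>h\<close>. Translating by \<open>t = h^(J-e)\<close> takes
    \<open>X\<close> to \<open>h^-e\<close> and therefore brings \<open>f\<close> next to the piece
    from the identity to \<open>h\<close>.\<close>
  define e where "e = (LEAST e. D < len (h [^] Suc e))"
  have e1: "D < len (h [^] Suc e)" unfolding e_def by (rule LeastI[of _ "2 * J - 1"]) (rule D)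
  have e2: "e \<le> 2 * J - 1" unfolding e_def by (rule Least_le) (rule D)
  have e3: "len (h [^] e) \<le> D"
  proof (cases e)
    case 0
    then show ?thesis by (simp add: D_def)
  next
    case (Suc e')
    then have "\<not> D < len (h [^] Suc e')" using not_less_Least[of e' "\<lambda>e. D < len (h [^] Suc e)"] by (simp add: e_def)
    then show ?thesis using Suc by simp
  qed
  define E where "E = 2 * J - 1 - e"
  define t where "t = inv (h [^] e) \<otimes> h [^] J"
  have t: "t \<in> carrier G" using h by (simp add: t_def)
  have tX: "t \<otimes> X = inv (h [^] e)" unfolding t_def X_def using h by (simp add: group_norm)
  have tY: "t \<otimes> Y = h [^] Suc E"
  proof -
    have "t \<otimes> Y = inv (h [^] e) \<otimes> h [^] (J + J)" unfolding t_def Y_def using h h_pow[of J J] by (simp add: m_assoc)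
    also have "\<dots> = h [^] (J + J - e)" using e2 by (intro inv_h_pow) simp
    also have "J + J - e = Suc E" using e2 J0 by (simp add: E_def)
    finally show ?thesis .
  qed
  let ?X = "inv (h [^] e)" and ?Y = "h [^] Suc E" and ?g = "t \<otimes> f"
  have c: "?X \<in> carrier G" "?Y \<in> carrier G" "?g \<in> carrier G" using h t f by (simp_all del: nat_pow_Suc)
  have gg: "gp ?g ?X ?Y \<le> R1 + 2 * \<delta>"
    using gf gp_translate[OF t f(1) XY] unfolding tX tY by simp
  have dg: "d ?X ?g = D" using d_translate[OF t XY(1) f(1)] unfolding tX by (simp add: D_def)
  have n1: "D \<le> d ?X (v n)" using e1 d_inv_pow_h[of e] by (simp add: vn)
  \<comment> \<open>The first \<open>v i\<close> whose distance from \<open>h^-e\<close> reaches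
    \<open>D\<close>. It overshoots by at most \<open>len a\<close>, or by \<open>len w\<close> if
    \<open>i = 0\<close>.\<close>
  define i where "i = (LEAST i. D \<le> d ?X (v i))"
  have i1: "D \<le> d ?X (v i)" unfolding i_def by (rule LeastI[of _ n]) (rule n1)
  have i2: "i \<le> n" unfolding i_def by (rule Least_le) (rule n1)
  have i3: "d ?X (v i) \<le> D + (len w + len a)"
  proof (cases i)
    case 0
    have "d ?X \<one> = len (h [^] e)" using h by (simp add: d_def)
    then show ?thesis using 0 d_triangle[of ?X \<one> "v 0"] d_one_v[of 0] e3 c(1) v[of 0] w by simp
  next
    case (Suc i')
    then have "\<not> D \<le> d ?X (v i')" using not_less_Least[of i' "\<lambda>i. D \<le> d ?X (v i)"] by (simp add: i_def)
    moreover have "d ?X (v i) \<le> d ?X (v i') + d (v i') (v i)" by (rule d_triangle[OF c(1) v v])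
    moreover have "d (v i') (v i) = \<kappa>" using d_v[of i' 1] Suc by simp
    ultimately show ?thesis by simp
  qed
  have "d ?g (v i) \<le> 2 * (2 * R1 + 2 * \<delta> + len w) + (len w + len a) + 2 * \<delta>"
  proof (rule near_if_same_position[OF c(1,2,3) v])
    show "gp ?g ?X ?Y \<le> 2 * R1 + 2 * \<delta> + len w" using gg R1 by simp
    show "gp (v i) ?X ?Y \<le> 2 * R1 + 2 * \<delta> + len w" using on_axis[OF i2, of e E] \<delta>_nonneg by simp
    show "\<bar>d ?X ?g - d ?X (v i)\<bar> \<le> len w + len a" using i1 i3 dg by simp
  qed
  moreover have "t = h [^] (int J - int e)"
  proof -
    have "t = h [^] (- int e) \<otimes> h [^] int J"
      unfolding t_def using h by (simp add: int_pow_neg_int int_pow_int)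
    also have "\<dots> = h [^] (- int e + int J)" using h by (simp only: int_pow_mult)
    finally show ?thesis by simp
  qed
  ultimately show ?thesis using i2 by (auto simp: R3_def)
qed

definition R4 where "R4 = 2 * c + 3 * (R3 + len w) + 4 * \<delta>"

text \<open>\<open>f\<close> carries the segment from \<open>u\<close> to \<open>p\<close>, which
  heads for \<open>z\<close>, to one that starts near \<open>q\<close> and heads for
  \<open>f z\<close>. As \<open>z\<close> and \<open>f z\<close> are far away and close together,
  this segment and the one from \<open>q\<close> to \<open>r\<close>, which heads for
  \<open>z\<close> and has the same length, end close together.\<close>

lemma fellow_travel:
  assumes f: "f \<in> carrier G" "f \<otimes> h = h \<otimes> f" and u: "u \<in> carrier G" and z: "z \<in> carrier G" "f \<otimes> z = z \<otimes> f"
    and far: "d \<one> z \<ge> m * \<kappa> + 2 * len f + len u" and q: "q \<in> carrier G" and p: "p \<in> carrier G" and r: "r \<in> carrier G"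
    and near: "d (f \<otimes> u) q \<le> M" and dp: "d u p = m * \<kappa>" and dr: "d q r = m * \<kappa>"
    and gp1: "gp u p z \<ge> m * \<kappa> - c" and gp2: "gp q z r \<ge> m * \<kappa> - c"
  shows "d r (f \<otimes> p) \<le> 2 * c + 3 * M + 4 * \<delta>"
proof -
  let ?b = "f \<otimes> u"
  have b: "?b \<in> carrier G" "f \<otimes> z \<in> carrier G" "f \<otimes> p \<in> carrier G" using f u z p by simp_all
  have M: "M \<ge> 0" using near d_nonneg[of ?b q] by linarith
  have 1: "gp ?b (f \<otimes> p) (f \<otimes> z) \<ge> m * \<kappa> - c" using gp1 gp_translate[OF f(1) u p z(1)] by simp
  have "d \<one> ?b \<le> len f + len u" using d_one[OF b(1)] len_mult[OF f(1) u] by simp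
  then have 2: "gp ?b z (f \<otimes> z) \<ge> m * \<kappa>" using commute_far[OF f(1) z b(1)] far by linarith
  have 3: "gp ?b z r \<ge> m * \<kappa> - c - M" using gp2 gp_base[OF b(1) q z(1) r] near by linarith
  have "gp ?b (f \<otimes> p) z \<ge> min (gp ?b (f \<otimes> p) (f \<otimes> z)) (gp ?b (f \<otimes> z) z) - \<delta>" using hyp b z by simp
  moreover have "gp ?b (f \<otimes> z) z = gp ?b z (f \<otimes> z)" using b z by (intro gp_commute)
  moreover have "gp ?b (f \<otimes> p) r \<ge> min (gp ?b (f \<otimes> p) z) (gp ?b z r) - \<delta>" using hyp b z r by simp
  ultimately have 4: "gp ?b (f \<otimes> p) r \<ge> m * \<kappa> - c - M - 2 * \<delta>" using 1 2 3 M c_nonneg \<delta>_nonneg by linarith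
  have "d ?b (f \<otimes> p) = m * \<kappa>" using d_translate[OF f(1) u p] dp by simp
  moreover have "d ?b r \<le> M + m * \<kappa>" using d_triangle[OF b(1) q r] near dr by simp
  moreover have "d r (f \<otimes> p) = d (f \<otimes> p) r" by (rule d_commute[OF r b(3)])
  ultimately show ?thesis using gp_double[of ?b "f \<otimes> p" r] 4 by linarith
qed

text \<open>\<open>f\<close> is near \<open>v i\<close> and hardly moves the far ends of the axis,
  relative to their distance. So it carries the path around the identity to the path around
  \<open>v i\<close>: the incoming points \<open>a^-m\<close> backwards, and the outgoing piece
  \<open>v m\<close> forwards. The latter starts at \<open>w\<close>, which adds
  \<open>len w\<close> to the initial distance.\<close>

lemma translates:
  assumes f: "f \<in> carrier G" "f \<otimes> h = h \<otimes> f" and i: "i \<le> n" "d f (v i) \<le> R3"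
  shows "m \<le> i \<Longrightarrow> d (v (i - m)) (f \<otimes> inv (a [^] m)) \<le> R4"
    and "i + m \<le> n \<Longrightarrow> d (v (i + m)) (f \<otimes> v m) \<le> R4"
proof -
  obtain J :: nat where J: "real J > n * \<kappa> + 2 * len f + len w" using reals_Archimedean2 by blast
  have big: "real (len (h [^] Suc J)) \<ge> n * \<kappa> + 2 * len f + len w" using pow_lower[of "Suc J"] J by simp
  let ?Y = "h [^] Suc J"
  have Y: "?Y \<in> carrier G" using h by (simp del: nat_pow_Suc)
  have fY: "f \<otimes> ?Y = ?Y \<otimes> f" by (rule commute_nat_pow[OF f(1) h f(2)])
  have fX: "f \<otimes> inv ?Y = inv ?Y \<otimes> f" by (rule commute_inv[OF f(1) Y fY])
  have mn: "m * \<kappa> \<le> n * \<kappa>" if "m \<le> n" for m using that by (simp add: mult_right_mono)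
  {
    assume m: "m \<le> i"
    have "d (v (i - m)) (f \<otimes> inv (a [^] m)) \<le> 2 * c + 3 * R3 + 4 * \<delta>"
    proof (rule fellow_travel[OF f one_closed, of "inv ?Y" m "v i"])
      show "d \<one> (inv ?Y) \<ge> m * \<kappa> + 2 * len f + len \<one>"
        using big mn[of m] m i Y d_one[of "inv ?Y"] by simp
      show "d \<one> (inv (a [^] m)) = m * \<kappa>" using ac lp by (simp add: d_one)
      show "d (v i) (v (i - m)) = m * \<kappa>" using d_v[of "i - m" m] m d_commute[OF v v] by simp
      show "gp \<one> (inv (a [^] m)) (inv ?Y) \<ge> m * \<kappa> - c" by (rule backward_one) (use m i in simp)
      show "gp (v i) (inv ?Y) (v (i - m)) \<ge> m * \<kappa> - c" by (rule backward[OF m i(1)])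
    qed (use Y fX v i f ac in \<open>simp_all del: nat_pow_Suc\<close>)
    then show "d (v (i - m)) (f \<otimes> inv (a [^] m)) \<le> R4" by (simp add: R4_def)
  next
    assume m: "i + m \<le> n"
    have "d (v (i + m)) (f \<otimes> v m) \<le> 2 * c + 3 * (R3 + len w) + 4 * \<delta>"
    proof (rule fellow_travel[OF f w, of ?Y m "v i"])
      show "d \<one> ?Y \<ge> m * \<kappa> + 2 * len f + len w"
        using big mn[of m] m Y d_one[of ?Y] by simp
      show "d w (v m) = m * \<kappa>" using d_v[of 0 m] w by simp
      show "d (v i) (v (i + m)) = m * \<kappa>" by (rule d_v)
      have "gp w ?Y (v m) \<ge> m * \<kappa> - c" using forward[of 0 m J] m w by simp
      then show "gp w (v m) ?Y \<ge> m * \<kappa> - c" using gp_commute[OF v Y] by simp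
      show "gp (v i) ?Y (v (i + m)) \<ge> m * \<kappa> - c" by (rule forward[OF m])
      have "d (f \<otimes> w) f = len w"
        using d_commute[of "f \<otimes> w" f] d_mult[OF f(1) w] f(1) w by simp
      then show "d (f \<otimes> w) (v i) \<le> R3 + len w"
        using d_triangle[of "f \<otimes> w" f "v i"] i(2) f(1) w v by simp
    qed (use Y fY v f in \<open>simp_all del: nat_pow_Suc\<close>)
    then show "d (v (i + m)) (f \<otimes> v m) \<le> R4" by (simp add: R4_def)
  }
qed

end

section \<open>An element whose centralizer lies in a given normal subgroup of finite index\<close>

context hyperbolic
begin

lemma exists_repetition:
  fixes e :: "nat \<Rightarrow> 'a"
  assumes "finite B" "card B \<le> k" "\<And>m. m \<le> k \<Longrightarrow> e m \<in> B"
  obtains m s where "s > 0" "m + s \<le> k" "e m = e (m + s)"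
proof -
  have "\<not> inj_on e {0..k}"
  proof
    assume "inj_on e {0..k}"
    then have "card {0..k} \<le> card B" using assms(1,3) by (intro card_inj_on_le) auto
    then show False using assms(2) by simp
  qed
  then obtain i j where ij: "i < j" "j \<le> k" "e i = e j"
    unfolding inj_on_def by (metis atLeastAtMost_iff linorder_neqE_nat)
  then show ?thesis using that[of "j - i" i] by simp
qed

lemma commute_of_conj_eq:
  assumes "p \<in> carrier G" "q \<in> carrier G" "y \<in> carrier G" "b \<in> carrier G"
    and "p \<otimes> (inv b \<otimes> y) \<otimes> q = p \<otimes> (y \<otimes> inv b) \<otimes> q"
  shows "y \<otimes> b = b \<otimes> y"
proof -
  have "inv b \<otimes> y = y \<otimes> inv b" using assms by simp
  then have "y \<otimes> inv b = inv b \<otimes> y" by simp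
  from commute_inv[OF assms(3) inv_closed[OF assms(4)] this] show ?thesis using assms(4) by simp
qed

text \<open>Multiplied by a power of \<open>h\<close>, a commuting element becomes some
  \<open>g\<close> near \<open>v i\<close>. If \<open>i\<close> were far from both ends,
  \<open>g\<close> would match the powers of \<open>a\<close> before and after the corner
  \<open>w\<close> at the identity with powers of \<open>a\<close> around \<open>v i\<close>. By
  pigeonhole \<open>w^-1 g\<close> and \<open>w^-1 g w\<close> would commute with powers of
  \<open>a\<close>, hence with \<open>a\<close>, and so would \<open>w\<close>. Thus
  \<open>i\<close> is near 0 or \<open>n\<close>, and \<open>g\<close> or \<open>h^-1 g\<close> is
  short.\<close>

lemma centralizer_bounded:
  assumes a: "full_centralizer a" and w: "w \<in> carrier G" "w \<notin> centralizer_of a"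
    and no: "\<And>s::nat. s > 0 \<Longrightarrow> w \<otimes> a [^] s \<otimes> inv w \<noteq> inv (a [^] s)"
  shows "\<exists>D n0. \<forall>n\<ge>n0. \<forall>f\<in>carrier G. f \<otimes> (w \<otimes> a [^] n) = (w \<otimes> a [^] n) \<otimes> f \<longrightarrow>
     (\<exists>k::int. len ((w \<otimes> a [^] (n::nat)) [^] k \<otimes> f) \<le> D)"
proof -
  have sa: "straight a" by (rule full_centralizerD(1)[OF a])
  note ac = straightD(1)[OF sa] and la = straightD(2)[OF sa] and lp = straightD(3)[OF sa]
  obtain R0 where R0: "\<And>(m::nat) (n::nat). gp \<one> (inv (a [^] n)) (w \<otimes> a [^] m) \<le> R0"
    using opposite_rays_diverge[OF sa w(1) no] by metis
  \<comment> \<open>\<open>h^-1 = a^-n w^-1\<close> is at distance \<open>len w\<close> from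
    \<open>a^-n\<close>, to which \<open>R0\<close> refers.\<close>
  define R where "R = R0 + len w"
  obtain n0 :: nat where n0: "real n0 > 2 * R + 3 * \<delta> + 1 + len w" using reals_Archimedean2 by blast
  \<comment> \<open>The constants of the locale involve neither \<open>n\<close> nor
    \<open>h\<close>; this makes the final bound \<open>D\<close> uniform in
    \<open>n\<close>.\<close>
  define r3 where "r3 = quasi_axis.R3 G S \<delta> a w R"
  define r4 where "r4 = quasi_axis.R4 G S \<delta> a w R"
  define B where "B = {g \<in> carrier G. real (len g) \<le> r4}"
  have "B \<subseteq> {g \<in> carrier G. len g \<le> nat \<lceil>r4\<rceil>}"
    by (auto simp: B_def) linarith
  then have B: "finite B" using finite_ball finite_subset by blast
  define D where "D = nat \<lceil>len w + card B * len a + r3\<rceil>"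
  have "\<exists>k::int. len ((w \<otimes> a [^] n) [^] k \<otimes> f) \<le> D"
    if n: "n \<ge> n0" and f: "f \<in> carrier G" "f \<otimes> (w \<otimes> a [^] n) = (w \<otimes> a [^] n) \<otimes> f" for n :: nat and f
  proof -
    define h where "h = w \<otimes> a [^] n"
    have hc: "h \<in> carrier G" using w(1) ac by (simp add: h_def)
    interpret Q: quasi_axis G S \<delta> a w n R h
    proof unfold_locales
      show "straight a" by (rule sa)
      show "w \<in> carrier G" by (rule w(1))
      show "h = w \<otimes> a [^] n" by (rule h_def)
      have "inv h = inv (a [^] n) \<otimes> inv w" using w(1) ac by (simp add: h_def inv_mult_group)
      then have "d (inv (a [^] n)) (inv h) = len w" using d_mult[of "inv (a [^] n)" "inv w"] w(1) ac by simp
      then show "gp \<one> (inv h) h \<le> R"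
        using gp_move[of \<one> "inv (a [^] n)" "inv h" h] R0[of n n] hc ac unfolding R_def h_def[symmetric] by simp
      have "d w h = n * len a" using d_mult[OF w(1), of "a [^] n"] ac lp by (simp add: h_def)
      then have "n * len a \<le> real (len w) + len h"
        using d_triangle[of w \<one> h] d_commute[of w \<one>] d_one[of w] d_one[of h] w(1) hc by simp
      moreover have "real n * 1 \<le> real n * real (len a)" using la by (intro mult_left_mono) simp_all
      ultimately show "len h \<ge> 2 * R + 3 * \<delta> + 1" using n0 n by simp
    qed
    have fh: "f \<otimes> h = h \<otimes> f" using f(2) by (simp add: h_def)
    obtain k :: int and i where ki: "i \<le> n" "d (h [^] k \<otimes> f) (w \<otimes> a [^] i) \<le> r3"
      using Q.commuting_near_axis[OF f(1) fh] unfolding r3_def by blast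
    define g where "g = h [^] k \<otimes> f"
    have g: "g \<in> carrier G" using hc f(1) by (simp add: g_def)
    have kh: "h [^] k \<otimes> h = h \<otimes> h [^] k" using commute_int_pow[OF hc hc, of k] by simp
    have gh: "g \<otimes> h = h \<otimes> g"
      unfolding g_def by (rule commute_mult) (use hc f(1) fh kh in simp_all)
    have vc: "w \<otimes> a [^] j \<in> carrier G" for j :: nat using w(1) ac by simp
    have gi: "d g (w \<otimes> a [^] i) \<le> quasi_axis.R3 G S \<delta> a w R" using ki(2) by (simp add: g_def r3_def)
    have "i < card B \<or> n - i < card B"
    proof (rule ccontr)
      assume "\<not> ?thesis"
      then have big: "card B \<le> i" "card B \<le> n - i" by simp_all
      define y where "y = inv w \<otimes> g"
      have y: "y \<in> carrier G" using w(1) g by (simp add: y_def)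
      have "\<exists>s>0. y \<otimes> a [^] (s::nat) = a [^] s \<otimes> y"
      proof -
        \<comment> \<open>\<open>e m = a^-(i-m) y a^-m\<close> is the gap between the two paths. Its
          values lie in the finite ball \<open>B\<close>, and a repetition cancels down to
          \<open>y\<close> commuting with \<open>a^s\<close>.\<close>
        define e where "e m = inv (w \<otimes> a [^] (i - m)) \<otimes> (g \<otimes> inv (a [^] m))" for m :: nat
        have mem: "e m \<in> B" if "m \<le> i" for m
          using Q.translates(1)[OF g gh ki(1) gi that] g w(1) ac by (simp add: B_def e_def r4_def d_def)
        obtain m s where ms: "s > 0" "m + s \<le> i" "e m = e (m + s)"
          by (rule exists_repetition[OF B big(1) mem])
        have p1: "a [^] (i - m) = a [^] s \<otimes> a [^] (i - (m + s))"
          using ac ms(2) by (simp add: nat_pow_mult)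
        have p2: "a [^] (m + s) = a [^] m \<otimes> a [^] s" using ac by (simp add: nat_pow_mult)
        have "inv (a [^] (i - (m + s))) \<otimes> (inv (a [^] s) \<otimes> y) \<otimes> inv (a [^] m) = e m"
          unfolding e_def p1 y_def using w(1) ac g by (simp add: group_norm)
        also have "e m = inv (a [^] (i - (m + s))) \<otimes> (y \<otimes> inv (a [^] s)) \<otimes> inv (a [^] m)"
          unfolding ms(3) unfolding e_def p2 y_def using w(1) ac g by (simp add: group_norm)
        finally have "y \<otimes> a [^] s = a [^] s \<otimes> y"
          by (rule commute_of_conj_eq[rotated 4]) (use y ac in simp_all)
        then show ?thesis using ms(1) by blast
      qed
      then have ya: "y \<otimes> a = a \<otimes> y" using full_centralizerD(3)[OF a y] by blast
      define y2 where "y2 = inv w \<otimes> g \<otimes> w"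
      have y2: "y2 \<in> carrier G" using w(1) g by (simp add: y2_def)
      have "\<exists>s>0. y2 \<otimes> a [^] (s::nat) = a [^] s \<otimes> y2"
      proof -
        define e where "e m = inv (w \<otimes> a [^] (i + m)) \<otimes> (g \<otimes> (w \<otimes> a [^] m))" for m :: nat
        have mem: "e m \<in> B" if "m \<le> n - i" for m
          using Q.translates(2)[OF g gh ki(1) gi, of m] that ki(1) g w(1) ac by (simp add: B_def e_def r4_def d_def)
        obtain m s where ms: "s > 0" "m + s \<le> n - i" "e m = e (m + s)"
          by (rule exists_repetition[OF B big(2) mem])
        have p1: "a [^] (i + (m + s)) = a [^] s \<otimes> a [^] (i + m)"
          using ac by (simp add: nat_pow_mult add_ac)
        have p2: "a [^] (m + s) = a [^] s \<otimes> a [^] m" using ac by (simp add: nat_pow_mult add_ac)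
        have "inv (a [^] (i + m)) \<otimes> (inv (a [^] s) \<otimes> y2) \<otimes> (a [^] s \<otimes> a [^] m) = e (m + s)"
          unfolding e_def p1 p2 y2_def using w(1) ac g by (simp add: group_norm)
        also have "e (m + s) = inv (a [^] (i + m)) \<otimes> (y2 \<otimes> inv (a [^] s)) \<otimes> (a [^] s \<otimes> a [^] m)"
          unfolding ms(3)[symmetric] unfolding e_def y2_def using w(1) ac g by (simp add: group_norm)
        finally have "y2 \<otimes> a [^] s = a [^] s \<otimes> y2"
          by (rule commute_of_conj_eq[rotated 4]) (use y2 ac in simp_all)
        then show ?thesis using ms(1) by blast
      qed
      then have y2a: "y2 \<otimes> a = a \<otimes> y2" using full_centralizerD(3)[OF a y2] by blast
      interpret C: subgroup "centralizer_of a" G by (rule subgroup_centralizer_of[OF ac])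
      have "inv y \<otimes> y2 \<in> centralizer_of a"
        using y y2 ya y2a by (intro C.m_closed C.m_inv_closed) (simp_all add: mem_centralizer_of)
      moreover have "inv y \<otimes> y2 = w" unfolding y_def y2_def using w(1) g by (simp add: group_norm)
      ultimately show False using w(2) by simp
    qed
    then show ?thesis
    proof
      assume "i < card B"
      then have "real i * len a \<le> real (card B) * len a" by (intro mult_right_mono) simp_all
      moreover have "d \<one> g \<le> d \<one> (w \<otimes> a [^] i) + d (w \<otimes> a [^] i) g" using d_triangle[of \<one> "w \<otimes> a [^] i" g] vc g by simp
      ultimately have "real (len g) \<le> len w + card B * len a + r3"
        using Q.d_one_v[of i] ki(2) d_commute[OF g vc, of i] d_one[OF g] by (simp add: g_def)
      then have "len g \<le> D" unfolding D_def by linarith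
      then show ?thesis by (auto simp: g_def h_def)
    next
      \<comment> \<open>Here \<open>g\<close> is near \<open>h\<close> instead of the identity; one
        more factor \<open>h^-1\<close> makes it short.\<close>
      assume "n - i < card B"
      then have "real (n - i) * len a \<le> real (card B) * len a" by (intro mult_right_mono) simp_all
      moreover have "d h g \<le> d h (w \<otimes> a [^] i) + d (w \<otimes> a [^] i) g" using d_triangle[of h "w \<otimes> a [^] i" g] vc g hc by simp
      moreover have "d h (w \<otimes> a [^] i) = real (n - i) * len a"
        using Q.d_v[of i "n - i"] ki(1) d_commute[OF hc vc, of i] by (simp add: h_def)
      ultimately have "d h g \<le> len w + card B * len a + r3"
        using ki(2) d_commute[OF g vc, of i] by (simp add: g_def)
      then have "len (inv h \<otimes> g) \<le> D" unfolding D_def d_def by linarith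
      moreover have "inv h \<otimes> g = h [^] (- 1 + k) \<otimes> f"
        unfolding g_def int_pow_mult[OF hc] using hc f(1) by (simp add: int_pow_neg m_assoc)
      ultimately show ?thesis unfolding h_def by metis
    qed
  qed
  then show ?thesis by blast
qed

text \<open>If each \<open>w a^n\<close> commuted with an element outside \<open>N\<close>, then for
  large \<open>n\<close> a power of \<open>w a^n\<close>, being in \<open>N\<close>, would bring it
  into a fixed ball, and some \<open>f\<close> would serve two exponents. Then \<open>f\<close>
  commutes with a power of \<open>a\<close>, hence with \<open>a\<close> and \<open>w\<close>. Some
  power of \<open>f\<close> is a power of \<open>a\<close>: if it is trivial, \<open>f\<close> is a
  torsion element whose centralizer \<open>w\<close> avoids; otherwise \<open>w\<close> commutes
  with a power of \<open>a\<close>, hence with \<open>a\<close>.\<close>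

lemma exists_centralizer_in_normal:
  assumes ne: "\<not> elementary_group G" and nf: "no_nontrivial_finite_normal_subgroup G"
    and N: "N \<lhd> G" "finite (rcosets N)"
  shows "\<exists>h\<in>N. \<forall>f\<in>carrier G. f \<otimes> h = h \<otimes> f \<longrightarrow> f \<in> N"
proof -
  interpret N: normal N G by (rule N(1))
  obtain a where a: "a \<in> N" "full_centralizer a"
    by (rule exists_full_centralizer[OF infinite_carrier[OF ne] N])
  have sa: "straight a" and ac: "a \<in> carrier G" using full_centralizerD[OF a(2)] by simp_all
  let ?C = "centralizer_of a"
  interpret C: subgroup ?C G by (rule subgroup_centralizer_of[OF ac])
  have Cinf: "infinite (rcosets ?C)" by (rule infinite_index_centralizer[OF ne sa])
  define T where "T = {t \<in> ?C. \<exists>n>0. t [^] (n::nat) = \<one>} - {\<one>}"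
  have T: "finite T" unfolding T_def using finite_torsion_centralizer[OF sa] by simp
  \<comment> \<open>By Dietzmann's lemma, a torsion element whose centralizer has finite index lies
    in a finite normal subgroup, which is trivial by hypothesis.\<close>
  have Tinf: "infinite (rcosets (centralizer_of t))" and Tc: "t \<in> carrier G" if tT: "t \<in> T" for t
  proof -
    have t: "t \<in> carrier G" "t \<noteq> \<one>" using tT unfolding T_def by auto
    obtain n :: nat where n: "n > 0" "t [^] n = \<one>" using tT unfolding T_def by auto
    show "infinite (rcosets (centralizer_of t))"
    proof
      assume "finite (rcosets (centralizer_of t))"
      from finite_normal_subgroup_torsion[OF t(1) n this] obtain K where "K \<lhd> G" "finite K" "t \<in> K" by blast
      then show False using nf t(2) unfolding no_nontrivial_finite_normal_subgroup_def by blast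
    qed
    show "t \<in> carrier G" by (rule t(1))
  qed
  \<comment> \<open>All elements inverting some power of \<open>a\<close> lie in one coset of the
    centralizer of \<open>a\<close>, that of any of them, \<open>w0\<close>. If there are none,
    \<open>w0 = \<one>\<close> and the coset is the centralizer itself.\<close>
  define rev where "rev w \<longleftrightarrow> w \<in> carrier G \<and> (\<exists>s::nat. s > 0 \<and> w \<otimes> a [^] s \<otimes> inv w = inv (a [^] s))" for w
  define w0 where "w0 = (if \<exists>w. rev w then SOME w. rev w else \<one>)"
  have w0: "rev w0" if "rev w" for w using that someI_ex[of rev] by (auto simp: w0_def)
  have w0c: "w0 \<in> carrier G" using someI_ex[of rev] by (auto simp: w0_def rev_def)
  define I where "I = {(?C, \<one>), (?C, w0)} \<union> (\<lambda>t. (centralizer_of t, \<one>)) ` T"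
  have "\<exists>w\<in>N. \<forall>i\<in>I. w \<otimes> inv (snd i) \<notin> fst i"
  proof (rule avoid_cosets_infinite_index[OF N.subgroup_axioms N(2)])
    show "finite I" using T by (simp add: I_def)
    show "subgroup (fst i) G" if "i \<in> I" for i
      using that subgroup_centralizer_of ac Tc by (auto simp: I_def)
    show "snd i \<in> carrier G" if "i \<in> I" for i using that w0c by (auto simp: I_def)
    show "infinite (rcosets (fst i))" if "i \<in> I" for i using that Cinf Tinf by (auto simp: I_def)
  qed
  then obtain w where w: "w \<in> N" "\<And>i. i \<in> I \<Longrightarrow> w \<otimes> inv (snd i) \<notin> fst i" by blast
  have wc: "w \<in> carrier G" using w(1) by simp
  have wC: "w \<notin> ?C" using w(2)[of "(?C, \<one>)"] wc by (simp add: I_def)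
  have ww0: "w \<otimes> inv w0 \<notin> ?C" using w(2)[of "(?C, w0)"] by (simp add: I_def)
  have wT: "w \<notin> centralizer_of t" if "t \<in> T" for t
    using w(2)[of "(centralizer_of t, \<one>)"] wc that by (simp add: I_def)
  have no: "w \<otimes> a [^] s \<otimes> inv w \<noteq> inv (a [^] s)" if s: "s > 0" for s :: nat
  proof
    assume ws: "w \<otimes> a [^] s \<otimes> inv w = inv (a [^] s)"
    then have "rev w" unfolding rev_def using wc s by blast
    then have "rev w0" by (rule w0)
    then obtain s0 :: nat where s0: "s0 > 0" "w0 \<otimes> a [^] s0 \<otimes> inv w0 = inv (a [^] s0)" by (auto simp: rev_def)
    have cp: "(x \<otimes> y \<otimes> inv x) [^] k = x \<otimes> y [^] k \<otimes> inv x" if "x \<in> carrier G" "y \<in> carrier G" for x y and k :: nat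
      by (induction k) (use that in \<open>simp_all add: group_norm\<close>)
    \<comment> \<open>Both \<open>w\<close> and \<open>w0\<close> invert the common power
      \<open>a^(s s0)\<close>, so \<open>w w0^-1\<close> commutes with it and hence with
      \<open>a\<close>.\<close>
    let ?S = "s * s0"
    let ?b = "a [^] ?S"
    have b: "?b \<in> carrier G" using ac by simp
    have p1: "(a [^] s) [^] s0 = ?b" using nat_pow_pow[OF ac, of s s0] .
    have p2: "(a [^] s0) [^] s = ?b" using nat_pow_pow[OF ac, of s0 s] unfolding mult.commute[of s0 s] .
    have ip: "(inv x) [^] k = inv (x [^] k)" if "x \<in> carrier G" for x and k :: nat
      using nat_pow_inv[OF that] .
    have b1: "w \<otimes> ?b \<otimes> inv w = inv ?b"
      using cp[OF wc, of "a [^] s" s0] ac unfolding ws by (simp add: ip p1)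
    have b2: "w0 \<otimes> ?b \<otimes> inv w0 = inv ?b"
      using cp[OF w0c, of "a [^] s0" s] ac unfolding s0(2) by (simp add: ip p2)
    have "(w \<otimes> inv w0) \<otimes> inv ?b = w \<otimes> inv w0 \<otimes> (w0 \<otimes> ?b \<otimes> inv w0)" unfolding b2 ..
    also have "\<dots> = (w \<otimes> ?b \<otimes> inv w) \<otimes> (w \<otimes> inv w0)" using wc w0c b by (simp add: group_norm)
    also have "\<dots> = inv ?b \<otimes> (w \<otimes> inv w0)" unfolding b1 ..
    finally have "(w \<otimes> inv w0) \<otimes> inv ?b = inv ?b \<otimes> (w \<otimes> inv w0)" .
    from commute_inv[OF _ _ this] have "(w \<otimes> inv w0) \<otimes> ?b = ?b \<otimes> (w \<otimes> inv w0)" using wc w0c b by simp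
    then have "(w \<otimes> inv w0) \<otimes> a = a \<otimes> (w \<otimes> inv w0)"
      using full_centralizerD(3)[OF a(2), of "w \<otimes> inv w0" ?S] wc w0c s s0(1) by simp
    then show False using ww0 wc w0c by (simp add: mem_centralizer_of)
  qed
  obtain D n0 where D: "\<And>(n::nat) f. n \<ge> n0 \<Longrightarrow> f \<in> carrier G \<Longrightarrow> f \<otimes> (w \<otimes> a [^] n) = (w \<otimes> a [^] n) \<otimes> f \<Longrightarrow>
     \<exists>k::int. len ((w \<otimes> a [^] n) [^] k \<otimes> f) \<le> D"
    using centralizer_bounded[OF a(2) wc wC no] by metis
  have hN: "w \<otimes> a [^] n \<in> N" for n :: nat
    using w(1) subgroup_int_pow_closed[OF N.subgroup_axioms a(1), of "int n"] by (simp add: int_pow_int)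
  define Cm where "Cm n f \<longleftrightarrow> f \<in> carrier G \<and> f \<otimes> (w \<otimes> a [^] n) = (w \<otimes> a [^] n) \<otimes> f" for n :: nat and f
  have "\<exists>n. \<forall>f. Cm n f \<longrightarrow> f \<in> N"
  proof (rule ccontr)
    assume "\<not> (\<exists>n. \<forall>f. Cm n f \<longrightarrow> f \<in> N)"
    then have bad: "\<exists>f. Cm n f \<and> f \<notin> N" for n by blast
    define Q where "Q n g \<longleftrightarrow> g \<in> carrier G \<and> g \<otimes> (w \<otimes> a [^] n) = (w \<otimes> a [^] n) \<otimes> g \<and> g \<notin> N \<and> len g \<le> D" for n :: nat and g
    have ex: "\<exists>g. Q n g" if n: "n \<ge> n0" for n :: nat
    proof -
      obtain f where f: "f \<in> carrier G" "f \<otimes> (w \<otimes> a [^] n) = (w \<otimes> a [^] n) \<otimes> f" "f \<notin> N"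
        using bad[of n] unfolding Cm_def by blast
      obtain k :: int where k: "len ((w \<otimes> a [^] n) [^] k \<otimes> f) \<le> D" using D[OF n f(1,2)] by blast
      let ?h = "w \<otimes> a [^] n"
      have hc: "?h \<in> carrier G" using hN[of n] by simp
      have hk: "?h [^] k \<in> N" by (rule subgroup_int_pow_closed[OF N.subgroup_axioms hN])
      have hkc: "?h [^] k \<in> carrier G" using hc by simp
      have kh: "?h [^] k \<otimes> ?h = ?h \<otimes> ?h [^] k" using commute_int_pow[OF hc hc refl, of k] by simp
      have "?h [^] k \<otimes> f \<otimes> ?h = ?h \<otimes> (?h [^] k \<otimes> f)" by (rule commute_mult[OF hkc f(1) hc kh f(2)])
      moreover have "?h [^] k \<otimes> f \<notin> N"
      proof
        assume "?h [^] k \<otimes> f \<in> N"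
        from N.m_closed[OF N.m_inv_closed[OF hk] this] have "inv (?h [^] k) \<otimes> (?h [^] k \<otimes> f) \<in> N" .
        then show False using f(1,3) hkc by (simp only: inv_m_cancel)
      qed
      ultimately have "Q n (?h [^] k \<otimes> f)" unfolding Q_def using k hkc f(1) by simp
      then show ?thesis by blast
    qed
    define g where "g j = (SOME g. Q (n0 + j) g)" for j
    have g: "Q (n0 + j) (g j)" for j unfolding g_def by (rule someI_ex[OF ex]) simp
    have "\<not> inj g"
    proof
      assume "inj g"
      have "range g \<subseteq> {g \<in> carrier G. len g \<le> D}" using g by (auto simp: Q_def)
      then have "finite (range g)" using finite_ball by (rule finite_subset)
      then have "finite (UNIV :: nat set)" using \<open>inj g\<close> by (rule finite_imageD)
      then show False by simp
    qed
    then obtain i j where ij: "i < j" "g i = g j" unfolding inj_def by (metis linorder_neqE_nat)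
    define f where "f = g i"
    define n s where "n = n0 + i" and "s = j - i"
    have f: "f \<in> carrier G" "f \<notin> N" "f \<otimes> (w \<otimes> a [^] n) = (w \<otimes> a [^] n) \<otimes> f"
      using g[of i] by (simp_all add: Q_def f_def n_def)
    have f2: "f \<otimes> (w \<otimes> a [^] (n + s)) = (w \<otimes> a [^] (n + s)) \<otimes> f"
      using g[of j] ij by (simp add: Q_def f_def n_def s_def)
    let ?h = "w \<otimes> a [^] n"
    have hc: "?h \<in> carrier G" using hN[of n] by simp
    \<comment> \<open>\<open>a^s\<close> is the quotient of \<open>w a^n\<close> and
      \<open>w a^(n+s)\<close>, and \<open>f\<close> commutes with both.\<close>
    have "a [^] s = inv ?h \<otimes> (w \<otimes> a [^] (n + s))"
      using wc ac nat_pow_mult[OF ac, of n s] by (simp add: group_norm flip: nat_pow_mult)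
    moreover have "inv ?h \<otimes> f = f \<otimes> inv ?h" using commute_inv[OF f(1) hc f(3)] by simp
    then have "inv ?h \<otimes> (w \<otimes> a [^] (n + s)) \<otimes> f = f \<otimes> (inv ?h \<otimes> (w \<otimes> a [^] (n + s)))"
      by (rule commute_mult[rotated 3]) (use wc ac hc f(1) f2 in simp_all)
    ultimately have "f \<otimes> a [^] s = a [^] s \<otimes> f" by simp
    then have fa: "f \<otimes> a = a \<otimes> f" using full_centralizerD(3)[OF a(2) f(1), of s] ij(1) by (simp add: s_def)
    have fC: "f \<in> ?C" using fa f(1) by (simp add: mem_centralizer_of)
    have "w = ?h \<otimes> inv (a [^] n)" using wc ac by (simp add: group_norm)
    moreover have "inv (a [^] n) \<otimes> f = f \<otimes> inv (a [^] n)"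
      using commute_inv[OF f(1) _ commute_nat_pow[OF f(1) ac fa, of n]] ac by simp
    then have "?h \<otimes> inv (a [^] n) \<otimes> f = f \<otimes> (?h \<otimes> inv (a [^] n))"
      using f(3) hc ac by (intro commute_mult[OF hc _ f(1)]) simp_all
    ultimately have wf: "w \<otimes> f = f \<otimes> w" by simp
    obtain m :: nat and l :: int where ml: "m > 0" "f [^] m = a [^] l"
      by (rule centralizer_power_in_axis[OF sa fC])
    show False
    proof (cases "l = 0")
      case True
      then have "f [^] m = \<one>" using ml(2) by simp
      moreover have "f \<noteq> \<one>" using f(2) N.one_closed by blast
      ultimately have "f \<in> T" unfolding T_def using fC ml(1) by blast
      then show False using wT wc wf by (auto simp: mem_centralizer_of)
    next
      case False
      have wl: "w \<otimes> a [^] l = a [^] l \<otimes> w" using commute_nat_pow[OF wc f(1) wf, of m] unfolding ml(2) .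
      have "w \<otimes> a [^] nat \<bar>l\<bar> = a [^] nat \<bar>l\<bar> \<otimes> w"
      proof (cases "l < 0")
        case True
        then have "a [^] nat \<bar>l\<bar> = inv (a [^] l)" using ac int_pow_int[of G a "nat \<bar>l\<bar>"] int_pow_neg[OF ac, of l] by simp
        then show ?thesis using commute_inv[OF wc _ wl] ac by simp
      next
        case False
        then have "a [^] nat \<bar>l\<bar> = a [^] l" using int_pow_int[of G a "nat \<bar>l\<bar>"] by simp
        then show ?thesis using wl by simp
      qed
      then have "w \<otimes> a = a \<otimes> w" using full_centralizerD(3)[OF a(2) wc, of "nat \<bar>l\<bar>"] False by simp
      then show False using wC wc by (simp add: mem_centralizer_of)
    qed
  qed
  then obtain n where n: "\<And>f. Cm n f \<Longrightarrow> f \<in> N" by blast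
  show ?thesis
    by (rule bexI[OF _ hN[of n]], intro ballI impI, rule n) (simp add: Cm_def)
qed

end

lemma hyperbolic_group_centralizer:
  assumes "hyperbolic_group A" "\<not> elementary_group A" "no_nontrivial_finite_normal_subgroup A"
    and "N \<lhd> A" "finite (rcosets\<^bsub>A\<^esub> N)"
  shows "\<exists>h\<in>N. \<forall>f\<in>carrier A. f \<otimes>\<^bsub>A\<^esub> h = h \<otimes>\<^bsub>A\<^esub> f \<longrightarrow> f \<in> N"
proof -
  obtain S \<delta> where S: "group A" "finite S" "S \<subseteq> carrier A" "generate A S = carrier A" "\<delta> \<ge> 0"
    "\<forall>w\<in>carrier A. \<forall>x\<in>carrier A. \<forall>y\<in>carrier A. \<forall>z\<in>carrier A.
        Gromov_product (word_metric A S) w x z \<ge>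
          min (Gromov_product (word_metric A S) w x y) (Gromov_product (word_metric A S) w y z) - \<delta>"
    using assms(1) unfolding hyperbolic_group_def Gromov_hyperbolic_on_def by blast
  interpret hyperbolic A S \<delta>
    using S by (simp add: hyperbolic_def hyperbolic_axioms_def)
  show ?thesis by (rule exists_centralizer_in_normal[OF assms(2-5)])
qed

section \<open>The equivalence\<close>

lemma exists_centralizer_in_finite_index:
  assumes "(is_free_group F \<and> \<not> comm_group F) \<or>
      (hyperbolic_group F \<and> \<not> elementary_group F \<and> no_nontrivial_finite_normal_subgroup F)"
    and "N \<lhd> F" "finite (rcosets\<^bsub>F\<^esub> N)"
  shows "\<exists>h\<in>N. \<forall>f\<in>carrier F. f \<otimes>\<^bsub>F\<^esub> h = h \<otimes>\<^bsub>F\<^esub> f \<longrightarrow> f \<in> N"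
  using assms(1)
proof
  assume F: "is_free_group F \<and> \<not> comm_group F"
  obtain X a b where "free_group F X" "a \<in> X" "b \<in> X" "a \<noteq> b"
    by (rule is_free_group_nonabelian[of F]) (use F in simp_all)
  then show ?thesis by (rule free_group_centralizer[OF _ _ _ _ assms(2,3)])
next
  assume "hyperbolic_group F \<and> \<not> elementary_group F \<and> no_nontrivial_finite_normal_subgroup F"
  then show ?thesis using hyperbolic_group_centralizer[OF _ _ _ assms(2,3)] by simp
qed

lemma (in pseudovariety) coset_conjugacy_separable_factor:
  assumes "is_free_group F \<or> (group F \<and> hereditarily_conjugacy_separable \<C> F)"
  shows "coset_conjugacy_separable \<C> F"
  using assms
proof
  assume "is_free_group F"
  then obtain X where "free_group F X"
    by (auto simp: is_free_group_def free_group_def free_group_axioms_def)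
  then show ?thesis by (rule coset_conjugacy_separable_free)
next
  assume "group F \<and> hereditarily_conjugacy_separable \<C> F"
  then show ?thesis using coset_conjugacy_separable_hereditarily by blast
qed

theorem corollary1p2:
  fixes \<C> :: "nat monoid set"
    and F\<^sub>1 :: "'a monoid" and F\<^sub>2 :: "'b monoid"
    and G :: "('a \<times> 'b) set"
  assumes "pseudovariety_of_finite_groups \<C>" and "nontrivial_class \<C>" and "extension_closed \<C>"
    and "(is_free_group F\<^sub>1 \<and> \<not> comm_group F\<^sub>1) \<or>
         (hyperbolic_group F\<^sub>1 \<and> \<not> elementary_group F\<^sub>1 \<and>
          hereditarily_conjugacy_separable \<C> F\<^sub>1 \<and> no_nontrivial_finite_normal_subgroup F\<^sub>1)"
    and "(is_free_group F\<^sub>2 \<and> \<not> comm_group F\<^sub>2) \<or>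
         (hyperbolic_group F\<^sub>2 \<and> \<not> elementary_group F\<^sub>2 \<and>
          hereditarily_conjugacy_separable \<C> F\<^sub>2 \<and> no_nontrivial_finite_normal_subgroup F\<^sub>2)"
    and "subdirect_product F\<^sub>1 F\<^sub>2 G"
    and "finite_index (F\<^sub>1 \<times>\<times> F\<^sub>2) G"
  shows "(conjugacy_separable \<C> ((F\<^sub>1 \<times>\<times> F\<^sub>2)\<lparr>carrier := G\<rparr>)
            \<longleftrightarrow> in_class \<C> (F\<^sub>1 Mod (inter_first_factor F\<^sub>1 F\<^sub>2 G)))
       \<and> (in_class \<C> (F\<^sub>1 Mod (inter_first_factor F\<^sub>1 F\<^sub>2 G))
            \<longleftrightarrow> openin (pro_topology \<C> (F\<^sub>1 \<times>\<times> F\<^sub>2)) G)"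
proof -
  interpret C: pseudovariety \<C> using assms(1-3) by (rule pseudovariety.intro)
  have groups: "group F\<^sub>1" "group F\<^sub>2"
    using assms(4,5) by (auto simp: is_free_group_def hyperbolic_group_def)
  interpret S: subdirect_pseudovariety F\<^sub>1 F\<^sub>2 G \<C>
    using C.pseudovariety_axioms groups assms(6)
    by (simp add: subdirect_pseudovariety_def subdirect_def)
  have "coset_conjugacy_separable \<C> F\<^sub>1" "coset_conjugacy_separable \<C> F\<^sub>2"
    using assms(4,5) groups by (auto intro!: C.coset_conjugacy_separable_factor)
  moreover have "\<exists>h\<in>S.N1. \<forall>f\<in>carrier F\<^sub>1. f \<otimes>\<^bsub>F\<^sub>1\<^esub> h = h \<otimes>\<^bsub>F\<^sub>1\<^esub> f \<longrightarrow> f \<in> S.N1"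
    by (rule exists_centralizer_in_finite_index[OF _ S.N1_normal S.finite_index_N1[OF assms(7)]])
      (use assms(4) in blast)
  moreover have "\<exists>h\<in>S.N2. \<forall>f\<in>carrier F\<^sub>2. f \<otimes>\<^bsub>F\<^sub>2\<^esub> h = h \<otimes>\<^bsub>F\<^sub>2\<^esub> f \<longrightarrow> f \<in> S.N2"
    by (rule exists_centralizer_in_finite_index[OF _ S.N2_normal S.finite_index_N2[OF assms(7)]])
      (use assms(5) in blast)
  ultimately have "conjugacy_separable \<C> ((F\<^sub>1 \<times>\<times> F\<^sub>2)\<lparr>carrier := G\<rparr>) \<longleftrightarrow> open_normal \<C> F\<^sub>1 S.N1"
    by (rule S.corollary_iff[OF _ _ assms(7)])
  moreover have "open_normal \<C> F\<^sub>1 S.N1 \<longleftrightarrow> in_class \<C> (F\<^sub>1 Mod (inter_first_factor F\<^sub>1 F\<^sub>2 G))"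
    using S.N1_normal unfolding open_normal_def S.N1_def by blast
  ultimately show ?thesis using S.open_iff by blast
qed

end
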